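(* Let $k,j\in\{1,\ldots,n\}$ and $\boldsymbol{A}:=(A_1,\ldots,A_n)$, where $A_k:=\begin{bmatrix}a_k&b_k\\c_k&d_k\end{bmatrix}$ is a real $2\times2$ matrix with determinant $1$ and both $b_k\neq0$ and $a_k=d_k$ for all $k$, and let $\boldsymbol{a}:=(a_1,\ldots,a_n)$, $\boldsymbol{b}:=(b_1,\ldots,b_n)$, and $\boldsymbol{d}:=(d_1,\ldots,d_n)$. From the perspective of the linear canonical transform $\mathscr{L}_{\boldsymbol{A}}$, the $j$th linear canonical Riesz transform $R_j^{\boldsymbol{A}}$ is given by the multiplication by the function $-i\,\frac{\omega_j}{b_j}\big/\left|\frac{\boldsymbol{\omega}}{\boldsymbol{b}}\right|$. That is, for any $f\in\mathscr{S}(\mathbb{R}^n)$ and any $\boldsymbol{\omega}=(\omega_1,\ldots,\omega_n)\in\mathbb{R}^n$, one has $$\mathscr{L}_{\boldsymbol{A}}\left[R_j^{\boldsymbol{A}}(f)\right](\boldsymbol{\omega})=-i\,\frac{\frac{\omega_j}{b_j}}{\left|\frac{\boldsymbol{\omega}}{\boldsymbol{b}}\right|}\,\mathscr{L}_{\boldsymbol{A}}(f)(\boldsymbol{\omega}),$$ where $\frac{\boldsymbol{\omega}}{\boldsymbol{b}}:=\left(\frac{\omega_1}{b_1},\ldots,\frac{\omega_n}{b_n}\right)$.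
   Context: $\mathscr{S}(\mathbb{R}^n)$ is the space of Schwartz functions on $\mathbb{R}^n$, and $|\cdot|$ is the Euclidean norm. Linear canonical transform (LCT). For $\boldsymbol{A}=(A_1,\ldots,A_n)$ with each $A_k=\begin{bmatrix}a_k&b_k\\c_k&d_k\end{bmatrix}$ a real matrix of determinant $1$ and $b_k\neq0$, the LCT of $f\in\mathscr{S}(\mathbb{R}^n)$ is defined by setting, for any $\boldsymbol{u}=(u_1,\ldots,u_n)\in\mathbb{R}^n$, $$\mathscr{L}_{\boldsymbol{A}}(f)(\boldsymbol{u}):=\int_{\mathbb{R}^n}f(\boldsymbol{x})\prod_{k=1}^nK_{A_k}(x_k,u_k)\,d\boldsymbol{x},$$ where $$K_{A_k}(x_k,u_k):=C_{A_k}\,e^{i\frac{a_k}{2b_k}x_k^2}\,e^{-i\frac{u_kx_k}{b_k}}\,e^{i\frac{d_k}{2b_k}u_k^2},\qquad C_{A_k}:=\sqrt{\frac{1}{i2\pi b_k}}.$$ Linear canonical Riesz transform (LCRT). For the same $\boldsymbol{A}$ and any given $j\in\{1,\ldots,n\}$, the $j$th LCRT of $f\in\mathscr{S}(\mathbb{R}^n)$ is defined by setting, for any $\boldsymbol{x}=(x_1,\ldots,x_n)\in\mathbb{R}^n$, $$R_j^{\boldsymbol{A}}(f)(\boldsymbol{x}):=\widetilde{c}_n\,e^{-i\sum_{k=1}^n\frac{d_k}{2b_k}x_k^2}\ \mathrm{p.v.}\int_{\mathbb{R}^n}\frac{(x_j-y_j)\,f(\boldsymbol{y})\,e^{i\sum_{k=1}^n\frac{a_k}{2b_k}y_k^2}}{|\boldsymbol{x}-\boldsymbol{y}|^{n+1}}\,d\boldsymbol{y},\qquad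 \widetilde{c}_n:=\frac{\Gamma\left(\frac{n+1}{2}\right)}{\pi^{\frac{n+1}{2}}},$$ where $\mathrm{p.v.}\int_{\mathbb{R}^n}$ denotes the principal value $\lim_{\varepsilon\to0^+}\int_{|\boldsymbol{x}-\boldsymbol{y}|\geq\varepsilon}$.
   Formalization: Since R_j^A(f) is in general not integrable, its transform is read as the limit of the defining integral over balls |x| ≤ r as r → ∞, proved both at every ω and in L²; at ω = 0 the undefined symbol 0/0 is taken to be 0. *)

theory Defs
  imports "HOL-Analysis.Analysis"
begin

text \<open>
  Throughout, \<open>\<real>\<^sup>n\<close> is \<^typ>\<open>real^'n\<close> with \<open>n = CARD('n)\<close>, and a parameter
  \<open>A :: 'n \<Rightarrow> real^2^2\<close> is the tuple of \<open>2 \<times> 2\<close> matrices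
  \<open>A k = ((a\<^sub>k, b\<^sub>k), (c\<^sub>k, d\<^sub>k))\<close>.
\<close>

abbreviation mat_a :: "real^2^2 \<Rightarrow> real" where "mat_a M \<equiv> M $ 1 $ 1"
abbreviation mat_b :: "real^2^2 \<Rightarrow> real" where "mat_b M \<equiv> M $ 1 $ 2"
abbreviation mat_d :: "real^2^2 \<Rightarrow> real" where "mat_d M \<equiv> M $ 2 $ 2"


definition partial_deriv :: "'n \<Rightarrow> (real^'n \<Rightarrow> complex) \<Rightarrow> real^'n \<Rightarrow> complex" where
  "partial_deriv k f x = frechet_derivative f (at x) (axis k 1)"

text \<open>
  A multi-index derivative is given by a list of directions. All iterated partial derivatives
  being totally differentiable everywhere is the same as \<open>f\<close> being of class \<open>C\<^sup>\<infinity>\<close>.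
\<close>

definition partial_derivs :: "'n list \<Rightarrow> (real^'n \<Rightarrow> complex) \<Rightarrow> real^'n \<Rightarrow> complex" where
  "partial_derivs ks f = foldr partial_deriv ks f"

definition schwartz :: "(real^'n \<Rightarrow> complex) \<Rightarrow> bool" where
  "schwartz f \<longleftrightarrow>
     (\<forall>ks x. partial_derivs ks f differentiable (at x)) \<and>
     (\<forall>ks (\<alpha> :: 'n \<Rightarrow> nat).
        bounded (range (\<lambda>x. of_real (\<Prod>k\<in>UNIV. x $ k ^ \<alpha> k) * partial_derivs ks f x)))"


definition lct_kernel :: "real^2^2 \<Rightarrow> real \<Rightarrow> real \<Rightarrow> complex" where
  "lct_kernel M x u =
     csqrt (1 / (\<i> * of_real (2 * pi * mat_b M)))
       * exp (\<i> * of_real (mat_a M / (2 * mat_b M) * x\<^sup>2))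
       * exp (- \<i> * of_real (u * x / mat_b M))
       * exp (\<i> * of_real (mat_d M / (2 * mat_b M) * u\<^sup>2))"

definition lct :: "('n \<Rightarrow> real^2^2) \<Rightarrow> (real^'n \<Rightarrow> complex) \<Rightarrow> real^'n \<Rightarrow> complex" where
  "lct A f u = (LINT x|lborel. f x * (\<Prod>k\<in>UNIV. lct_kernel (A k) (x $ k) (u $ k)))"

text \<open>
  The Riesz transform of a Schwartz function is square integrable but in general only
  \<open>O(|x|\<^sup>-\<^sup>n)\<close> at infinity, so the integral defining its linear canonical transform need not
  converge absolutely. The transform is then obtained from the integrals over the balls
  \<open>|x| \<le> r\<close> as \<open>r \<rightarrow> \<infinity>\<close>: in the mean, which (by Plancherel) gives the
  continuous extension of \<^const>\<open>lct\<close> to \<open>L\<^sup>2\<close>, or pointwise, as an improper integral.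
  For an integrable function the pointwise limit is \<^const>\<open>lct\<close> itself.
\<close>

definition lct_trunc ::
    "('n \<Rightarrow> real^2^2) \<Rightarrow> real \<Rightarrow> (real^'n \<Rightarrow> complex) \<Rightarrow> real^'n \<Rightarrow> complex" where
  "lct_trunc A r g = lct A (\<lambda>x. indicator (cball 0 r) x * g x)"

definition square_integrable :: "(real^'n \<Rightarrow> complex) \<Rightarrow> bool" where
  "square_integrable g \<longleftrightarrow>
     g \<in> borel_measurable lborel \<and> integrable lborel (\<lambda>x. (cmod (g x))\<^sup>2)"

definition has_lct_L2 ::
    "('n \<Rightarrow> real^2^2) \<Rightarrow> (real^'n \<Rightarrow> complex) \<Rightarrow> (real^'n \<Rightarrow> complex) \<Rightarrow> bool" where
  "has_lct_L2 A g G \<longleftrightarrow>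
     square_integrable g \<and> square_integrable G \<and>
     ((\<lambda>r. \<integral>\<^sup>+ u. ennreal ((cmod (lct_trunc A r g u - G u))\<^sup>2) \<partial>lborel) \<longlongrightarrow> 0) at_top"

definition has_lct_at ::
    "('n \<Rightarrow> real^2^2) \<Rightarrow> (real^'n \<Rightarrow> complex) \<Rightarrow> real^'n \<Rightarrow> complex \<Rightarrow> bool" where
  "has_lct_at A g u l \<longleftrightarrow> ((\<lambda>r. lct_trunc A r g u) \<longlongrightarrow> l) at_top"


definition riesz_const :: "nat \<Rightarrow> real" where
  "riesz_const n = Gamma ((real n + 1) / 2) / pi powr ((real n + 1) / 2)"

definition lcrt :: "('n \<Rightarrow> real^2^2) \<Rightarrow> 'n \<Rightarrow> (real^'n \<Rightarrow> complex) \<Rightarrow> real^'n \<Rightarrow> complex" where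
  "lcrt A j f x =
     of_real (riesz_const CARD('n))
       * exp (- \<i> * of_real (\<Sum>k\<in>UNIV. mat_d (A k) / (2 * mat_b (A k)) * (x $ k)\<^sup>2))
       * Lim (at_right 0) (\<lambda>\<epsilon>.
           LINT y:{y. norm (x - y) \<ge> \<epsilon>}|lborel.
             of_real (x $ j - y $ j) * f y
               * exp (\<i> * of_real (\<Sum>k\<in>UNIV. mat_a (A k) / (2 * mat_b (A k)) * (y $ k)\<^sup>2))
               / of_real (norm (x - y) ^ (CARD('n) + 1)))"

text \<open>At \<open>\<omega> = 0\<close>, where the symbol is \<open>0/0\<close>, it takes the value \<open>0\<close>.\<close>

definition lcrt_symbol :: "('n \<Rightarrow> real^2^2) \<Rightarrow> 'n \<Rightarrow> real^'n \<Rightarrow> complex" where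
  "lcrt_symbol A j \<omega> =
     - \<i> * of_real ((\<omega> $ j / mat_b (A j)) / norm (\<chi> k. \<omega> $ k / mat_b (A k)))"

end

theory Submission
  imports Defs "HOL-Probability.Characteristic_Functions"
begin

text \<open>
  Let \<open>g\<close> be the product of \<open>f\<close> with the chirp \<open>exp (i \<Sum>\<^sub>k a\<^sub>k y\<^sub>k\<^sup>2 / (2 b\<^sub>k))\<close>. The linear canonical transform of a function is the
  Fourier transform of its product with this chirp, read at \<open>\<omega> / b\<close> and multiplied by a factor of constant modulus
  (\<open>lct_eq_fourier\<close>). The linear canonical Riesz transform of \<open>f\<close> is the classical Riesz transform \<open>R g\<close> times the
  inverse chirp, since \<open>a = d\<close> (\<open>lcrt_eq_riesz_transform\<close>). The chirps cancel, and it remains to show that the integrals of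
  \<open>R g x \<cdot> exp (- i x \<bullet> \<xi>)\<close> over the balls \<open>|x| \<le> r\<close> tend to \<open>- i (\<xi>\<^sub>j / |\<xi>|)\<close> times the Fourier transform of
  \<open>g\<close>, for every \<open>\<xi>\<close> and in the mean. For this \<open>g\<close> only has to be a decaying function of class \<open>C\<^sup>1\<close> (locale
  \<open>decaying_C1\<close>).

  In general \<open>R g\<close> is no better than \<open>O(|x|\<^sup>-\<^sup>n)\<close>, so these integrals do not converge absolutely. They are first replaced by
  Gaussian means, with the weight \<open>exp (- \<delta> |x|\<^sup>2)\<close> in place of the indicator of a ball. The Gamma integral writes the
  Riesz kernel as a superposition of the functions \<open>z\<^sub>j exp (- t |z|\<^sup>2)\<close>; after an exchange of integrals every integral over
  the space is Gaussian and explicit (\<open>riesz_gaussian_mean\<close>), and dominated convergence gives the limit for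
  \<open>\<delta> \<rightarrow> 0\<close>, at the origin as well (\<open>riesz_gaussian_means_tendsto\<close>).

  The step from Gaussian means to balls is Tauberian: for a function that is \<open>O(|x|\<^sup>-\<^sup>n)\<close>, convergence of the Gaussian
  means implies convergence of the integrals over balls, by Karamata's method of approximating the indicator of the unit
  ball by polynomials in \<open>exp (- |x|\<^sup>2)\<close> (\<open>gaussian_means_imp_ball_means\<close>). This gives the pointwise statement
  \<open>fourier_riesz_transform\<close>.

  The decay also makes \<open>R g\<close> square integrable. The Plancherel inequality (\<open>fourier_L2_le\<close>) and Fatou's lemma then turn
  pointwise convergence into convergence in the mean (\<open>fourier_ball_L2_tendsto\<close>).
\<close>

section \<open>Affine changes of variables and Gaussian integrals\<close>

lemma measurable_cis [measurable]: "cis \<in> borel_measurable borel"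
  unfolding cis_conv_exp by measurable

lemma measurable_cnj [measurable]: "cnj \<in> borel_measurable borel"
  by (intro borel_measurable_continuous_onI continuous_intros)

lemma
  fixes f :: "'a::euclidean_space \<Rightarrow> 'b::{banach, second_countable_topology}"
  assumes c: "c \<noteq> 0"
  shows integrable_affine_iff: "integrable lborel (\<lambda>x. f (t + c *\<^sub>R x)) \<longleftrightarrow> integrable lborel f"
    and integral_affine: "(\<integral>x. f x \<partial>lborel) = \<bar>c\<bar> ^ DIM('a) *\<^sub>R (\<integral>x. f (t + c *\<^sub>R x) \<partial>lborel)"
proof -
  let ?T = "\<lambda>x::'a. t + c *\<^sub>R x" and ?S = "\<lambda>x. (-t /\<^sub>R c) + (1/c) *\<^sub>R x"
  \<comment> \<open>Both claims also cover functions that are not measurable, since the substitution can be inverted.\<close>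
  have meas: "f \<in> borel_measurable borel" if "(\<lambda>x. f (?T x)) \<in> borel_measurable borel"
  proof -
    have "(\<lambda>x. f (?T (?S x))) \<in> borel_measurable borel"
      by (rule measurable_compose[OF _ that]) measurable
    moreover have "?T (?S x) = x" for x
      using c by (simp add: algebra_simps)
    ultimately show ?thesis by simp
  qed
  have meas': "(\<lambda>x. f (?T x)) \<in> borel_measurable borel" if "f \<in> borel_measurable borel"
    by (rule measurable_compose[OF _ that]) measurable
  show "integrable lborel (\<lambda>x. f (?T x)) \<longleftrightarrow> integrable lborel f"
  proof (cases "f \<in> borel_measurable borel")
    case True
    have "integrable lborel f \<longleftrightarrow> integrable (density (distr lborel borel ?T) (\<lambda>_. ennreal (\<bar>c\<bar> ^ DIM('a)))) f"
      by (subst lborel_affine[OF c, of t]) simp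
    also have "\<dots> \<longleftrightarrow> integrable lborel (\<lambda>x. \<bar>c\<bar> ^ DIM('a) *\<^sub>R f (?T x))"
      using True by (subst integrable_density) (simp_all add: integrable_distr_eq)
    also have "\<dots> \<longleftrightarrow> integrable lborel (\<lambda>x. f (?T x))"
      using c integrable_scaleR_right[of "inverse (\<bar>c\<bar> ^ DIM('a))" lborel "\<lambda>x. \<bar>c\<bar> ^ DIM('a) *\<^sub>R f (?T x)"]
      by auto
    finally show ?thesis by simp
  next
    case False
    with meas show ?thesis
      by (auto dest: borel_measurable_integrable)
  qed
  note iff = this
  show "(\<integral>x. f x \<partial>lborel) = \<bar>c\<bar> ^ DIM('a) *\<^sub>R (\<integral>x. f (?T x) \<partial>lborel)"
  proof (cases "integrable lborel f")
    case True
    then have [measurable]: "f \<in> borel_measurable borel" by auto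
    have "(\<integral>x. f x \<partial>lborel) = (\<integral>x. f x \<partial>density (distr lborel borel ?T) (\<lambda>_. ennreal (\<bar>c\<bar> ^ DIM('a))))"
      by (subst lborel_affine[OF c, of t]) simp
    also have "\<dots> = \<bar>c\<bar> ^ DIM('a) *\<^sub>R (\<integral>x. f (?T x) \<partial>lborel)"
      by (subst integral_density) (auto simp: integral_distr)
    finally show ?thesis .
  next
    case False
    with iff show ?thesis by (simp add: not_integrable_integral_eq)
  qed
qed

lemma
  fixes f :: "'a::euclidean_space \<Rightarrow> 'b::{banach, second_countable_topology}"
  shows integrable_reflect_iff: "integrable lborel (\<lambda>x. f (a - x)) \<longleftrightarrow> integrable lborel f"
    and integral_reflect: "(\<integral>x. f (a - x) \<partial>lborel) = (\<integral>x. f x \<partial>lborel)"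
    and integrable_translate_iff: "integrable lborel (\<lambda>x. f (a + x)) \<longleftrightarrow> integrable lborel f"
    and integral_translate: "(\<integral>x. f (a + x) \<partial>lborel) = (\<integral>x. f x \<partial>lborel)"
proof -
  show "integrable lborel (\<lambda>x. f (a - x)) \<longleftrightarrow> integrable lborel f"
    using integrable_affine_iff[of "-1" f a] by simp
  show "integrable lborel (\<lambda>x. f (a + x)) \<longleftrightarrow> integrable lborel f"
    using integrable_affine_iff[of 1 f a] by simp
  show "(\<integral>x. f (a - x) \<partial>lborel) = (\<integral>x. f x \<partial>lborel)"
    by (rule sym) (use integral_affine[of "-1" f a] in simp)
  show "(\<integral>x. f (a + x) \<partial>lborel) = (\<integral>x. f x \<partial>lborel)"
    by (rule sym) (use integral_affine[of 1 f a] in simp)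
qed

lemma nn_integral_reflect:
  fixes f :: "'a::euclidean_space \<Rightarrow> ennreal"
  assumes [measurable]: "f \<in> borel_measurable borel"
  shows "(\<integral>\<^sup>+y. f (a - y) \<partial>lborel) = (\<integral>\<^sup>+y. f y \<partial>lborel)"
  by (subst (2) lborel_affine[of "-1" a]) (auto simp: nn_integral_density nn_integral_distr)

text \<open>
  Lebesgue measure on \<open>'a\<close> is the image of a product measure under the coordinate map, so a
  product of functions of single coordinates integrates factor by factor.
\<close>

lemma
  fixes h :: "'a::euclidean_space \<Rightarrow> real \<Rightarrow> 'b::{real_normed_field, banach, second_countable_topology}"
  assumes h: "\<And>b. b \<in> Basis \<Longrightarrow> integrable lborel (h b)"
  shows integrable_prod_Basis: "integrable lborel (\<lambda>x. \<Prod>b\<in>Basis. h b (x \<bullet> b))"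
    and integral_prod_Basis: "(\<integral>x. (\<Prod>b\<in>Basis. h b (x \<bullet> b)) \<partial>lborel) = (\<Prod>b\<in>Basis. \<integral>t. h b t \<partial>lborel)"
proof -
  interpret product_sigma_finite "\<lambda>_. lborel :: real measure" ..
  let ?P = "\<Pi>\<^sub>M b\<in>(Basis::'a set). (lborel::real measure)"
  have [measurable]: "\<And>b. b \<in> Basis \<Longrightarrow> h b \<in> borel_measurable borel"
    using h by auto
  have m: "(\<lambda>x::'a. \<Prod>b\<in>Basis. h b (x \<bullet> b)) \<in> borel_measurable borel" by measurable
  have T: "(\<lambda>f. \<Sum>b\<in>(Basis::'a set). f b *\<^sub>R b) \<in> ?P \<rightarrow>\<^sub>M borel" by measurable
  have *: "(\<Prod>b\<in>Basis. h b ((\<Sum>c\<in>Basis. f c *\<^sub>R c) \<bullet> b)) = (\<Prod>b\<in>Basis. h b (f b))" for f :: "'a \<Rightarrow> real"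
    by (intro prod.cong) auto
  show "integrable lborel (\<lambda>x. \<Prod>b\<in>Basis. h b (x \<bullet> b))"
    unfolding lborel_eq[where 'a='a] integrable_distr_eq[OF T m] *
    using h by (intro product_integrable_prod) auto
  show "(\<integral>x. (\<Prod>b\<in>Basis. h b (x \<bullet> b)) \<partial>lborel) = (\<Prod>b\<in>Basis. \<integral>t. h b t \<partial>lborel)"
    unfolding lborel_eq[where 'a='a] integral_distr[OF T m] *
    using h by (intro product_integral_prod) auto
qed

text \<open>
  The characteristic function of the standard normal distribution, rescaled by \<open>\<surd>(2 s)\<close>.
\<close>

lemma
  fixes s \<xi> :: real
  assumes s: "s > 0"
  shows integrable_gaussian_real: "integrable lborel (\<lambda>w. exp (- s * w\<^sup>2) * \<bar>w\<bar> ^ k)"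
    and integral_gaussian_cis_real:
      "(\<integral>w. of_real (exp (- s * w\<^sup>2)) * cis (- (w * \<xi>)) \<partial>lborel) = of_real (sqrt (pi / s) * exp (- \<xi>\<^sup>2 / (4 * s)))"
proof -
  define c where "c = sqrt (2 * s)"
  have c: "c > 0" "c\<^sup>2 = 2 * s" using s by (auto simp: c_def)
  have dens: "std_normal_density (0 + c * w) = exp (- s * w\<^sup>2) / sqrt (2 * pi)" for w
    using c by (simp add: std_normal_density_def power_mult_distrib)
  have "integrable lborel (\<lambda>w. std_normal_density (0 + c * w) * \<bar>0 + c * w\<bar> ^ k)"
    using c by (intro lborel_integrable_real_affine integrable_std_normal_moment_abs) auto
  then have "integrable lborel (\<lambda>w. (sqrt (2 * pi) / c ^ k) * (std_normal_density (0 + c * w) * \<bar>0 + c * w\<bar> ^ k))"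
    by (rule integrable_mult_right)
  then show "integrable lborel (\<lambda>w. exp (- s * w\<^sup>2) * \<bar>w\<bar> ^ k)"
    unfolding dens using c by (simp add: abs_mult power_mult_distrib)
  have "of_real (exp (- (\<xi>/c)\<^sup>2 / 2)) = char std_normal_distribution (- \<xi> / c)"
    by (simp add: char_std_normal_distribution)
  also have "\<dots> = (\<integral>x. std_normal_density x *\<^sub>R cis (- (x * \<xi> / c)) \<partial>lborel)"
    unfolding char_def by (subst integral_density) (auto simp: cis_conv_exp mult_ac)
  also have "\<dots> = c *\<^sub>R (\<integral>w. std_normal_density (0 + c * w) *\<^sub>R cis (- ((0 + c * w) * \<xi> / c)) \<partial>lborel)"
    using c by (subst lborel_integral_real_affine[where c=c and t=0]) auto
  also have "\<dots> = c *\<^sub>R (\<integral>w. of_real (1 / sqrt (2 * pi)) * (of_real (exp (- s * w\<^sup>2)) * cis (- (w * \<xi>))) \<partial>lborel)"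
    unfolding dens using c by (simp add: scaleR_conv_of_real)
  also have "\<dots> = of_real (c / sqrt (2 * pi)) * (\<integral>w. of_real (exp (- s * w\<^sup>2)) * cis (- (w * \<xi>)) \<partial>lborel)"
    by (subst integral_mult_right_zero) (simp add: scaleR_conv_of_real)
  finally have "(\<integral>w. of_real (exp (- s * w\<^sup>2)) * cis (- (w * \<xi>)) \<partial>lborel)
      = of_real ((sqrt (2 * pi) / c) * exp (- (\<xi>/c)\<^sup>2 / 2))"
    using c by (simp add: field_simps)
  also have "sqrt (2 * pi) / c = sqrt (pi / s)"
    using s by (simp add: c_def real_sqrt_mult real_sqrt_divide)
  also have "- (\<xi>/c)\<^sup>2 / 2 = - \<xi>\<^sup>2 / (4 * s)"
    using c by (simp add: power_divide)
  finally show "(\<integral>w. of_real (exp (- s * w\<^sup>2)) * cis (- (w * \<xi>)) \<partial>lborel) = of_real (sqrt (pi / s) * exp (- \<xi>\<^sup>2 / (4 * s)))" .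
qed

lemma integrable_gaussian_cis_real:
  assumes "s > 0"
  shows "integrable lborel (\<lambda>w. of_real (exp (- s * w\<^sup>2)) * cis (- (w * \<xi>)))"
    and "integrable lborel (\<lambda>w. of_real (w * exp (- s * w\<^sup>2)) * cis (- (w * \<xi>)))"
proof -
  show "integrable lborel (\<lambda>w. of_real (exp (- s * w\<^sup>2)) * cis (- (w * \<xi>)))"
    by (rule Bochner_Integration.integrable_bound[OF integrable_gaussian_real[OF assms, of 0]]) (auto simp: norm_mult)
  show "integrable lborel (\<lambda>w. of_real (w * exp (- s * w\<^sup>2)) * cis (- (w * \<xi>)))"
    by (rule Bochner_Integration.integrable_bound[OF integrable_gaussian_real[OF assms, of 1]]) (auto simp: norm_mult)
qed

text \<open>
  The derivative of \<open>exp (- s w\<^sup>2) exp (- i w \<xi>)\<close> has integral \<open>0\<close> over the line, which expresses the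
  first moment through the integral of \<open>integral_gaussian_cis_real\<close>.
\<close>

lemma integral_gaussian_cis_real_1:
  fixes s \<xi> :: real
  assumes s: "s > 0"
  shows "(\<integral>w. of_real (w * exp (- s * w\<^sup>2)) * cis (- (w * \<xi>)) \<partial>lborel)
    = - \<i> * of_real (\<xi> / (2 * s)) * of_real (sqrt (pi / s) * exp (- \<xi>\<^sup>2 / (4 * s)))"
proof -
  define F where "F w = of_real (exp (- s * w\<^sup>2)) * cis (- (w * \<xi>))" for w
  define f where "f w = of_real (- 2 * s) * (of_real (w * exp (- s * w\<^sup>2)) * cis (- (w * \<xi>))) + (- \<i> * of_real \<xi>) * F w" for w
  have "(F has_vector_derivative f w) (at w)" for w
  proof -
    define G where "G z = exp (- of_real s * z\<^sup>2 - \<i> * of_real \<xi> * z)" for z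
    have F: "F v = G (of_real v)" for v
      by (simp add: F_def G_def cis_conv_exp exp_of_real[symmetric] exp_add[symmetric] exp_minus_inverse) (simp add: algebra_simps)
    have "(G has_field_derivative (G (of_real w) * (- of_real s * (2 * of_real w) - \<i> * of_real \<xi>))) (at (of_real w))"
      unfolding G_def by (auto intro!: derivative_eq_intros)
    then have "((\<lambda>v. G (of_real v)) has_vector_derivative (G (of_real w) * (- of_real s * (2 * of_real w) - \<i> * of_real \<xi>))) (at w)"
      by (rule has_vector_derivative_real_field)
    then have "(F has_vector_derivative (F w * (- of_real s * (2 * of_real w) - \<i> * of_real \<xi>))) (at w)"
      by (simp only: F[symmetric])
    also have "F w * (- of_real s * (2 * of_real w) - \<i> * of_real \<xi>) = f w"
      by (simp add: f_def F_def algebra_simps)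
    finally show ?thesis .
  qed
  note der = this
  have int: "integrable lborel f"
    unfolding f_def[abs_def] F_def using integrable_gaussian_cis_real[OF s] by (intro Bochner_Integration.integrable_add integrable_mult_right) auto
  have lim: "((\<lambda>w. exp (- s * w\<^sup>2)) \<longlongrightarrow> 0) at_top" "((\<lambda>w. exp (- s * w\<^sup>2)) \<longlongrightarrow> 0) at_bot"
  proof -
    have "filterlim (\<lambda>w::real. w\<^sup>2) at_top at_top" "filterlim (\<lambda>w::real. w\<^sup>2) at_top at_bot"
      by (auto intro!: filterlim_pow_at_top filterlim_ident filterlim_pow_at_bot_even[OF _ filterlim_ident])
    then have "filterlim (\<lambda>w. - s * w\<^sup>2) at_bot at_top" "filterlim (\<lambda>w. - s * w\<^sup>2) at_bot at_bot"
      using s filterlim_tendsto_neg_mult_at_bot[OF tendsto_const[of "- s"], where g="\<lambda>w. w\<^sup>2"] by simp_all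
    then show "((\<lambda>w. exp (- s * w\<^sup>2)) \<longlongrightarrow> 0) at_top" "((\<lambda>w. exp (- s * w\<^sup>2)) \<longlongrightarrow> 0) at_bot"
      by (auto intro: filterlim_compose[OF exp_at_bot])
  qed
  have "(LBINT w=-\<infinity>..\<infinity>. f w) = 0 - 0"
  proof (rule interval_integral_FTC_integrable)
    show "isCont f w" for w unfolding f_def[abs_def] F_def cis_conv_exp by (intro continuous_intros)
    show "set_integrable lborel (einterval (- \<infinity>) \<infinity>) f"
      using int by (simp add: set_integrable_def)
    have "(F \<longlongrightarrow> 0) at_top" "(F \<longlongrightarrow> 0) at_bot"
      by (rule tendsto_norm_zero_cancel, use lim in \<open>simp add: F_def norm_mult\<close>)+
    then show "((F \<circ> real_of_ereal) \<longlongrightarrow> 0) (at_left \<infinity>)" "((F \<circ> real_of_ereal) \<longlongrightarrow> 0) (at_right (-\<infinity>))"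
      by (simp_all add: ereal_tendsto_simps)
  qed (use der in \<open>simp_all\<close>)
  then have "(\<integral>w. f w \<partial>lborel) = 0"
    by (simp add: interval_lebesgue_integral_def set_lebesgue_integral_def)
  then have "of_real (- 2 * s) * (\<integral>w. of_real (w * exp (- s * w\<^sup>2)) * cis (- (w * \<xi>)) \<partial>lborel)
     + (- \<i> * of_real \<xi>) * (\<integral>w. F w \<partial>lborel) = 0"
    unfolding f_def[abs_def] F_def using integrable_gaussian_cis_real[OF s]
    by (subst (asm) Bochner_Integration.integral_add) auto
  then show ?thesis
    using s unfolding F_def integral_gaussian_cis_real[OF s] by (simp add: field_simps)
qed

lemma prod_cis: "finite A \<Longrightarrow> (\<Prod>a\<in>A. cis (f a)) = cis (\<Sum>a\<in>A. f a)"
  by (induction A rule: finite_induct) (auto simp: cis_mult)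

lemma exp_neg_norm_squared_eq_prod:
  "exp (- s * (norm (x :: 'a::euclidean_space))\<^sup>2) = (\<Prod>b\<in>Basis. exp (- s * (x \<bullet> b)\<^sup>2))"
  unfolding power2_norm_eq_inner exp_sum[OF finite_Basis, symmetric]
  by (subst euclidean_inner) (simp add: sum_distrib_left power2_eq_square)

lemma
  fixes \<xi> :: "'a::euclidean_space"
  assumes s: "s > 0"
  shows integrable_gaussian_cis: "integrable lborel (\<lambda>x. of_real (exp (- s * (norm x)\<^sup>2)) * cis (- (x \<bullet> \<xi>)))"
    and integral_gaussian_cis: "(\<integral>x. of_real (exp (- s * (norm x)\<^sup>2)) * cis (- (x \<bullet> \<xi>)) \<partial>lborel)
        = of_real (sqrt (pi / s) ^ DIM('a) * exp (- (norm \<xi>)\<^sup>2 / (4 * s)))"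
proof -
  define h where "h b t = of_real (exp (- s * t\<^sup>2)) * cis (- (t * (\<xi> \<bullet> b)))" for b t
  have eq: "of_real (exp (- s * (norm x)\<^sup>2)) * cis (- (x \<bullet> \<xi>)) = (\<Prod>b\<in>Basis. h b (x \<bullet> b))" for x
    unfolding h_def prod.distrib exp_neg_norm_squared_eq_prod prod_cis[OF finite_Basis] of_real_prod
    by (subst euclidean_inner) (simp add: sum_negf)
  have h: "integrable lborel (h b)" for b
    unfolding h_def[abs_def] using integrable_gaussian_cis_real[OF s] by simp
  show "integrable lborel (\<lambda>x. of_real (exp (- s * (norm x)\<^sup>2)) * cis (- (x \<bullet> \<xi>)))"
    unfolding eq by (rule integrable_prod_Basis) (rule h)
  have "(\<Prod>b\<in>Basis. exp (- (\<xi> \<bullet> b)\<^sup>2 / (4 * s))) = exp (- (norm \<xi>)\<^sup>2 / (4 * s))"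
    using exp_neg_norm_squared_eq_prod[of "1 / (4 * s)" \<xi>] by simp
  then show "(\<integral>x. of_real (exp (- s * (norm x)\<^sup>2)) * cis (- (x \<bullet> \<xi>)) \<partial>lborel)
        = of_real (sqrt (pi / s) ^ DIM('a) * exp (- (norm \<xi>)\<^sup>2 / (4 * s)))"
    unfolding eq integral_prod_Basis[OF h]
    unfolding h_def integral_gaussian_cis_real[OF s] of_real_prod[symmetric] by (simp add: prod.distrib)
qed

text \<open>
  Only the factor of the coordinate \<open>e\<close> differs from the product computed above: there the first
  moment replaces the plain Gaussian integral.
\<close>

lemma
  fixes \<xi> e :: "'a::euclidean_space"
  assumes s: "s > 0" and e: "e \<in> Basis"
  shows integrable_gaussian_cis_1: "integrable lborel (\<lambda>x. of_real ((x \<bullet> e) * exp (- s * (norm x)\<^sup>2)) * cis (- (x \<bullet> \<xi>)))"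
    and integral_gaussian_cis_1: "(\<integral>x. of_real ((x \<bullet> e) * exp (- s * (norm x)\<^sup>2)) * cis (- (x \<bullet> \<xi>)) \<partial>lborel)
        = - \<i> * of_real ((\<xi> \<bullet> e) / (2 * s)) * of_real (sqrt (pi / s) ^ DIM('a) * exp (- (norm \<xi>)\<^sup>2 / (4 * s)))"
proof -
  define h0 where "h0 b t = of_real (exp (- s * t\<^sup>2)) * cis (- (t * (\<xi> \<bullet> b)))" for b t
  define h where "h b t = of_real ((if b = e then t else 1) * exp (- s * t\<^sup>2)) * cis (- (t * (\<xi> \<bullet> b)))" for b t
  have eq0: "of_real (exp (- s * (norm x)\<^sup>2)) * cis (- (x \<bullet> \<xi>)) = (\<Prod>b\<in>Basis. h0 b (x \<bullet> b))" for x
    unfolding h0_def prod.distrib exp_neg_norm_squared_eq_prod prod_cis[OF finite_Basis] of_real_prod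
    by (subst euclidean_inner) (simp add: sum_negf)
  have eq: "of_real ((x \<bullet> e) * exp (- s * (norm x)\<^sup>2)) * cis (- (x \<bullet> \<xi>)) = (\<Prod>b\<in>Basis. h b (x \<bullet> b))" for x
  proof -
    have "(\<Prod>b\<in>Basis. h b (x \<bullet> b)) = (\<Prod>b\<in>Basis. (if b = e then of_real (x \<bullet> e) else 1) * h0 b (x \<bullet> b))"
      by (intro prod.cong) (auto simp: h_def h0_def)
    also have "\<dots> = of_real (x \<bullet> e) * (\<Prod>b\<in>Basis. h0 b (x \<bullet> b))"
      using e by (simp add: prod.distrib)
    finally show ?thesis by (simp add: eq0[symmetric])
  qed
  have h: "integrable lborel (h b)" for b
    using integrable_gaussian_cis_real[OF s] by (cases "b = e") (simp_all add: h_def[abs_def])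
  show "integrable lborel (\<lambda>x. of_real ((x \<bullet> e) * exp (- s * (norm x)\<^sup>2)) * cis (- (x \<bullet> \<xi>)))"
    unfolding eq by (rule integrable_prod_Basis) (rule h)
  have *: "(\<integral>t. h b t \<partial>lborel) = (if b = e then - \<i> * of_real ((\<xi> \<bullet> e) / (2 * s)) else 1) * (\<integral>t. h0 b t \<partial>lborel)" for b
    unfolding h_def h0_def using integral_gaussian_cis_real_1[OF s, of "\<xi> \<bullet> e"] integral_gaussian_cis_real[OF s, of "\<xi> \<bullet> e"]
    by (auto simp del: of_real_mult of_real_divide)
  have h0: "integrable lborel (h0 b)" for b
    using integrable_gaussian_cis_real[OF s] by (simp add: h0_def[abs_def])
  show "(\<integral>x. of_real ((x \<bullet> e) * exp (- s * (norm x)\<^sup>2)) * cis (- (x \<bullet> \<xi>)) \<partial>lborel)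
        = - \<i> * of_real ((\<xi> \<bullet> e) / (2 * s)) * of_real (sqrt (pi / s) ^ DIM('a) * exp (- (norm \<xi>)\<^sup>2 / (4 * s)))"
    unfolding eq integral_prod_Basis[OF h] * prod.distrib integral_prod_Basis[OF h0, symmetric] eq0[symmetric] integral_gaussian_cis[OF s]
    using e by simp
qed

lemma integrable_gaussian:
  assumes "s > 0"
  shows "integrable lborel (\<lambda>x::'a::euclidean_space. exp (- s * (norm x)\<^sup>2))"
  using integrable_norm[OF integrable_gaussian_cis[OF assms, of "0::'a"]] by simp

lemma integral_gaussian:
  assumes "s > 0"
  shows "(\<integral>x. exp (- s * (norm x)\<^sup>2) \<partial>(lborel :: 'a::euclidean_space measure)) = sqrt (pi / s) ^ DIM('a)"
proof -
  have "of_real (\<integral>x. exp (- s * (norm x)\<^sup>2) \<partial>(lborel :: 'a measure)) = complex_of_real (sqrt (pi / s) ^ DIM('a))"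
    using integral_gaussian_cis[OF assms, of "0::'a"] by (simp add: integral_of_real[symmetric] del: of_real_power)
  then show ?thesis by (simp only: of_real_eq_iff)
qed

section \<open>Radial integrals\<close>

text \<open>
  The surface measure of the unit sphere.
\<close>

definition sphere_area :: "'a::euclidean_space itself \<Rightarrow> real" where
  "sphere_area TYPE('a) = DIM('a) * unit_ball_vol DIM('a)"

lemma sphere_area_nonneg: "sphere_area TYPE('a::euclidean_space) \<ge> 0"
  by (simp add: sphere_area_def)

text \<open>
  Integration in polar coordinates for radial functions. Both measures give \<open>{..a}\<close> the volume of the ball of
  radius \<open>a\<close>, and these half-lines generate the Borel sets.
\<close>

lemma distr_lborel_norm:
  "distr (lborel :: 'a::euclidean_space measure) borel norm
    = density lborel (\<lambda>r. ennreal (sphere_area TYPE('a) * r ^ (DIM('a) - 1)) * indicator {0..} r)"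
    (is "?M = ?N")
proof (rule measure_eqI_generator_eq[where E = "range atMost" and \<Omega> = UNIV and A = "\<lambda>i. {..real i}"])
  show "sets ?M = sigma_sets UNIV (range atMost)" "sets ?N = sigma_sets UNIV (range atMost)"
    by (simp_all add: borel_eq_atMost)
  show "Int_stable (range (atMost :: real \<Rightarrow> real set))"
    by (auto simp: Int_stable_def)
  have M: "emeasure ?M {..a} = (if a \<ge> 0 then ennreal (unit_ball_vol DIM('a) * a ^ DIM('a)) else 0)" for a
  proof -
    have "norm -` {..a} \<inter> space lborel = cball (0::'a) a" by (auto simp: dist_norm)
    then have "emeasure ?M {..a} = emeasure lborel (cball (0::'a) a)"
      by (subst emeasure_distr) auto
    then show ?thesis by (simp add: emeasure_cball)
  qed
  have N: "emeasure ?N {..a} = (if a \<ge> 0 then ennreal (unit_ball_vol DIM('a) * a ^ DIM('a)) else 0)" for a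
  proof (cases "a \<ge> 0")
    case True
    have "emeasure ?N {..a} = (\<integral>\<^sup>+r. ennreal (sphere_area TYPE('a) * r ^ (DIM('a) - 1)) * indicator {0..a} r \<partial>lborel)"
      by (subst emeasure_density) (auto intro!: nn_integral_cong simp: indicator_def)
    also have "\<dots> = unit_ball_vol DIM('a) * a ^ DIM('a) - unit_ball_vol DIM('a) * 0 ^ DIM('a)"
      using True by (intro nn_integral_FTC_Icc)
        (auto intro!: derivative_eq_intros mult_nonneg_nonneg simp: sphere_area_def)
    finally show ?thesis using True by simp
  next
    case False
    have "emeasure ?N {..a} = (\<integral>\<^sup>+r. 0 \<partial>(lborel :: real measure))"
      using False by (subst emeasure_density, simp, simp, intro nn_integral_cong) (auto simp: indicator_def)
    with False show ?thesis by simp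
  qed
  show "emeasure ?M X = emeasure ?N X" if "X \<in> range atMost" for X
    using that M N by auto
  show "emeasure ?M {..real i} \<noteq> \<infinity>" for i by (subst M) simp
  show "(\<Union>i. {..real i}) = UNIV" using real_arch_simple by auto
qed auto

lemma nn_integral_norm:
  assumes [measurable]: "\<phi> \<in> borel_measurable borel"
  shows "(\<integral>\<^sup>+x. \<phi> (norm x) \<partial>(lborel :: 'a::euclidean_space measure))
    = (\<integral>\<^sup>+r. ennreal (sphere_area TYPE('a) * r ^ (DIM('a) - 1)) * indicator {0..} r * \<phi> r \<partial>lborel)"
proof -
  have "(\<integral>\<^sup>+x. \<phi> (norm x) \<partial>(lborel :: 'a measure)) = (\<integral>\<^sup>+r. \<phi> r \<partial>distr (lborel :: 'a measure) borel norm)"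
    by (subst nn_integral_distr) auto
  then show ?thesis unfolding distr_lborel_norm by (subst (asm) nn_integral_density) auto
qed

text \<open>
  The factor \<open>r ^ (n - 1)\<close> of the polar density cancels the singularity.
\<close>

lemma nn_integral_inverse_norm_cball_le:
  assumes "R \<ge> 0"
  shows "(\<integral>\<^sup>+x. ennreal (1 / norm x ^ (DIM('a) - 1)) * indicator (cball 0 R) x \<partial>(lborel :: 'a::euclidean_space measure))
    \<le> ennreal (sphere_area TYPE('a) * R)"
proof -
  have "(\<integral>\<^sup>+x. ennreal (1 / norm x ^ (DIM('a) - 1)) * indicator (cball 0 R) x \<partial>(lborel :: 'a measure))
      = (\<integral>\<^sup>+x. ennreal (1 / norm x ^ (DIM('a) - 1)) * indicator {..R} (norm x) \<partial>(lborel :: 'a measure))"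
    by (intro nn_integral_cong) (auto simp: indicator_def)
  also have "\<dots> = (\<integral>\<^sup>+r. ennreal (sphere_area TYPE('a) * r ^ (DIM('a) - 1)) * indicator {0..} r
        * (ennreal (1 / r ^ (DIM('a) - 1)) * indicator {..R} r) \<partial>lborel)"
    by (rule nn_integral_norm) measurable
  also have "\<dots> \<le> (\<integral>\<^sup>+r. ennreal (sphere_area TYPE('a)) * indicator {0..R} r \<partial>lborel)"
  proof (intro nn_integral_mono)
    fix r :: real
    have "sphere_area TYPE('a) * r ^ (DIM('a) - 1) * (1 / r ^ (DIM('a) - 1)) \<le> sphere_area TYPE('a)" if "r \<ge> 0"
      using sphere_area_nonneg[where 'a='a] by (cases "r ^ (DIM('a) - 1) = 0") auto
    then show "ennreal (sphere_area TYPE('a) * r ^ (DIM('a) - 1)) * indicator {0..} r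
        * (ennreal (1 / r ^ (DIM('a) - 1)) * indicator {..R} r) \<le> ennreal (sphere_area TYPE('a)) * indicator {0..R} r"
      using sphere_area_nonneg[where 'a='a]
      by (auto simp: indicator_def ennreal_mult''[symmetric] intro!: ennreal_leI)
  qed
  also have "\<dots> = ennreal (sphere_area TYPE('a) * R)"
    using assms sphere_area_nonneg[where 'a='a] by (simp add: nn_integral_cmult ennreal_mult)
  finally show ?thesis .
qed

lemma integrable_inverse_norm_power:
  "integrable lborel (\<lambda>x::'a::euclidean_space. 1 / (1 + norm x) ^ (DIM('a) + 1))"
proof (rule integrableI_nonneg)
  define n where "n = DIM('a) - 1"
  have n: "DIM('a) = Suc n" by (simp add: n_def)
  let ?C = "sphere_area TYPE('a)"
  have C: "?C \<ge> 0" by (rule sphere_area_nonneg)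
  have "(\<integral>\<^sup>+x. ennreal (1 / (1 + norm x) ^ (DIM('a) + 1)) \<partial>(lborel :: 'a measure))
     = (\<integral>\<^sup>+r. ennreal (?C * r ^ n) * indicator {0..} r * ennreal (1 / (1 + r) ^ (n + 2)) \<partial>lborel)"
    using nn_integral_norm[where 'a='a, of "\<lambda>r. ennreal (1 / (1 + r) ^ (n + 2))"] by (simp add: n)
  also have "\<dots> \<le> (\<integral>\<^sup>+r. ennreal (?C / (1 + r)^2) * indicator {0..} r \<partial>lborel)"
  proof (intro nn_integral_mono)
    fix r :: real
    have "?C * r ^ n * (1 / (1 + r) ^ (n + 2)) \<le> ?C / (1 + r)^2" if "r \<ge> 0"
    proof -
      have "?C * r ^ n * (1 / (1 + r) ^ (n + 2)) = ?C / (1 + r)^2 * (r / (1 + r)) ^ n"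
        by (simp add: power_add power_divide power2_eq_square)
      also have "\<dots> \<le> ?C / (1 + r)^2 * 1"
        using that C by (intro mult_left_mono power_le_one) auto
      finally show ?thesis by simp
    qed
    then show "ennreal (?C * r ^ n) * indicator {0..} r * ennreal (1 / (1 + r) ^ (n + 2)) \<le> ennreal (?C / (1 + r)^2) * indicator {0..} r"
      using C by (auto simp: indicator_def ennreal_mult''[symmetric] intro!: ennreal_leI)
  qed
  also have "\<dots> = ennreal (0 - (- ?C / (1 + 0)))"
  proof (rule nn_integral_FTC_atLeast)
    show "((\<lambda>r. - ?C / (1 + r)) \<longlongrightarrow> 0) at_top"
      by (intro tendsto_divide_0[OF tendsto_const] filterlim_at_top_imp_at_infinity filterlim_tendsto_add_at_top[OF tendsto_const] filterlim_ident)
    show "DERIV (\<lambda>r. - ?C / (1 + r)) x :> ?C / (1 + x)\<^sup>2" if "0 \<le> x" for x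
      using that by (auto intro!: derivative_eq_intros simp: power2_eq_square)
  qed (use C in auto)
  also have "\<dots> < \<infinity>" by simp
  finally show "(\<integral>\<^sup>+x. ennreal (1 / (1 + norm x) ^ (DIM('a) + 1)) \<partial>(lborel :: 'a measure)) < \<infinity>" .
qed auto

section \<open>The Fourier transform and the Plancherel inequality\<close>

text \<open>
  Fubini's theorem in the form in which it serves below: the kernel is bounded, so the integrand
  is dominated by a product of two integrable functions.
\<close>

lemma integral_swap_kernel:
  fixes f :: "'a::euclidean_space \<Rightarrow> complex" and g :: "'b::euclidean_space \<Rightarrow> complex" and k :: "'a \<Rightarrow> 'b \<Rightarrow> complex"
  assumes f: "integrable lborel f" and g: "integrable lborel g"
    and k [measurable]: "case_prod k \<in> borel_measurable (lborel \<Otimes>\<^sub>M lborel)" and bound: "\<And>x y. norm (k x y) \<le> B"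
  shows "(\<integral>x. f x * (\<integral>y. g y * k x y \<partial>lborel) \<partial>lborel) = (\<integral>y. g y * (\<integral>x. f x * k x y \<partial>lborel) \<partial>lborel)"
proof -
  have [measurable]: "f \<in> borel_measurable lborel" "g \<in> borel_measurable lborel" using f g by auto
  have k1: "(\<lambda>y. k x y) \<in> borel_measurable lborel" for x
  proof -
    have "(\<lambda>y. case_prod k (x, y)) \<in> borel_measurable lborel" by measurable
    then show ?thesis by simp
  qed
  have k2: "(\<lambda>x. k x y) \<in> borel_measurable lborel" for y
  proof -
    have "(\<lambda>x. case_prod k (x, y)) \<in> borel_measurable lborel" by measurable
    then show ?thesis by simp
  qed
  have B: "B \<ge> 0" using order_trans[OF norm_ge_zero bound] .
  have ig: "integrable lborel (\<lambda>y. g y * k x y)" for x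
    by (rule Bochner_Integration.integrable_bound[OF integrable_mult_left[OF integrable_norm[OF g], of B]])
       (use k1 bound B in \<open>auto simp: norm_mult intro!: always_eventually mult_left_mono\<close>)
  have ik: "integrable lborel (\<lambda>x. f x * k x y)" for y
    by (rule Bochner_Integration.integrable_bound[OF integrable_mult_left[OF integrable_norm[OF f], of B]])
       (use k2 bound B in \<open>auto simp: norm_mult intro!: always_eventually mult_left_mono\<close>)
  have "integrable (lborel \<Otimes>\<^sub>M lborel) (\<lambda>(x, y). norm (f x) * (norm (g y) * B))"
  proof (rule lborel_pair.Fubini_integrable)
    show "integrable lborel (\<lambda>x. \<integral>y. norm (case (x, y) of (x, y) \<Rightarrow> norm (f x) * (norm (g y) * B)) \<partial>lborel)"
      using f B by (simp add: abs_mult)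
  qed (use g in auto)
  then have int: "integrable (lborel \<Otimes>\<^sub>M lborel) (\<lambda>(x, y). f x * (g y * k x y))"
    by (rule Bochner_Integration.integrable_bound)
       (use bound B in \<open>auto simp: norm_mult intro!: always_eventually mult_left_mono\<close>)
  have "(\<integral>x. f x * (\<integral>y. g y * k x y \<partial>lborel) \<partial>lborel) = (\<integral>x. \<integral>y. f x * (g y * k x y) \<partial>lborel \<partial>lborel)"
    using ig by simp
  also have "\<dots> = (\<integral>y. \<integral>x. f x * (g y * k x y) \<partial>lborel \<partial>lborel)"
    using lborel_pair.Fubini_integral[OF int] by simp
  also have "\<dots> = (\<integral>y. \<integral>x. g y * (f x * k x y) \<partial>lborel \<partial>lborel)"
    by (simp add: mult_ac)
  also have "\<dots> = (\<integral>y. g y * (\<integral>x. f x * k x y \<partial>lborel) \<partial>lborel)"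
    using ik by simp
  finally show "(\<integral>x. f x * (\<integral>y. g y * k x y \<partial>lborel) \<partial>lborel) = (\<integral>y. g y * (\<integral>x. f x * k x y \<partial>lborel) \<partial>lborel)" .
qed

definition fourier :: "('a::euclidean_space \<Rightarrow> complex) \<Rightarrow> 'a \<Rightarrow> complex" where
  "fourier f \<xi> = (\<integral>x. f x * cis (- (x \<bullet> \<xi>)) \<partial>lborel)"

lemma integrable_times_cis:
  fixes f :: "'a::euclidean_space \<Rightarrow> complex"
  assumes "integrable lborel f"
  shows "integrable lborel (\<lambda>x. f x * cis (- (x \<bullet> \<xi>)))"
  by (rule Bochner_Integration.integrable_bound[OF assms]) (use assms in \<open>auto simp: norm_mult\<close>)

lemma measurable_fourier [measurable]:
  fixes f :: "'a::euclidean_space \<Rightarrow> complex"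
  assumes [measurable]: "f \<in> borel_measurable borel"
  shows "fourier f \<in> borel_measurable borel"
  unfolding fourier_def[abs_def] by measurable

lemma norm_fourier_le:
  fixes f :: "'a::euclidean_space \<Rightarrow> complex"
  shows "norm (fourier f \<xi>) \<le> (\<integral>x. norm (f x) \<partial>lborel)"
  unfolding fourier_def by (rule order_trans[OF integral_norm_bound]) (simp add: norm_mult)


text \<open>
  With the damping factor all integrals converge absolutely. Writing the square of the transform as a
  double integral and integrating over \<open>\<xi>\<close> first leaves
  \<open>\<integral>\<integral> v x \<cdot> cnj (v y) \<cdot> K (x - y)\<close> with a positive Gaussian \<open>K\<close> of total mass \<open>(2 \<pi>) ^ n\<close>, and such a form is
  at most the mass of \<open>K\<close> times the square of the norm of \<open>v\<close> (Schur's test).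
\<close>

lemma fourier_damped_L2_le:
  fixes v :: "'a::euclidean_space \<Rightarrow> complex"
  assumes v: "integrable lborel v" and v2: "integrable lborel (\<lambda>x. (norm (v x))\<^sup>2)" and s: "s > 0"
  shows "(\<integral>\<^sup>+\<xi>. ennreal (exp (- s * (norm \<xi>)\<^sup>2) * (norm (fourier v \<xi>))\<^sup>2) \<partial>lborel)
    \<le> ennreal ((2 * pi) ^ DIM('a) * (\<integral>x. (norm (v x))\<^sup>2 \<partial>lborel))"
proof -
  have vm [measurable]: "v \<in> borel_measurable borel" using v by auto
  define E where "E \<xi> = exp (- s * (norm \<xi>)\<^sup>2)" for \<xi> :: 'a
  define W where "W \<xi> = cnj (fourier v \<xi>)" for \<xi>
  define K where "K z = sqrt (pi / s) ^ DIM('a) * exp (- (norm z)\<^sup>2 / (4 * s))" for z :: 'a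
  define V where "V x = (\<integral>y. cnj (v y) * of_real (K (x - y)) \<partial>lborel)" for x
  have K_nonneg: "K z \<ge> 0" for z using s by (simp add: K_def)
  have [measurable]: "K \<in> borel_measurable borel" "E \<in> borel_measurable borel" "W \<in> borel_measurable borel"
    unfolding K_def[abs_def] E_def[abs_def] W_def[abs_def] by measurable
  have E: "integrable lborel E" unfolding E_def[abs_def] by (rule integrable_gaussian[OF s])
  have Ec: "integrable lborel (\<lambda>\<xi>. complex_of_real (E \<xi>))" using E by (simp add: complex_of_real_integrable_eq)
  have W: "norm (W \<xi>) \<le> (\<integral>x. norm (v x) \<partial>lborel)" for \<xi>
    using norm_fourier_le[of v \<xi>] by (simp add: W_def)
  have EW: "integrable lborel (\<lambda>\<xi>. of_real (E \<xi>) * W \<xi>)"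
    by (rule Bochner_Integration.integrable_bound[OF integrable_mult_left[OF E, of "\<integral>x. norm (v x) \<partial>lborel"]])
       (use W in \<open>auto simp: norm_mult E_def intro!: always_eventually mult_left_mono order_trans[OF W]\<close>)
  have W_eq: "W \<xi> = (\<integral>y. cnj (v y) * cis (y \<bullet> \<xi>) \<partial>lborel)" for \<xi>
  proof -
    have "cnj (v y) * cis (y \<bullet> \<xi>) = cnj (v y * cis (- (y \<bullet> \<xi>)))" for y
      by (simp add: cis_cnj)
    then show ?thesis unfolding W_def fourier_def by (simp only: Bochner_Integration.integral_cnj)
  qed
  have inner: "(\<integral>\<xi>. (of_real (E \<xi>) * W \<xi>) * cis (- (x \<bullet> \<xi>)) \<partial>lborel) = V x" for x
  proof -
    have *: "(\<integral>\<xi>. (of_real (E \<xi>) * cis (- (x \<bullet> \<xi>))) * cis (y \<bullet> \<xi>) \<partial>lborel) = of_real (K (x - y))" for y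
    proof -
      have "(\<integral>\<xi>. (of_real (E \<xi>) * cis (- (x \<bullet> \<xi>))) * cis (y \<bullet> \<xi>) \<partial>lborel)
          = (\<integral>\<xi>. of_real (E \<xi>) * cis (- (\<xi> \<bullet> (x - y))) \<partial>lborel)"
        by (intro Bochner_Integration.integral_cong) (simp_all add: mult.assoc cis_mult inner_diff_right inner_commute)
      then show ?thesis using integral_gaussian_cis[OF s, of "x - y"] by (simp add: E_def K_def)
    qed
    have "(\<integral>\<xi>. (of_real (E \<xi>) * W \<xi>) * cis (- (x \<bullet> \<xi>)) \<partial>lborel)
      = (\<integral>\<xi>. (of_real (E \<xi>) * cis (- (x \<bullet> \<xi>))) * (\<integral>y. cnj (v y) * cis (y \<bullet> \<xi>) \<partial>lborel) \<partial>lborel)"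
      by (simp add: W_eq mult_ac)
    also have "\<dots> = (\<integral>y. cnj (v y) * (\<integral>\<xi>. (of_real (E \<xi>) * cis (- (x \<bullet> \<xi>))) * cis (y \<bullet> \<xi>) \<partial>lborel) \<partial>lborel)"
    proof (rule integral_swap_kernel[where B=1])
      show "integrable lborel (\<lambda>\<xi>. of_real (E \<xi>) * cis (- (x \<bullet> \<xi>)))"
        using integrable_times_cis[OF Ec, of x] by (simp add: inner_commute)
      show "integrable lborel (\<lambda>y. cnj (v y))" using v by simp
    qed auto
    finally show ?thesis by (simp only: * V_def)
  qed
  have "of_real (\<integral>\<xi>. E \<xi> * (norm (fourier v \<xi>))\<^sup>2 \<partial>lborel) = (\<integral>\<xi>. (of_real (E \<xi>) * W \<xi>) * fourier v \<xi> \<partial>lborel)"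
    unfolding integral_complex_of_real[symmetric] W_def
    by (intro Bochner_Integration.integral_cong) (simp_all add: complex_norm_square mult_ac del: of_real_power)
  also have "\<dots> = (\<integral>x. v x * V x \<partial>lborel)"
    unfolding fourier_def by (subst integral_swap_kernel[OF EW v, where B=1]) (simp_all add: inner_commute inner)
  finally have main: "complex_of_real (\<integral>\<xi>. E \<xi> * (norm (fourier v \<xi>))\<^sup>2 \<partial>lborel) = (\<integral>x. v x * V x \<partial>lborel)" .
  have IK: "(\<integral>\<^sup>+y. ennreal (K y) \<partial>lborel) = ennreal ((2 * pi) ^ DIM('a))"
  proof -
    have K': "integrable lborel K"
      unfolding K_def[abs_def] using integrable_gaussian[of "1 / (4 * s)"] s by simp
    have "(\<integral>y. K y \<partial>lborel) = sqrt (pi / s) ^ DIM('a) * sqrt (pi / (1 / (4 * s))) ^ DIM('a)"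
      unfolding K_def using integral_gaussian[of "1 / (4 * s)", where 'a='a] s by simp
    also have "\<dots> = (sqrt (pi / s) * sqrt (pi / (1 / (4 * s)))) ^ DIM('a)" by (simp add: power_mult_distrib)
    also have "sqrt (pi / s) * sqrt (pi / (1 / (4 * s))) = sqrt ((2 * pi)\<^sup>2)"
      using s unfolding real_sqrt_mult[symmetric] by (simp add: power2_eq_square field_simps)
    also have "sqrt ((2 * pi)\<^sup>2) = 2 * pi" by (rule real_sqrt_unique) auto
    finally show ?thesis using nn_integral_eq_integral[OF K'] K_nonneg by simp
  qed
  have "ennreal (\<integral>\<xi>. E \<xi> * (norm (fourier v \<xi>))\<^sup>2 \<partial>lborel) \<le> (\<integral>\<^sup>+x. \<integral>\<^sup>+y. ennreal (norm (v x) * norm (v y) * K (x - y)) \<partial>lborel \<partial>lborel)"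
  proof -
    have "ennreal (\<integral>\<xi>. E \<xi> * (norm (fourier v \<xi>))\<^sup>2 \<partial>lborel) \<le> ennreal (norm (\<integral>x. v x * V x \<partial>lborel))"
      unfolding main[symmetric] by (intro ennreal_leI) (simp only: norm_of_real abs_ge_self)
    also have "\<dots> \<le> (\<integral>\<^sup>+x. ennreal (norm (v x * V x)) \<partial>lborel)"
      by (cases "integrable lborel (\<lambda>x. v x * V x)") (auto intro: integral_norm_bound_ennreal simp: not_integrable_integral_eq)
    also have "\<dots> \<le> (\<integral>\<^sup>+x. \<integral>\<^sup>+y. ennreal (norm (v x) * norm (v y) * K (x - y)) \<partial>lborel \<partial>lborel)"
    proof (intro nn_integral_mono)
      fix x
      have "ennreal (norm (V x)) \<le> (\<integral>\<^sup>+y. ennreal (norm (v y) * K (x - y)) \<partial>lborel)"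
        unfolding V_def
        using integral_norm_bound_ennreal[of lborel "\<lambda>y. cnj (v y) * of_real (K (x - y))"] K_nonneg
        by (cases "integrable lborel (\<lambda>y. cnj (v y) * of_real (K (x - y)))")
           (auto simp: not_integrable_integral_eq norm_mult)
      then have "ennreal (norm (v x)) * ennreal (norm (V x)) \<le> ennreal (norm (v x)) * (\<integral>\<^sup>+y. ennreal (norm (v y) * K (x - y)) \<partial>lborel)"
        by (rule mult_left_mono) simp
      also have "\<dots> = (\<integral>\<^sup>+y. ennreal (norm (v x) * norm (v y) * K (x - y)) \<partial>lborel)"
        using K_nonneg by (subst nn_integral_cmult[symmetric]) (auto simp: ennreal_mult' mult.assoc)
      finally show "ennreal (norm (v x * V x)) \<le> \<dots>"
        by (simp add: norm_mult ennreal_mult')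
    qed
    finally show ?thesis .
  qed
  \<comment> \<open>Schur's test: \<open>|v x| |v y|\<close> is at most the mean of the two squares, and \<open>K\<close> integrates over either variable to its mass.\<close>
  also have "\<dots> \<le> (\<integral>\<^sup>+x. \<integral>\<^sup>+y. ennreal ((norm (v x))\<^sup>2 / 2) * ennreal (K (x - y)) + ennreal ((norm (v y))\<^sup>2 / 2) * ennreal (K (x - y)) \<partial>lborel \<partial>lborel)"
  proof (intro nn_integral_mono)
    fix x y
    have "norm (v x) * norm (v y) \<le> (norm (v x))\<^sup>2 / 2 + (norm (v y))\<^sup>2 / 2"
      using sum_squares_bound[of "norm (v x)" "norm (v y)"] by simp
    then have "norm (v x) * norm (v y) * K (x - y) \<le> ((norm (v x))\<^sup>2 / 2 + (norm (v y))\<^sup>2 / 2) * K (x - y)"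
      using K_nonneg by (rule mult_right_mono)
    then have "ennreal (norm (v x) * norm (v y) * K (x - y)) \<le> ennreal ((norm (v x))\<^sup>2 / 2 * K (x - y) + (norm (v y))\<^sup>2 / 2 * K (x - y))"
      by (intro ennreal_leI) (simp add: algebra_simps)
    then show "ennreal (norm (v x) * norm (v y) * K (x - y)) \<le> ennreal ((norm (v x))\<^sup>2 / 2) * ennreal (K (x - y)) + ennreal ((norm (v y))\<^sup>2 / 2) * ennreal (K (x - y))"
      using K_nonneg by (simp add: ennreal_mult[symmetric] ennreal_plus[symmetric] del: ennreal_plus)
  qed
  also have "\<dots> = (\<integral>\<^sup>+x. \<integral>\<^sup>+y. ennreal ((norm (v x))\<^sup>2 / 2) * ennreal (K (x - y)) \<partial>lborel \<partial>lborel)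
      + (\<integral>\<^sup>+x. \<integral>\<^sup>+y. ennreal ((norm (v y))\<^sup>2 / 2) * ennreal (K (x - y)) \<partial>lborel \<partial>lborel)"
    by (simp add: nn_integral_add)
  also have "(\<integral>\<^sup>+x. \<integral>\<^sup>+y. ennreal ((norm (v y))\<^sup>2 / 2) * ennreal (K (x - y)) \<partial>lborel \<partial>lborel)
     = (\<integral>\<^sup>+y. \<integral>\<^sup>+x. ennreal ((norm (v y))\<^sup>2 / 2) * ennreal (K (x - y)) \<partial>lborel \<partial>lborel)"
    by (rule lborel_pair.Fubini') measurable
  also have "\<dots> = (\<integral>\<^sup>+x. \<integral>\<^sup>+y. ennreal ((norm (v x))\<^sup>2 / 2) * ennreal (K (x - y)) \<partial>lborel \<partial>lborel)"
    by (simp add: K_def norm_minus_commute)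
  also have "(\<integral>\<^sup>+x. \<integral>\<^sup>+y. ennreal ((norm (v x))\<^sup>2 / 2) * ennreal (K (x - y)) \<partial>lborel \<partial>lborel)
      = (\<integral>\<^sup>+x. ennreal ((norm (v x))\<^sup>2 / 2) * ennreal ((2 * pi) ^ DIM('a)) \<partial>lborel)"
    by (simp add: nn_integral_cmult nn_integral_reflect[where f="\<lambda>z. ennreal (K z)"] IK)
  also have "\<dots> = ennreal (\<integral>x. (norm (v x))\<^sup>2 / 2 * (2 * pi) ^ DIM('a) \<partial>lborel)"
    using v2 by (subst nn_integral_eq_integral[symmetric]) (auto simp: ennreal_mult[symmetric] mult_ac)
  also have "\<dots> + \<dots> = ennreal ((2 * pi) ^ DIM('a) * (\<integral>x. (norm (v x))\<^sup>2 \<partial>lborel))"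
    by (subst ennreal_plus[symmetric]) (auto simp: mult_ac)
  finally have "ennreal (\<integral>\<xi>. E \<xi> * (norm (fourier v \<xi>))\<^sup>2 \<partial>lborel) \<le> ennreal ((2 * pi) ^ DIM('a) * (\<integral>x. (norm (v x))\<^sup>2 \<partial>lborel))" .
  moreover have "(\<integral>\<^sup>+\<xi>. ennreal (E \<xi> * (norm (fourier v \<xi>))\<^sup>2) \<partial>lborel) = ennreal (\<integral>\<xi>. E \<xi> * (norm (fourier v \<xi>))\<^sup>2 \<partial>lborel)"
  proof (rule nn_integral_eq_integral)
    show "integrable lborel (\<lambda>\<xi>. E \<xi> * (norm (fourier v \<xi>))\<^sup>2)"
      by (rule Bochner_Integration.integrable_bound[OF integrable_mult_left[OF E, of "(\<integral>x. norm (v x) \<partial>lborel)\<^sup>2"]])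
         (auto simp: E_def intro!: always_eventually mult_left_mono power_mono norm_fourier_le)
  qed (simp add: E_def)
  ultimately show ?thesis by (simp add: E_def)
qed

text \<open>
  Fatou's lemma removes the damping.
\<close>

theorem fourier_L2_le:
  fixes v :: "'a::euclidean_space \<Rightarrow> complex"
  assumes v: "integrable lborel v" and v2: "integrable lborel (\<lambda>x. (norm (v x))\<^sup>2)"
  shows "(\<integral>\<^sup>+\<xi>. ennreal ((norm (fourier v \<xi>))\<^sup>2) \<partial>lborel) \<le> ennreal ((2 * pi) ^ DIM('a) * (\<integral>x. (norm (v x))\<^sup>2 \<partial>lborel))"
    (is "_ \<le> ?B")
proof -
  have [measurable]: "v \<in> borel_measurable borel" using v by auto
  let ?g = "\<lambda>k \<xi>. ennreal (exp (- (1 / real (Suc k)) * (norm \<xi>)\<^sup>2) * (norm (fourier v \<xi>))\<^sup>2)"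
  have "(\<lambda>k. ?g k \<xi>) \<longlonglongrightarrow> ennreal ((norm (fourier v \<xi>))\<^sup>2)" for \<xi>
  proof -
    have "(\<lambda>k. exp (- (1 / real (Suc k)) * (norm \<xi>)\<^sup>2) * (norm (fourier v \<xi>))\<^sup>2) \<longlonglongrightarrow> exp (- 0 * (norm \<xi>)\<^sup>2) * (norm (fourier v \<xi>))\<^sup>2"
      by (intro tendsto_intros LIMSEQ_Suc[OF lim_1_over_n])
    then show ?thesis by (intro tendsto_ennrealI) simp
  qed
  then have "(\<integral>\<^sup>+\<xi>. ennreal ((norm (fourier v \<xi>))\<^sup>2) \<partial>lborel) = (\<integral>\<^sup>+\<xi>. liminf (\<lambda>k. ?g k \<xi>) \<partial>lborel)"
    by (intro nn_integral_cong lim_imp_Liminf[symmetric]) simp_all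
  also have "\<dots> \<le> liminf (\<lambda>k. \<integral>\<^sup>+\<xi>. ?g k \<xi> \<partial>lborel)"
    by (rule nn_integral_liminf) measurable
  also have "\<dots> \<le> limsup (\<lambda>k. \<integral>\<^sup>+\<xi>. ?g k \<xi> \<partial>lborel)"
    by (rule Liminf_le_Limsup) simp
  also have "\<dots> \<le> ?B"
    by (rule Limsup_bounded) (intro always_eventually allI fourier_damped_L2_le[OF v v2], simp)
  finally show ?thesis .
qed

section \<open>From Gaussian means to integrals over balls\<close>

lemma nn_integral_gaussian_moment_Icc:
  assumes "a \<le> b" "0 \<le> a"
  shows "(\<integral>\<^sup>+\<rho>. ennreal (\<rho> * exp (- \<rho>\<^sup>2)) * indicator {a..b} \<rho> \<partial>lborel) = ennreal ((exp (- a\<^sup>2) - exp (- b\<^sup>2)) / 2)"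
proof -
  have "(\<integral>\<^sup>+\<rho>. ennreal (\<rho> * exp (- \<rho>\<^sup>2)) * indicator {a..b} \<rho> \<partial>lborel) = ennreal (- exp (- b\<^sup>2) / 2 - (- exp (- a\<^sup>2) / 2))"
    by (rule nn_integral_FTC_Icc) (use assms in \<open>auto intro!: derivative_eq_intros\<close>)
  then show ?thesis by (simp add: field_simps)
qed

lemma nn_integral_gaussian_moment_atLeast:
  "(\<integral>\<^sup>+\<rho>. ennreal (\<rho> * exp (- \<rho>\<^sup>2)) * indicator {0..} \<rho> \<partial>lborel) = ennreal (1 / 2)"
proof -
  have "((\<lambda>\<rho>::real. - exp (- \<rho>\<^sup>2) / 2) \<longlongrightarrow> - 0 / 2) at_top"
    by (intro tendsto_intros filterlim_compose[OF exp_at_bot] filterlim_uminus_at_bot[THEN iffD1] )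
       (auto simp: filterlim_uminus_at_bot intro!: filterlim_pow_at_top filterlim_ident)
  then have "(\<integral>\<^sup>+\<rho>. ennreal (\<rho> * exp (- \<rho>\<^sup>2)) * indicator {0..} \<rho> \<partial>lborel) = ennreal (- 0 / 2 - (- exp (- 0\<^sup>2) / 2))"
    by (intro nn_integral_FTC_atLeast) (auto intro!: derivative_eq_intros)
  then show ?thesis by simp
qed

text \<open>
  Karamata's approximation. With \<open>s = exp (- \<rho>\<^sup>2)\<close> the indicator of \<open>\<rho> \<le> 1\<close> is the step function of \<open>s\<close> that jumps at
  \<open>1/e\<close>. The polynomial must agree with the step at \<open>s = 0\<close> and \<open>s = 1\<close>, so it has the form
  \<open>s + s (1 - s) Q s\<close>. The error is then \<open>s (1 - s) |\<phi> s - Q s|\<close> for a bounded function \<open>\<phi>\<close> with one jump, and the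
  factor \<open>s (1 - s)\<close>, at most \<open>\<rho>\<^sup>2 exp (- \<rho>\<^sup>2)\<close>, absorbs the weight \<open>1/\<rho>\<close>. So it
  suffices to approximate \<open>\<phi>\<close> in the mean, and Weierstrass' theorem does this after the jump has been
  replaced by a steep continuous piece.
\<close>

lemma karamata_polynomial:
  fixes \<epsilon> :: real
  assumes \<epsilon>: "\<epsilon> > 0"
  obtains a :: "nat \<Rightarrow> real" and m :: nat where
    "(\<integral>\<^sup>+\<rho>. ennreal (\<bar>indicator {..1} \<rho> - (exp (- \<rho>\<^sup>2) + (\<Sum>i\<le>m. a i * (exp (- \<rho>\<^sup>2) ^ (i + 1) - exp (- \<rho>\<^sup>2) ^ (i + 2))))\<bar> / \<rho>)
        * indicator {0..} \<rho> \<partial>lborel) \<le> ennreal \<epsilon>"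
proof -
  define c :: real where "c = exp (- 1)"
  have c: "0 < c" "c < 1" by (auto simp: c_def)
  define M where "M = 1 / c + 1 / (1 - c)"
  have M: "M > 0" using c by (simp add: M_def add_pos_pos)
  \<comment> \<open>Width of the window: Weierstrass' theorem costs \<open>\<epsilon> / 2\<close>, the window costs \<open>M \<tau> \<le> \<epsilon> / 2\<close>.\<close>
  define \<tau> where "\<tau> = min (c / 2) (\<epsilon> / (2 * M))"
  have \<tau>: "0 < \<tau>" "\<tau> < c" "M * \<tau> \<le> \<epsilon> / 2"
    using c M \<epsilon> by (auto simp: \<tau>_def min_def field_simps)
  define s1 where "s1 = c - \<tau>"
  have s1: "0 < s1" "s1 < c" using \<tau> by (auto simp: s1_def)
  \<comment> \<open>The window \<open>[s1, c]\<close> in the variable \<open>s\<close> is \<open>[1, b]\<close> in the variable \<open>\<rho>\<close>.\<close>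
  define b where "b = sqrt (- ln s1)"
  have "ln s1 < ln c" using s1 by simp
  then have ln_s1: "- ln s1 > 1" by (simp add: c_def)
  have b: "b > 1" "b\<^sup>2 = - ln s1" using ln_s1 real_sqrt_pow2[of "- ln s1"] by (simp_all add: b_def)
  then have exp_b: "exp (- b\<^sup>2) = s1" using s1 by simp
  \<comment> \<open>\<open>\<theta>\<close> rises linearly from \<open>0\<close> to \<open>1\<close> on the window \<open>[s1, c]\<close>; \<open>\<psi>\<close> interpolates between the two branches of \<open>\<phi>\<close> there.\<close>
  define \<theta> where "\<theta> s = max 0 (min 1 ((s - s1) / \<tau>))" for s
  define \<phi> where "\<phi> s = (if s \<ge> c then 1 / s else - 1 / (1 - s))" for s
  define \<psi> where "\<psi> s = \<theta> s * (1 / max s c) - (1 - \<theta> s) * (1 / (1 - min s c))" for s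
  have \<theta>: "0 \<le> \<theta> s" "\<theta> s \<le> 1" for s by (auto simp: \<theta>_def)
  have max: "0 \<le> 1 / max s c" "1 / max s c \<le> 1 / c" for s using c by (auto intro!: divide_left_mono)
  have min: "0 \<le> 1 / (1 - min s c)" "1 / (1 - min s c) \<le> 1 / (1 - c)" for s using c by (auto intro!: divide_left_mono mult_pos_pos simp: min_def)
  have \<psi>_bound: "\<bar>\<psi> s\<bar> \<le> M" for s
  proof -
    have "\<bar>\<psi> s\<bar> \<le> \<bar>\<theta> s * (1 / max s c)\<bar> + \<bar>(1 - \<theta> s) * (1 / (1 - min s c))\<bar>"
      unfolding \<psi>_def by (rule abs_triangle_ineq4)
    also have "\<dots> = \<theta> s * (1 / max s c) + (1 - \<theta> s) * (1 / (1 - min s c))"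
      using \<theta>[of s] max[of s] min[of s] by (simp only: abs_mult) auto
    also have "\<dots> \<le> 1 * (1 / c) + 1 * (1 / (1 - c))"
      using \<theta>[of s] max[of s] min[of s] by (intro add_mono mult_mono) auto
    finally show ?thesis by (simp add: M_def)
  qed
  have \<phi>_bound: "\<bar>\<phi> s\<bar> \<le> M" if "0 \<le> s" "s \<le> 1" for s
  proof -
    have "0 \<le> 1 / c" "0 \<le> 1 / (1 - c)" using c by auto
    moreover have "\<phi> s = 1 / max s c \<or> \<phi> s = - (1 / (1 - min s c))"
      by (auto simp: \<phi>_def max_def min_def)
    ultimately show ?thesis using max[of s] min[of s] unfolding M_def by linarith
  qed
  have eq: "\<phi> s = \<psi> s" if "s \<ge> c \<or> s \<le> s1" for s
  proof (cases "s \<ge> c")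
    case True
    then have "(s - s1) / \<tau> \<ge> 1" using \<tau> by (simp add: s1_def)
    then have "\<theta> s = 1" by (simp add: \<theta>_def)
    with True show ?thesis by (simp add: \<phi>_def \<psi>_def)
  next
    case False
    with that have "(s - s1) / \<tau> \<le> 0" using \<tau> by (simp add: divide_le_0_iff)
    then have "\<theta> s = 0" by (simp add: \<theta>_def)
    with False show ?thesis by (simp add: \<phi>_def \<psi>_def)
  qed
  have "continuous_on {0..1} \<psi>"
    unfolding \<psi>_def \<theta>_def using c \<tau> by (intro continuous_intros) (auto simp: min_def max_def)
  then obtain Q where "real_polynomial_function Q" and Q: "\<And>s. s \<in> {0..1} \<Longrightarrow> \<bar>\<psi> s - Q s\<bar> < \<epsilon>"
    using Stone_Weierstrass_real_polynomial_function[of "{0..1}" \<psi> \<epsilon>] \<epsilon> by auto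
  then obtain a m where a: "Q = (\<lambda>s. \<Sum>i\<le>m. a i * s ^ i)"
    using real_polynomial_function_iff_sum by auto
  define P where "P s = s + (\<Sum>i\<le>m. a i * (s ^ (i + 1) - s ^ (i + 2)))" for s
  have P: "P s = s + s * (1 - s) * Q s" for s
    unfolding P_def a sum_distrib_left by (intro arg_cong2[where f="(+)"] sum.cong) (auto simp: algebra_simps)
  have "(\<integral>\<^sup>+\<rho>. ennreal (\<bar>indicator {..1} \<rho> - P (exp (- \<rho>\<^sup>2))\<bar> / \<rho>) * indicator {0..} \<rho> \<partial>lborel)
     \<le> (\<integral>\<^sup>+\<rho>. ennreal \<epsilon> * (ennreal (\<rho> * exp (- \<rho>\<^sup>2)) * indicator {0..} \<rho>)
          + ennreal (2 * M) * (ennreal (\<rho> * exp (- \<rho>\<^sup>2)) * indicator {1..b} \<rho>) \<partial>lborel)"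
  proof (intro nn_integral_mono)
    fix \<rho> :: real
    show "ennreal (\<bar>indicator {..1} \<rho> - P (exp (- \<rho>\<^sup>2))\<bar> / \<rho>) * indicator {0..} \<rho>
     \<le> ennreal \<epsilon> * (ennreal (\<rho> * exp (- \<rho>\<^sup>2)) * indicator {0..} \<rho>)
          + ennreal (2 * M) * (ennreal (\<rho> * exp (- \<rho>\<^sup>2)) * indicator {1..b} \<rho>)"
    proof (cases "\<rho> > 0")
      case True
      define s where "s = exp (- \<rho>\<^sup>2)"
      have s: "0 < s" "s < 1" using True by (auto simp: s_def)
      have ind: "indicator {..1} \<rho> = (if s \<ge> c then 1 else 0 :: real)"
        using True power_le_one_iff[of \<rho> 2] by (auto simp: s_def c_def indicator_def)
      have "indicator {..1} \<rho> - P s = s * (1 - s) * (\<phi> s - Q s)"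
        unfolding P ind \<phi>_def using s by (simp add: field_simps)
      then have "\<bar>indicator {..1} \<rho> - P s\<bar> = s * (1 - s) * \<bar>\<phi> s - Q s\<bar>"
        using s by (simp add: abs_mult)
      also have "\<dots> \<le> s * \<rho>\<^sup>2 * (\<epsilon> + 2 * M * indicator {1..b} \<rho>)"
      proof (intro mult_mono)
        show "1 - s \<le> \<rho>\<^sup>2" using exp_ge_add_one_self[of "- \<rho>\<^sup>2"] by (simp add: s_def)
        have "\<bar>\<phi> s - \<psi> s\<bar> \<le> 2 * M * indicator {1..b} \<rho>"
        proof (cases "\<rho> \<in> {1..b}")
          case True
          then show ?thesis using \<phi>_bound[of s] \<psi>_bound[of s] s by auto
        next
          case False
          have "s \<ge> c \<or> s \<le> s1"
          proof (cases "\<rho> \<le> 1")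
            case True
            then show ?thesis using ind by (auto split: if_splits)
          next
            case False
            with \<open>\<rho> \<notin> {1..b}\<close> have "b \<le> \<rho>" by auto
            then have "b\<^sup>2 \<le> \<rho>\<^sup>2" using b by (intro power_mono) auto
            then have "s \<le> exp (- b\<^sup>2)" by (simp add: s_def)
            then show ?thesis using exp_b by simp
          qed
          then show ?thesis using eq[of s] False by simp
        qed
        then show "\<bar>\<phi> s - Q s\<bar> \<le> \<epsilon> + 2 * M * indicator {1..b} \<rho>"
          using Q[of s] s by auto
      qed (use s in auto)
      finally have "\<bar>indicator {..1} \<rho> - P s\<bar> / \<rho> \<le> s * \<rho>\<^sup>2 * (\<epsilon> + 2 * M * indicator {1..b} \<rho>) / \<rho>"
        using True by (intro divide_right_mono) auto
      also have "\<dots> = \<epsilon> * (\<rho> * s) + 2 * M * (\<rho> * s * indicator {1..b} \<rho>)"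
        using True by (simp add: power2_eq_square field_simps)
      finally have "ennreal (\<bar>indicator {..1} \<rho> - P s\<bar> / \<rho>) \<le> ennreal (\<epsilon> * (\<rho> * s) + 2 * M * (\<rho> * s * indicator {1..b} \<rho>))"
        by (rule ennreal_leI)
      also have "\<dots> = ennreal \<epsilon> * ennreal (\<rho> * s) + ennreal (2 * M) * (ennreal (\<rho> * s) * indicator {1..b} \<rho>)"
        using True s \<epsilon> M by (auto simp: indicator_def ennreal_mult[symmetric] ennreal_plus[symmetric] simp del: ennreal_plus)
      finally show ?thesis using True by (simp add: s_def)
    next
      case False
      then show ?thesis by (cases "\<rho> = 0") auto
    qed
  qed
  also have "\<dots> = ennreal \<epsilon> * ennreal (1 / 2) + ennreal (2 * M) * ennreal ((exp (- 1\<^sup>2) - exp (- b\<^sup>2)) / 2)"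
    using b nn_integral_gaussian_moment_Icc[of 1 b] nn_integral_gaussian_moment_atLeast
    by (simp add: nn_integral_add nn_integral_cmult)
  also have "\<dots> = ennreal (\<epsilon> / 2 + M * \<tau>)"
  proof -
    have "exp (- 1\<^sup>2) - exp (- b\<^sup>2) = \<tau>" by (simp add: exp_b s1_def c_def)
    moreover have "ennreal \<epsilon> * ennreal (1 / 2) = ennreal (\<epsilon> / 2)" "ennreal (2 * M) * ennreal (\<tau> / 2) = ennreal (M * \<tau>)"
      using M \<tau> \<epsilon> by (subst ennreal_mult[symmetric]; simp)+
    moreover have "ennreal (\<epsilon> / 2) + ennreal (M * \<tau>) = ennreal (\<epsilon> / 2 + M * \<tau>)"
      using M \<tau> \<epsilon> by (subst ennreal_plus) auto
    ultimately show ?thesis by (simp only:)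
  qed
  also have "\<dots> \<le> ennreal \<epsilon>" using \<tau> by (intro ennreal_leI) simp
  finally show ?thesis using that[of a m] by (simp add: P_def)
qed

text \<open>
  A Tauberian theorem of Hardy-Littlewood type; the bound \<open>O(|x|\<^sup>-\<^sup>n)\<close> is the Tauberian condition. A
  polynomial \<open>P\<close> in \<open>exp (- |x|\<^sup>2 / r\<^sup>2)\<close> with \<open>P 0 = 0\<close> and \<open>P 1 = 1\<close> is a combination of Gaussians with coefficients of sum
  \<open>1\<close>, so the means of \<open>v\<close> with this weight tend to \<open>L\<close>. They differ from the integral over the ball
  of radius \<open>r\<close> by at most \<open>C \<integral> |x|\<^sup>-\<^sup>n |indicator - P|\<close>, which by homogeneity does not depend on \<open>r\<close> and is small by
  \<open>karamata_polynomial\<close>.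
\<close>

theorem gaussian_means_imp_ball_means:
  fixes v :: "'a::euclidean_space \<Rightarrow> complex"
  assumes vm [measurable]: "v \<in> borel_measurable borel"
    and bound: "\<And>x. norm (v x) \<le> C / (1 + norm x) ^ DIM('a)"
    and lim: "((\<lambda>\<delta>. \<integral>x. of_real (exp (- \<delta> * (norm x)\<^sup>2)) * v x \<partial>lborel) \<longlongrightarrow> L) (at_right 0)"
  shows "((\<lambda>r. \<integral>x. indicator (cball 0 r) x * v x \<partial>lborel) \<longlongrightarrow> L) at_top"
proof (rule tendstoI)
  fix \<epsilon> :: real assume \<epsilon>: "\<epsilon> > 0"
  define A where "A = sphere_area TYPE('a)"
  have A: "A \<ge> 0" unfolding A_def by (rule sphere_area_nonneg)
  have C: "C \<ge> 0" using order_trans[OF norm_ge_zero bound[of 0]] by simp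
  have bound': "norm (v x) \<le> C" for x
  proof -
    have "C / (1 + norm x) ^ DIM('a) \<le> C / 1"
      using C by (intro divide_left_mono one_le_power mult_pos_pos zero_less_power add_pos_nonneg) auto
    then show ?thesis using bound[of x] by simp
  qed
  have bound'': "norm (v x) \<le> C / norm x ^ DIM('a)" if "x \<noteq> 0" for x
    using that C by (intro order_trans[OF bound] divide_left_mono power_mono mult_pos_pos zero_less_power add_pos_nonneg) auto
  define \<Phi> where "\<Phi> \<delta> = (\<integral>x. of_real (exp (- \<delta> * (norm x)\<^sup>2)) * v x \<partial>lborel)" for \<delta>
  have int: "integrable lborel (\<lambda>x. of_real (exp (- \<delta> * (norm x)\<^sup>2)) * v x)" if "\<delta> > 0" for \<delta>
    by (rule Bochner_Integration.integrable_bound[OF integrable_mult_left[OF integrable_gaussian[OF that], of C]])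
       (use bound' C in \<open>auto simp: norm_mult intro!: always_eventually mult_left_mono\<close>)
  define \<epsilon>' where "\<epsilon>' = \<epsilon> / (2 * (C * A + 1))"
  have \<epsilon>': "\<epsilon>' > 0" "C * A * \<epsilon>' < \<epsilon> / 2"
  proof -
    have *: "C * A + 1 > 0" using A C by (simp add: add_nonneg_pos)
    then show "\<epsilon>' > 0" using \<epsilon> by (simp add: \<epsilon>'_def)
    have "C * A * \<epsilon>' < (C * A + 1) * \<epsilon>'" using \<open>\<epsilon>' > 0\<close> by simp
    also have "\<dots> = \<epsilon> / 2" using * by (simp add: \<epsilon>'_def field_simps)
    finally show "C * A * \<epsilon>' < \<epsilon> / 2" .
  qed
  from karamata_polynomial[OF \<epsilon>'(1)] obtain a m where am:
    "(\<integral>\<^sup>+\<rho>. ennreal (\<bar>indicator {..1} \<rho> - (exp (- \<rho>\<^sup>2) + (\<Sum>i\<le>m. a i * (exp (- \<rho>\<^sup>2) ^ (i + 1) - exp (- \<rho>\<^sup>2) ^ (i + 2))))\<bar> / \<rho>)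
        * indicator {0..} \<rho> \<partial>lborel) \<le> ennreal \<epsilon>'" .
  define P where "P s = s + (\<Sum>i\<le>m. a i * (s ^ (i + 1) - s ^ (i + 2)))" for s :: real
  have [measurable]: "P \<in> borel_measurable borel" unfolding P_def[abs_def] by measurable
  define h where "h \<rho> = \<bar>indicator {..1} \<rho> - P (exp (- \<rho>\<^sup>2))\<bar>" for \<rho> :: real
  have [measurable]: "h \<in> borel_measurable borel" unfolding h_def[abs_def] by measurable
  have h_nonneg: "h \<rho> \<ge> 0" for \<rho> by (simp add: h_def)
  have J: "(\<integral>\<^sup>+\<rho>. ennreal (h \<rho> / \<rho>) * indicator {0..} \<rho> \<partial>lborel) \<le> ennreal \<epsilon>'"
    using am by (simp add: h_def P_def)
  \<comment> \<open>The mean of \<open>v\<close> with weight \<open>P\<close>, written out in Gaussian means.\<close>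
  define S where "S r = \<Phi> (1 / r\<^sup>2) + (\<Sum>i\<le>m. of_real (a i) * (\<Phi> (real (i + 1) / r\<^sup>2) - \<Phi> (real (i + 2) / r\<^sup>2)))" for r
  have lim_k: "((\<lambda>r. \<Phi> (real k / r\<^sup>2)) \<longlongrightarrow> L) at_top" if "k > 0" for k
  proof (rule filterlim_compose[OF lim[folded \<Phi>_def]])
    show "filterlim (\<lambda>r. real k / r\<^sup>2) (at_right 0) at_top"
      unfolding filterlim_at
    proof
      show "\<forall>\<^sub>F r in at_top. real k / r\<^sup>2 \<in> {0<..} \<and> real k / r\<^sup>2 \<noteq> 0"
        using eventually_gt_at_top[of 0] by eventually_elim (use that in auto)
      show "((\<lambda>r::real. real k / r\<^sup>2) \<longlongrightarrow> 0) at_top"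
        by (intro tendsto_divide_0[OF tendsto_const] filterlim_at_top_imp_at_infinity filterlim_pow_at_top filterlim_ident) auto
    qed
  qed
  have "(S \<longlongrightarrow> L + (\<Sum>i\<le>m. of_real (a i) * (L - L))) at_top"
    unfolding S_def[abs_def] using lim_k[of 1] by (intro tendsto_intros lim_k) auto
  then have "(S \<longlongrightarrow> L) at_top" by simp
  then have "\<forall>\<^sub>F r in at_top. dist (S r) L < \<epsilon> / 2" using \<epsilon> by (intro tendstoD) auto
  then show "\<forall>\<^sub>F r in at_top. dist (\<integral>x. indicator (cball 0 r) x * v x \<partial>lborel) L < \<epsilon>"
    using eventually_gt_at_top[of 0]
  proof eventually_elim
    case (elim r)
    then have r: "r > 0" by simp
    have pow: "exp (- (norm x / r)\<^sup>2) ^ k = exp (- (real k / r\<^sup>2) * (norm x)\<^sup>2)" for x :: 'a and k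
      by (simp add: exp_of_nat_mult[symmetric] power_divide)
    have intk: "integrable lborel (\<lambda>x. of_real (exp (- (norm x / r)\<^sup>2) ^ k) * v x)" if "k > 0" for k
      unfolding pow using that r by (intro int) auto
    have Phik: "(\<integral>x. of_real (exp (- (norm x / r)\<^sup>2) ^ k) * v x \<partial>lborel) = \<Phi> (real k / r\<^sup>2)" for k
      unfolding pow \<Phi>_def ..
    have Pv: "of_real (P (exp (- (norm x / r)\<^sup>2))) * v x = of_real (exp (- (norm x / r)\<^sup>2) ^ 1) * v x +
       (\<Sum>i\<le>m. of_real (a i) * (of_real (exp (- (norm x / r)\<^sup>2) ^ (i + 1)) * v x - of_real (exp (- (norm x / r)\<^sup>2) ^ (i + 2)) * v x))" for x
      unfolding P_def of_real_add of_real_sum distrib_right sum_distrib_right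
      by (intro arg_cong2[where f="(+)"] sum.cong) (simp_all add: algebra_simps)
    have intP: "integrable lborel (\<lambda>x. of_real (P (exp (- (norm x / r)\<^sup>2))) * v x)"
      unfolding Pv by (intro Bochner_Integration.integrable_add Bochner_Integration.integrable_sum Bochner_Integration.integrable_diff integrable_mult_right intk) auto
    have S: "(\<integral>x. of_real (P (exp (- (norm x / r)\<^sup>2))) * v x \<partial>lborel) = S r"
    proof -
      have "(\<integral>x. of_real (P (exp (- (norm x / r)\<^sup>2))) * v x \<partial>lborel) = \<Phi> (real 1 / r\<^sup>2) + (\<Sum>i\<le>m. of_real (a i) * (\<Phi> (real (i + 1) / r\<^sup>2) - \<Phi> (real (i + 2) / r\<^sup>2)))"
      proof -
        define T where "T k x = of_real (exp (- (norm x / r)\<^sup>2) ^ k) * v x" for k x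
        have T: "integrable lborel (T k)" if "k > 0" for k
          using intk[OF that] by (simp only: T_def[abs_def])
        have Ti: "(\<integral>x. T k x \<partial>lborel) = \<Phi> (real k / r\<^sup>2)" for k
          using Phik[of k] by (simp only: T_def)
        show ?thesis
          unfolding Pv T_def[symmetric] by (simp add: T Ti del: of_nat_Suc of_nat_add)
      qed
      then show ?thesis by (simp add: S_def)
    qed
    have intB: "integrable lborel (\<lambda>x. indicator (cball 0 r) x * v x)"
    proof (rule Bochner_Integration.integrable_bound)
      show "integrable lborel (\<lambda>x::'a. indicator (cball 0 r) x * C)"
        by (intro integrable_mult_left integrable_real_indicator) (use emeasure_lborel_cball_finite[of "0::'a" r] in \<open>simp_all add: top.not_eq_extremum\<close>)
    qed (use bound' C in \<open>auto simp: indicator_def\<close>)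
    have "ennreal (norm ((\<integral>x. indicator (cball 0 r) x * v x \<partial>lborel) - S r))
       = ennreal (norm (\<integral>x. indicator (cball 0 r) x * v x - of_real (P (exp (- (norm x / r)\<^sup>2))) * v x \<partial>lborel))"
      unfolding S[symmetric] using intB intP by simp
    also have "\<dots> \<le> (\<integral>\<^sup>+x. ennreal (norm (indicator (cball 0 r) x * v x - of_real (P (exp (- (norm x / r)\<^sup>2))) * v x)) \<partial>lborel)"
      using intB intP by (intro integral_norm_bound_ennreal) simp
    also have "\<dots> \<le> (\<integral>\<^sup>+x. ennreal (C / norm x ^ DIM('a) * h (norm x / r)) \<partial>(lborel :: 'a measure))"
    proof (intro nn_integral_mono_AE)
      show "AE x in lborel. ennreal (norm (indicator (cball 0 r) x * v x - of_real (P (exp (- (norm x / r)\<^sup>2))) * v x)) \<le> ennreal (C / norm x ^ DIM('a) * h (norm x / r))"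
        using AE_lborel_singleton[of "0::'a"]
      proof eventually_elim
        case (elim x)
        have "indicator (cball 0 r) x * v x - of_real (P (exp (- (norm x / r)\<^sup>2))) * v x
           = of_real (indicator {..1} (norm x / r) - P (exp (- (norm x / r)\<^sup>2))) * v x"
          using r by (auto simp: indicator_def algebra_simps)
        then have "norm (indicator (cball 0 r) x * v x - of_real (P (exp (- (norm x / r)\<^sup>2))) * v x) = h (norm x / r) * norm (v x)"
          by (simp only: norm_mult norm_of_real h_def)
        also have "\<dots> \<le> h (norm x / r) * (C / norm x ^ DIM('a))"
          by (intro mult_left_mono bound'' elim h_nonneg)
        finally show ?case by (intro ennreal_leI) (simp add: mult_ac)
      qed
    qed
    also have "\<dots> = (\<integral>\<^sup>+\<rho>. ennreal (A * \<rho> ^ (DIM('a) - 1)) * indicator {0..} \<rho> * ennreal (C / \<rho> ^ DIM('a) * h (\<rho> / r)) \<partial>lborel)"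
      unfolding A_def by (rule nn_integral_norm) measurable
    also have "\<dots> = (\<integral>\<^sup>+\<rho>. ennreal (C * A / r) * (ennreal (h (\<rho> / r) / (\<rho> / r)) * indicator {0..} (\<rho> / r)) \<partial>lborel)"
    proof (intro nn_integral_cong)
      fix \<rho> :: real
      define n where "n = DIM('a) - 1"
      have n: "DIM('a) = Suc n" by (simp add: n_def)
      have "A * \<rho> ^ n * (C / \<rho> ^ Suc n * h (\<rho> / r)) = C * A / r * (h (\<rho> / r) / (\<rho> / r))"
        using r by (cases "\<rho> = 0") auto
      then show "ennreal (A * \<rho> ^ (DIM('a) - 1)) * indicator {0..} \<rho> * ennreal (C / \<rho> ^ DIM('a) * h (\<rho> / r))
         = ennreal (C * A / r) * (ennreal (h (\<rho> / r) / (\<rho> / r)) * indicator {0..} (\<rho> / r))"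
        using r A C h_nonneg[of "\<rho> / r"]
        by (cases "\<rho> \<ge> 0") (auto simp: n ennreal_mult[symmetric] zero_le_divide_iff simp del: power_Suc)
    qed
    also have "\<dots> = ennreal (C * A / r) * (\<integral>\<^sup>+\<rho>. ennreal (h (\<rho> / r) / (\<rho> / r)) * indicator {0..} (\<rho> / r) \<partial>lborel)"
      by (rule nn_integral_cmult) measurable
    also have "(\<integral>\<^sup>+\<rho>. ennreal (h (\<rho> / r) / (\<rho> / r)) * indicator {0..} (\<rho> / r) \<partial>lborel)
        = ennreal r * (\<integral>\<^sup>+\<rho>. ennreal (h \<rho> / \<rho>) * indicator {0..} \<rho> \<partial>lborel)"
      using r by (subst nn_integral_real_affine[where c=r and t=0]) auto
    also have "ennreal (C * A / r) * (ennreal r * (\<integral>\<^sup>+\<rho>. ennreal (h \<rho> / \<rho>) * indicator {0..} \<rho> \<partial>lborel))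
        \<le> ennreal (C * A / r) * (ennreal r * ennreal \<epsilon>')"
      by (intro mult_left_mono J) auto
    also have "\<dots> = ennreal (C * A * \<epsilon>')"
      using r A C \<epsilon>' by (simp add: ennreal_mult[symmetric])
    also have "\<dots> < ennreal (\<epsilon> / 2)" using \<epsilon>' A C \<epsilon> by (intro ennreal_lessI) auto
    finally have "norm ((\<integral>x. indicator (cball 0 r) x * v x \<partial>lborel) - S r) < \<epsilon> / 2"
      by (subst (asm) ennreal_less_iff) auto
    then have "dist (\<integral>x. indicator (cball 0 r) x * v x \<partial>lborel) (S r) < \<epsilon> / 2"
      by (simp add: dist_norm)
    with elim(1) show ?case
      using dist_triangle[of "\<integral>x. indicator (cball 0 r) x * v x \<partial>lborel" L "S r"] by linarith
  qed
qed

section \<open>The Riesz transform of a decaying function\<close>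

text \<open>
  The kernel of the Riesz transform in the direction \<open>e\<close>, up to the factor \<^const>\<open>riesz_const\<close>.
\<close>

definition riesz_kernel :: "'a::euclidean_space \<Rightarrow> 'a \<Rightarrow> real" where
  "riesz_kernel e z = (z \<bullet> e) / norm z ^ (DIM('a) + 1)"

text \<open>
  The principal value in symmetrized form: the kernel is odd, and the difference of the values of \<open>g\<close> at \<open>x - z\<close> and
  \<open>x + z\<close> is small for small \<open>z\<close>, so for decaying \<open>g\<close> of class \<open>C\<^sup>1\<close> this integral converges absolutely.
\<close>

definition riesz_pv :: "'a::euclidean_space \<Rightarrow> ('a \<Rightarrow> complex) \<Rightarrow> 'a \<Rightarrow> complex" where
  "riesz_pv e g x = (1 / 2) * (\<integral>z. of_real (riesz_kernel e z) * (g (x - z) - g (x + z)) \<partial>lborel)"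

lemma measurable_riesz_kernel [measurable]: "riesz_kernel e \<in> borel_measurable borel"
  unfolding riesz_kernel_def[abs_def] by measurable

lemma riesz_kernel_minus [simp]: "riesz_kernel e (- z) = - riesz_kernel e z"
  by (simp add: riesz_kernel_def)

lemma abs_riesz_kernel_le:
  fixes e :: "'a::euclidean_space"
  assumes e: "e \<in> Basis"
  shows "\<bar>riesz_kernel e z\<bar> \<le> 1 / norm z ^ DIM('a)"
proof (cases "z = 0")
  case False
  have "\<bar>riesz_kernel e z\<bar> \<le> norm z / norm z ^ (DIM('a) + 1)"
    unfolding riesz_kernel_def abs_divide using Basis_le_norm[OF e, of z]
    by (simp only: abs_of_nonneg[OF zero_le_power[OF norm_ge_zero]]) (rule divide_right_mono, auto)
  then show ?thesis using False by simp
qed (simp add: riesz_kernel_def)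

text \<open>
  The exponent \<open>n + 2\<close> makes \<open>(1 + |x|) |g x|\<close> integrable. The exponent \<open>n + 1\<close> for the derivative
  yields the decay \<open>O(|x|\<^sup>-\<^sup>n)\<close> of the Riesz transform, which is the true order when the integral of \<open>g\<close> is not \<open>0\<close>.
\<close>

locale decaying_C1 =
  fixes g :: "'a::euclidean_space \<Rightarrow> complex" and g' :: "'a \<Rightarrow> 'a \<Rightarrow> complex" and C :: real and e :: 'a
  assumes deriv: "\<And>x. (g has_derivative g' x) (at x)"
    and bound: "\<And>x. norm (g x) \<le> C / (1 + norm x) ^ (DIM('a) + 2)"
    and deriv_bound: "\<And>x. onorm (g' x) \<le> C / (1 + norm x) ^ (DIM('a) + 1)"
    and e: "e \<in> Basis"
begin

lemma C_nonneg: "C \<ge> 0"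
  using order_trans[OF norm_ge_zero bound[of 0]] by simp

lemma measurable_g [measurable]: "g \<in> borel_measurable borel"
  by (intro borel_measurable_continuous_onI has_derivative_continuous_on[of UNIV g g']) (use deriv in auto)

lemma moment_bound: "(1 + norm x) * norm (g x) \<le> C * (1 / (1 + norm x) ^ (DIM('a) + 1))"
proof -
  define p where "p = 1 + norm x"
  have p: "p > 0" by (simp add: p_def add_pos_nonneg)
  have "p * norm (g x) \<le> p * (C / p ^ (DIM('a) + 2))"
    using p bound[of x] by (intro mult_left_mono) (auto simp: p_def)
  also have "\<dots> = C * (1 / p ^ (DIM('a) + 1))"
    using p by (simp add: field_simps)
  finally show ?thesis by (simp only: p_def)
qed

lemma integrable_moment: "integrable lborel (\<lambda>x. (1 + norm x) * norm (g x))"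
proof (rule Bochner_Integration.integrable_bound[OF integrable_mult_right[OF integrable_inverse_norm_power, of C]])
  show "AE x in lborel. norm ((1 + norm x) * norm (g x)) \<le> norm (C * (1 / (1 + norm x) ^ (DIM('a) + 1)))"
  proof (intro always_eventually allI)
    fix x
    have "norm ((1 + norm x) * norm (g x)) = (1 + norm x) * norm (g x)" by simp
    also note moment_bound[of x]
    finally show "norm ((1 + norm x) * norm (g x)) \<le> norm (C * (1 / (1 + norm x) ^ (DIM('a) + 1)))" 
      using C_nonneg by simp
  qed
qed measurable

lemma integrable_g: "integrable lborel g"
  by (rule Bochner_Integration.integrable_bound[OF integrable_moment]) (auto simp: algebra_simps)

text \<open>
  Every \<open>w\<close> at distance at most \<open>|z|\<close> from \<open>x\<close> satisfies \<open>1 + |w| \<ge> (1 + |x|) / 2\<close>, so the mean value inequality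
  applies with a bound for the derivative in terms of \<open>x\<close>.
\<close>

lemma symmetric_difference_le:
  assumes "norm z \<le> (1 + norm x) / 2"
  shows "norm (g (x - z) - g (x + z)) \<le> 2 * C / ((1 + norm x) / 2) ^ (DIM('a) + 1) * norm z"
proof -
  have "norm (g (x - z) - g (x + z)) \<le> C / ((1 + norm x) / 2) ^ (DIM('a) + 1) * norm ((x - z) - (x + z))"
  proof (rule differentiable_bound)
    show "convex (cball x (norm z))" by (rule convex_cball)
    show "(g has_derivative g' w) (at w within cball x (norm z))" for w
      by (rule has_derivative_at_withinI[OF deriv])
    show "onorm (g' w) \<le> C / ((1 + norm x) / 2) ^ (DIM('a) + 1)" if "w \<in> cball x (norm z)" for w
    proof -
      have "norm x \<le> norm w + norm z"
        using that norm_triangle_sub[of x w] by (simp add: dist_norm)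
      then have "(1 + norm x) / 2 \<le> 1 + norm w" using assms by (simp add: field_simps)
      moreover have "0 < (1 + norm x) / 2" "0 < 1 + norm w" by (simp_all add: add_pos_nonneg)
      ultimately have "C / (1 + norm w) ^ (DIM('a) + 1) \<le> C / ((1 + norm x) / 2) ^ (DIM('a) + 1)"
        using C_nonneg by (intro divide_left_mono power_mono mult_pos_pos zero_less_power) auto
      then show ?thesis using deriv_bound[of w] by linarith
    qed
    show "x - z \<in> cball x (norm z)" "x + z \<in> cball x (norm z)" by (auto simp: dist_norm)
  qed
  also have "norm ((x - z) - (x + z)) = 2 * norm z"
  proof -
    have "(x - z) - (x + z) = - (2 *\<^sub>R z)" by (simp add: scaleR_2)
    then show ?thesis by (simp only: norm_minus_cancel norm_scaleR abs_numeral)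
  qed
  finally show ?thesis by (simp add: mult_ac)
qed

definition bound_const :: real where
  "bound_const = 2 ^ (DIM('a) + 1) * C * sphere_area TYPE('a) + 2 * 2 ^ DIM('a) * (\<integral>x. norm (g x) \<partial>lborel)"

lemma bound_const_nonneg: "bound_const \<ge> 0"
  unfolding bound_const_def using C_nonneg sphere_area_nonneg[where 'a='a] by simp

text \<open>
  Split at \<open>|z| = \<rho> / 2\<close> with \<open>\<rho> = 1 + |x|\<close>. Inside, the difference of values is \<open>O(|z| / \<rho> ^ (n + 1))\<close>, and
  \<open>|z| ^ (1 - n)\<close> has integral \<open>O(\<rho>)\<close> over the ball; outside, the kernel is \<open>O(\<rho> ^ (- n))\<close> and \<open>g\<close> is integrable.
\<close>

lemma nn_integral_kernel_le:
  "(\<integral>\<^sup>+z. ennreal (norm (of_real (riesz_kernel e z) * (g (x - z) - g (x + z)))) \<partial>lborel) \<le> ennreal (bound_const / (1 + norm x) ^ DIM('a))"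
proof -
  define \<rho> where "\<rho> = 1 + norm x"
  have \<rho>: "\<rho> > 0" by (simp add: \<rho>_def add_pos_nonneg)
  define a where "a = 2 * C / (\<rho> / 2) ^ (DIM('a) + 1)"
  define b where "b = 1 / (\<rho> / 2) ^ DIM('a)"
  have [measurable]: "cball 0 (\<rho> / 2) \<in> sets (borel :: 'a measure)" by simp
  have ab: "a \<ge> 0" "b \<ge> 0" using \<rho> C_nonneg by (auto simp: a_def b_def)
  have "(\<integral>\<^sup>+z. ennreal (norm (of_real (riesz_kernel e z) * (g (x - z) - g (x + z)))) \<partial>lborel)
     \<le> (\<integral>\<^sup>+z. ennreal a * (ennreal (1 / norm z ^ (DIM('a) - 1)) * indicator (cball 0 (\<rho> / 2)) z)
         + ennreal b * (ennreal (norm (g (x - z))) + ennreal (norm (g (x + z)))) \<partial>lborel)"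
  proof (rule nn_integral_mono)
    fix z :: 'a
    define \<Delta> where "\<Delta> = norm (g (x - z) - g (x + z))"
    have n: "norm (of_real (riesz_kernel e z) * (g (x - z) - g (x + z))) = \<bar>riesz_kernel e z\<bar> * \<Delta>"
      by (simp add: norm_mult \<Delta>_def)
    show "ennreal (norm (of_real (riesz_kernel e z) * (g (x - z) - g (x + z)))) \<le>
      ennreal a * (ennreal (1 / norm z ^ (DIM('a) - 1)) * indicator (cball 0 (\<rho> / 2)) z)
         + ennreal b * (ennreal (norm (g (x - z))) + ennreal (norm (g (x + z))))"
    proof (cases "norm z \<le> \<rho> / 2")
      case True
      have "\<bar>riesz_kernel e z\<bar> * \<Delta> \<le> 1 / norm z ^ DIM('a) * (a * norm z)"
        using symmetric_difference_le[of z x] True unfolding \<rho>_def[symmetric] a_def[symmetric] \<Delta>_def[symmetric]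
        by (intro mult_mono abs_riesz_kernel_le e) (auto simp: \<Delta>_def)
      also have "\<dots> = a * (norm z / norm z ^ DIM('a))" by simp
      also have "\<dots> \<le> a * (1 / norm z ^ (DIM('a) - 1))"
      proof (intro mult_left_mono ab)
        define m where "m = DIM('a) - 1"
        have m: "DIM('a) = Suc m" by (simp add: m_def)
        show "norm z / norm z ^ DIM('a) \<le> 1 / norm z ^ (DIM('a) - 1)"
          by (cases "z = 0") (simp_all add: m)
      qed
      finally have "ennreal (\<bar>riesz_kernel e z\<bar> * \<Delta>) \<le> ennreal a * (ennreal (1 / norm z ^ (DIM('a) - 1)) * indicator (cball 0 (\<rho> / 2)) z)"
        using True ab by (simp add: ennreal_mult[symmetric] ennreal_leI)
      then show ?thesis unfolding n by (rule order_trans) simp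
    next
      case False
      have "1 / norm z ^ DIM('a) \<le> b"
        unfolding b_def using False \<rho> by (intro divide_left_mono power_mono mult_pos_pos zero_less_power) auto
      then have "\<bar>riesz_kernel e z\<bar> \<le> b" using abs_riesz_kernel_le[OF e, of z] by linarith
      then have "\<bar>riesz_kernel e z\<bar> * \<Delta> \<le> b * (norm (g (x - z)) + norm (g (x + z)))"
        unfolding \<Delta>_def by (intro mult_mono norm_triangle_ineq4 ab) auto
      then have "ennreal (\<bar>riesz_kernel e z\<bar> * \<Delta>) \<le> ennreal b * (ennreal (norm (g (x - z))) + ennreal (norm (g (x + z))))"
        using ab by (simp add: ennreal_mult[symmetric] ennreal_plus[symmetric] ennreal_leI del: ennreal_plus)
      then show ?thesis unfolding n by (rule order_trans) simp
    qed
  qed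
  also have "\<dots> = ennreal a * (\<integral>\<^sup>+z. ennreal (1 / norm z ^ (DIM('a) - 1)) * indicator (cball 0 (\<rho> / 2)) z \<partial>(lborel :: 'a measure))
      + ennreal b * ((\<integral>\<^sup>+z. ennreal (norm (g (x - z))) \<partial>lborel) + (\<integral>\<^sup>+z. ennreal (norm (g (x + z))) \<partial>lborel))"
    by (simp add: nn_integral_add nn_integral_cmult)
  also have "(\<integral>\<^sup>+z. ennreal (norm (g (x - z))) \<partial>lborel) = ennreal (\<integral>z. norm (g z) \<partial>lborel)"
    using integrable_reflect_iff[THEN iffD2, OF integrable_norm[OF integrable_g]] integral_reflect[of "\<lambda>z. norm (g z)" x]
    by (subst nn_integral_eq_integral) auto
  also have "(\<integral>\<^sup>+z. ennreal (norm (g (x + z))) \<partial>lborel) = ennreal (\<integral>z. norm (g z) \<partial>lborel)"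
    using integrable_translate_iff[THEN iffD2, OF integrable_norm[OF integrable_g]] integral_translate[of "\<lambda>z. norm (g z)" x]
    by (subst nn_integral_eq_integral) auto
  also have "ennreal a * (\<integral>\<^sup>+z. ennreal (1 / norm z ^ (DIM('a) - 1)) * indicator (cball 0 (\<rho> / 2)) z \<partial>(lborel :: 'a measure))
      \<le> ennreal a * ennreal (sphere_area TYPE('a) * (\<rho> / 2))"
    using \<rho> by (intro mult_left_mono nn_integral_inverse_norm_cball_le) auto
  also have "ennreal a * ennreal (sphere_area TYPE('a) * (\<rho> / 2)) + ennreal b * (ennreal (\<integral>z. norm (g z) \<partial>lborel) + ennreal (\<integral>z. norm (g z) \<partial>lborel))
      = ennreal (a * (sphere_area TYPE('a) * (\<rho> / 2)) + b * ((\<integral>z. norm (g z) \<partial>lborel) + (\<integral>z. norm (g z) \<partial>lborel)))"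
    using ab \<rho> sphere_area_nonneg[where 'a='a] by (simp add: ennreal_mult[symmetric] ennreal_plus[symmetric] del: ennreal_plus)
  also have "a * (sphere_area TYPE('a) * (\<rho> / 2)) + b * ((\<integral>z. norm (g z) \<partial>lborel) + (\<integral>z. norm (g z) \<partial>lborel)) = bound_const / \<rho> ^ DIM('a)"
    using \<rho> by (simp add: a_def b_def bound_const_def power_divide field_simps)
  finally show ?thesis by (simp add: \<rho>_def add_right_mono)
qed

lemma integrable_kernel: "integrable lborel (\<lambda>z. of_real (riesz_kernel e z) * (g (x - z) - g (x + z)))"
  by (rule integrableI_bounded) (use nn_integral_kernel_le[of x] in \<open>auto intro: le_less_trans\<close>)

lemma integral_norm_kernel_le:
  "(\<integral>z. norm (of_real (riesz_kernel e z) * (g (x - z) - g (x + z))) \<partial>lborel) \<le> bound_const / (1 + norm x) ^ DIM('a)"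
proof -
  have "ennreal (\<integral>z. norm (of_real (riesz_kernel e z) * (g (x - z) - g (x + z))) \<partial>lborel) \<le> ennreal (bound_const / (1 + norm x) ^ DIM('a))"
    using nn_integral_kernel_le[of x] nn_integral_eq_integral[OF integrable_norm[OF integrable_kernel[of x]]] by simp
  then show ?thesis using bound_const_nonneg by (subst (asm) ennreal_le_iff) auto
qed

lemma norm_riesz_pv_le: "norm (riesz_pv e g x) \<le> bound_const / (1 + norm x) ^ DIM('a)"
proof -
  have "norm (riesz_pv e g x) \<le> 1 * norm (\<integral>z. of_real (riesz_kernel e z) * (g (x - z) - g (x + z)) \<partial>lborel)"
    unfolding riesz_pv_def norm_mult by (rule mult_right_mono) auto
  also have "\<dots> \<le> bound_const / (1 + norm x) ^ DIM('a)"
    unfolding mult_1 by (rule order_trans[OF integral_norm_bound integral_norm_kernel_le])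
  finally show ?thesis .
qed

lemma measurable_riesz_pv [measurable]: "riesz_pv e g \<in> borel_measurable borel"
  unfolding riesz_pv_def[abs_def] by measurable

text \<open>
  The truncated kernel is odd and integrable against \<open>g\<close>, so its integral equals the symmetrized one; the
  latter converges by domination.
\<close>

lemma riesz_pv_principal_value:
  "((\<lambda>\<epsilon>. LINT y:{y. norm (x - y) \<ge> \<epsilon>}|lborel. of_real (riesz_kernel e (x - y)) * g y) \<longlongrightarrow> riesz_pv e g x) (at_right 0)"
proof -
  define D where "D z = of_real (riesz_kernel e z) * (g (x - z) - g (x + z))" for z
  have D: "integrable lborel D" using integrable_kernel[of x] by (simp add: D_def[abs_def])
  have [measurable]: "D \<in> borel_measurable borel" using D by auto
  have trunc: "(LINT y:{y. norm (x - y) \<ge> \<epsilon>}|lborel. of_real (riesz_kernel e (x - y)) * g y)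
      = (1 / 2) * (\<integral>z. indicator {z. norm z \<ge> \<epsilon>} z *\<^sub>R D z \<partial>lborel)" if \<epsilon>: "\<epsilon> > 0" for \<epsilon>
  proof -
    \<comment> \<open>Averaging the integrals of \<open>h\<close> and of its reflection symmetrizes the integrand.\<close>
    define h where "h z = indicator {z. norm z \<ge> \<epsilon>} z *\<^sub>R (of_real (riesz_kernel e z) * g (x - z))" for z
    have hm [measurable]: "h \<in> borel_measurable borel" unfolding h_def[abs_def] by measurable
    have "integrable lborel (\<lambda>z. g (x - z))"
      using integrable_g by (rule integrable_reflect_iff[THEN iffD2])
    then have "integrable lborel (\<lambda>z. norm (g (x - z)) * (1 / \<epsilon> ^ DIM('a)))"
      by (intro integrable_mult_left integrable_norm)
    then have h: "integrable lborel h"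
    proof (rule Bochner_Integration.integrable_bound)
      show "AE z in lborel. norm (h z) \<le> norm (norm (g (x - z)) * (1 / \<epsilon> ^ DIM('a)))"
      proof (intro always_eventually allI)
        fix z
        have "\<bar>riesz_kernel e z\<bar> \<le> 1 / \<epsilon> ^ DIM('a)" if "norm z \<ge> \<epsilon>"
          by (rule order_trans[OF abs_riesz_kernel_le[OF e]])
             (use that \<epsilon> in \<open>intro divide_left_mono power_mono mult_pos_pos zero_less_power; auto\<close>)
        then have "\<bar>riesz_kernel e z\<bar> * norm (g (x - z)) \<le> 1 / \<epsilon> ^ DIM('a) * norm (g (x - z))" if "norm z \<ge> \<epsilon>"
          using that by (intro mult_right_mono) auto
        then show "norm (h z) \<le> norm (norm (g (x - z)) * (1 / \<epsilon> ^ DIM('a)))"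
          using \<epsilon> by (auto simp: h_def norm_mult indicator_def mult.commute)
      qed
    qed measurable
    have "(LINT y:{y. norm (x - y) \<ge> \<epsilon>}|lborel. of_real (riesz_kernel e (x - y)) * g y) = (\<integral>y. h (x - y) \<partial>lborel)"
      unfolding set_lebesgue_integral_def h_def by (simp add: indicator_def)
    then have 1: "(LINT y:{y. norm (x - y) \<ge> \<epsilon>}|lborel. of_real (riesz_kernel e (x - y)) * g y) = (\<integral>z. h z \<partial>lborel)"
      by (rule trans) (rule integral_reflect)
    have "(\<integral>z. h z \<partial>lborel) = (\<integral>z. h (0 - z) \<partial>lborel)" by (rule integral_reflect[symmetric])
    moreover have h': "integrable lborel (\<lambda>z. h (0 - z))" using h by (rule integrable_reflect_iff[THEN iffD2])
    ultimately have "(\<integral>z. h z \<partial>lborel) + (\<integral>z. h z \<partial>lborel) = (\<integral>z. h z + h (0 - z) \<partial>lborel)"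
      using h by simp
    also have "\<dots> = (\<integral>z. indicator {z. norm z \<ge> \<epsilon>} z *\<^sub>R D z \<partial>lborel)"
      by (intro Bochner_Integration.integral_cong) (auto simp: h_def D_def indicator_def algebra_simps)
    finally show ?thesis unfolding 1 by (simp add: mult.commute)
  qed
  have "((\<lambda>t. \<integral>z. indicator {z. norm z \<ge> inverse t} z *\<^sub>R D z \<partial>lborel) \<longlongrightarrow> (\<integral>z. D z \<partial>lborel)) at_top"
  proof (rule integral_dominated_convergence_at_top[where w="\<lambda>z. norm (D z)"])
    show "integrable lborel (\<lambda>z. norm (D z))" using D by simp
    show "\<forall>\<^sub>F t in at_top. AE z in lborel. norm (indicator {z. norm z \<ge> inverse t} z *\<^sub>R D z) \<le> norm (D z)"
      by (intro always_eventually allI) (auto simp: indicator_def)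
    show "AE z in lborel. ((\<lambda>t. indicator {z. norm z \<ge> inverse t} z *\<^sub>R D z) \<longlongrightarrow> D z) at_top"
    proof (intro always_eventually allI)
      fix z :: 'a
      show "((\<lambda>t. indicator {z. norm z \<ge> inverse t} z *\<^sub>R D z) \<longlongrightarrow> D z) at_top"
      proof (cases "z = 0")
        case True
        then show ?thesis by (simp add: D_def)
      next
        case False
        have "\<forall>\<^sub>F t in at_top. inverse t < norm z"
          using tendsto_inverse_0_at_top[OF filterlim_ident] False by (intro order_tendstoD) auto
        then have "\<forall>\<^sub>F t in at_top. indicator {z. norm z \<ge> inverse t} z *\<^sub>R D z = D z"
          by eventually_elim simp
        then show ?thesis by (rule tendsto_eventually)
      qed
    qed
  qed measurable
  then have "((\<lambda>t. (1 / 2) * (\<integral>z. indicator {z. norm z \<ge> inverse t} z *\<^sub>R D z \<partial>lborel)) \<longlongrightarrow> riesz_pv e g x) at_top"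
    unfolding riesz_pv_def D_def by (rule tendsto_mult_left)
  then have "((\<lambda>\<epsilon>. (1 / 2) * (\<integral>z. indicator {z. norm z \<ge> \<epsilon>} z *\<^sub>R D z \<partial>lborel)) \<longlongrightarrow> riesz_pv e g x) (at_right 0)"
    by (simp add: filterlim_at_right_to_top)
  then show ?thesis
    by (rule Lim_transform_eventually)
       (use eventually_at_right_less[of 0] in \<open>eventually_elim, simp add: trunc\<close>)
qed

end

section \<open>The Riesz kernel as a superposition of Gaussians\<close>

lemma has_bochner_integral_Gamma:
  assumes s: "s > (0::real)" and a: "a > 0"
  shows "has_bochner_integral lborel (\<lambda>t. indicator {0<..} t * (t powr (s - 1) * exp (- (a * t)))) (Gamma s / a powr s)"
proof -
  let ?f = "\<lambda>t::real. indicator {0..} t * t powr (s - 1) / exp t"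
  have "has_bochner_integral lborel ?f (Gamma s)"
    by (rule has_bochner_integral_nn_integral)
       (use s in \<open>auto simp: Gamma_conv_nn_integral_real Gamma_real_pos intro!: less_imp_le\<close>)
  then have "has_bochner_integral lborel (\<lambda>t. ?f (0 + a * t)) (Gamma s /\<^sub>R \<bar>a\<bar>)"
    by (subst lborel_has_bochner_integral_real_affine_iff[symmetric]) (use a in auto)
  then have "has_bochner_integral lborel (\<lambda>t. a powr (1 - s) * ?f (0 + a * t)) (a powr (1 - s) * (Gamma s /\<^sub>R \<bar>a\<bar>))"
    by (rule has_bochner_integral_mult_right)
  moreover have "a powr (1 - s) * (Gamma s /\<^sub>R \<bar>a\<bar>) = Gamma s / a powr s"
    using a by (simp add: powr_diff field_simps)
  moreover have "a powr (1 - s) * ?f (0 + a * t) = indicator {0<..} t * (t powr (s - 1) * exp (- (a * t)))" for t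
  proof (cases "t > 0")
    case True
    have "a powr (1 - s) * a powr (s - 1) = 1" using a by (simp add: powr_add[symmetric])
    moreover have "a powr (1 - s) * ?f (0 + a * t) = (a powr (1 - s) * a powr (s - 1)) * (t powr (s - 1) * exp (- (a * t)))"
      using True a by (simp add: powr_mult exp_minus divide_inverse)
    ultimately show ?thesis using True by simp
  next
    case False
    then show ?thesis using a by (cases "t = 0") (auto simp: indicator_def zero_le_mult_iff)
  qed
  ultimately show ?thesis by simp
qed

text \<open>
  The density for which the Riesz kernel, with its constant, is
  \<open>\<integral> riesz_weight n t \<cdot> (z \<bullet> e) \<cdot> exp (- t |z|\<^sup>2) dt\<close>.
\<close>

definition riesz_weight :: "nat \<Rightarrow> real \<Rightarrow> real" where
  "riesz_weight n t = indicator {0<..} t * (t powr ((real n - 1) / 2) / pi powr ((real n + 1) / 2))"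

lemma measurable_riesz_weight [measurable]: "riesz_weight n \<in> borel_measurable borel"
  unfolding riesz_weight_def[abs_def] by measurable

lemma riesz_weight_nonneg: "riesz_weight n t \<ge> 0"
  by (simp add: riesz_weight_def indicator_def)

lemma riesz_const_nonneg: "riesz_const n \<ge> 0"
  unfolding riesz_const_def by (intro divide_nonneg_nonneg less_imp_le[OF Gamma_real_pos]) auto

text \<open>
  The Gamma integral with exponent \<open>(n + 1) / 2\<close> represents \<open>|z| ^ (- (n + 1))\<close>.
\<close>

lemma has_bochner_integral_riesz_kernel:
  fixes z e :: "'a::euclidean_space"
  shows "has_bochner_integral lborel (\<lambda>t. riesz_weight DIM('a) t * ((z \<bullet> e) * exp (- t * (norm z)\<^sup>2)))
      (riesz_const DIM('a) * riesz_kernel e z)"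
proof (cases "z = 0")
  case True
  then show ?thesis by (simp add: riesz_kernel_def has_bochner_integral_zero)
next
  case False
  define s where "s = (real DIM('a) + 1) / 2"
  have s: "s > 0" by (simp add: s_def add_nonneg_pos)
  have a: "(norm z)\<^sup>2 > 0" using False by simp
  have "(norm z)\<^sup>2 powr s = norm z powr (2 * s)"
    using False by (simp add: powr_powr[symmetric] powr_numeral)
  also have "2 * s = real (DIM('a) + 1)" by (simp add: s_def)
  also have "norm z powr \<dots> = norm z ^ (DIM('a) + 1)" using False by (subst powr_realpow) auto
  finally have pow: "(norm z)\<^sup>2 powr s = norm z ^ (DIM('a) + 1)" .
  have "has_bochner_integral lborel (\<lambda>t. ((z \<bullet> e) / pi powr s) * (indicator {0<..} t * (t powr (s - 1) * exp (- ((norm z)\<^sup>2 * t)))))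
     (((z \<bullet> e) / pi powr s) * (Gamma s / (norm z)\<^sup>2 powr s))"
    by (intro has_bochner_integral_mult_right has_bochner_integral_Gamma s a)
  moreover have "((z \<bullet> e) / pi powr s) * (Gamma s / (norm z)\<^sup>2 powr s) = riesz_const DIM('a) * riesz_kernel e z"
    unfolding pow by (simp add: riesz_const_def riesz_kernel_def s_def)
  moreover have "((z \<bullet> e) / pi powr s) * (indicator {0<..} t * (t powr (s - 1) * exp (- ((norm z)\<^sup>2 * t))))
     = riesz_weight DIM('a) t * ((z \<bullet> e) * exp (- t * (norm z)\<^sup>2))" for t
  proof -
    have *: "(real DIM('a) - 1) / 2 = s - 1" by (simp add: s_def field_simps)
    show ?thesis unfolding riesz_weight_def s_def[symmetric] * by (simp add: mult_ac)
  qed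
  ultimately show ?thesis by simp
qed

lemma einterval_0_infty: "einterval 0 \<infinity> = {0<..}"
  by (auto simp: einterval_def zero_ereal_def)

text \<open>
  An antiderivative is \<open>2 arctan (\<surd>t)\<close>. This function dominates all integrals over the Gaussian parameter \<open>t\<close>
  below.
\<close>

lemma set_integrable_inverse_sqrt_decay:
  "set_integrable lborel {0<..} (\<lambda>t. 1 / (sqrt t * (1 + t)))"
proof -
  have "set_integrable lborel (einterval 0 \<infinity>) (\<lambda>t. 1 / (sqrt t * (1 + t)))"
  proof (rule interval_integral_FTC_nonneg(1)[where F="\<lambda>t. 2 * arctan (sqrt t)"])
    show "DERIV (\<lambda>t. 2 * arctan (sqrt t)) t :> 1 / (sqrt t * (1 + t))" if "0 < ereal t" for t
    proof -
      have t: "t > 0" using that by simp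
      have "DERIV (\<lambda>t. 2 * arctan (sqrt t)) t :> 2 * (inverse (1 + (sqrt t)\<^sup>2) * (inverse (sqrt t) / 2))"
        using t by (auto intro!: derivative_eq_intros)
      also have "2 * (inverse (1 + (sqrt t)\<^sup>2) * (inverse (sqrt t) / 2)) = 1 / (sqrt t * (1 + t))"
        using t by (simp add: inverse_eq_divide mult.commute)
      finally show ?thesis .
    qed
    have "((\<lambda>t::real. 2 * arctan (sqrt t)) \<longlongrightarrow> 2 * arctan (sqrt 0)) (at_right 0)"
      by (intro tendsto_intros)
    then show "(((\<lambda>t. 2 * arctan (sqrt t)) \<circ> real_of_ereal) \<longlongrightarrow> 0) (at_right 0)"
      by (simp add: zero_ereal_def ereal_tendsto_simps)
    have "((\<lambda>t::real. 2 * arctan (sqrt t)) \<longlongrightarrow> 2 * (pi / 2)) at_top"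
      by (intro tendsto_intros filterlim_compose[OF tendsto_arctan_at_top] sqrt_at_top)
    then show "(((\<lambda>t. 2 * arctan (sqrt t)) \<circ> real_of_ereal) \<longlongrightarrow> pi) (at_left \<infinity>)"
      by (simp add: ereal_tendsto_simps)
  qed (auto intro!: continuous_intros simp: zero_ereal_def)
  then show ?thesis by (simp add: einterval_0_infty)
qed

lemma exp_neg_divide_le:
  fixes c t :: real
  assumes "c > 0" "t > 0"
  shows "exp (- c / t) / t \<le> (1 + 1 / c) / (1 + t)"
proof -
  have "c / t \<le> exp (c / t)" using exp_ge_add_one_self[of "c / t"] by linarith
  then have "exp (- (c / t)) * (c / t) \<le> exp (- (c / t)) * exp (c / t)"
    by (intro mult_left_mono) auto
  then have "exp (- (c / t)) * (c / t) \<le> 1"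
    by (simp add: exp_minus)
  then have 1: "exp (- c / t) / t \<le> 1 / c" using assms by (simp add: field_simps)
  have 2: "exp (- c / t) \<le> 1" using assms by simp
  have "exp (- c / t) / t * (1 + t) = exp (- c / t) / t + exp (- c / t)"
    using assms by (simp add: field_simps)
  also have "\<dots> \<le> 1 / c + 1" using 1 2 by (rule add_mono)
  finally show ?thesis using assms by (simp add: pos_le_divide_eq)
qed

lemma set_integrable_inverse_gaussian:
  assumes c: "c > 0"
  shows "set_integrable lborel {0<..} (\<lambda>t. exp (- c / t) / (t * sqrt t))"
proof (rule set_integrable_bound)
  show "set_integrable lborel {0<..} (\<lambda>t. (1 + 1 / c) * (1 / (sqrt t * (1 + t))))"
    by (intro set_integrable_mult_right set_integrable_inverse_sqrt_decay)
  show "AE t in lborel. t \<in> {0<..} \<longrightarrow> norm (exp (- c / t) / (t * sqrt t)) \<le> norm ((1 + 1 / c) * (1 / (sqrt t * (1 + t))))"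
  proof (intro always_eventually allI impI)
    fix t :: real assume "t \<in> {0<..}"
    then have t: "t > 0" by simp
    have "exp (- c / t) / (t * sqrt t) = exp (- c / t) / t / sqrt t" by simp
    also have "\<dots> \<le> (1 + 1 / c) / (1 + t) / sqrt t"
      using t by (intro divide_right_mono exp_neg_divide_le c) auto
    also have "\<dots> = (1 + 1 / c) * (1 / (sqrt t * (1 + t)))" by simp
    finally show "norm (exp (- c / t) / (t * sqrt t)) \<le> norm ((1 + 1 / c) * (1 / (sqrt t * (1 + t))))"
      using t c by simp
  qed
qed (simp add: set_borel_measurable_def)

text \<open>
  The substitution \<open>u = - 1 / \<surd>t\<close> turns the integral into that of \<open>2 exp (- a\<^sup>2 u\<^sup>2)\<close> over the negative half-line.
\<close>

lemma integral_inverse_gaussian: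
  assumes a: "a > 0"
  shows "(LINT t:{0<..}|lborel. exp (- a\<^sup>2 / t) / (t * sqrt t)) = sqrt pi / a"
proof -
  let ?f = "\<lambda>u. 2 * exp (- a\<^sup>2 * u\<^sup>2)" and ?g = "\<lambda>t. - 1 / sqrt t" and ?g' = "\<lambda>t. 1 / (2 * (t * sqrt t))"
  have int: "integrable lborel (\<lambda>u::real. exp (- a\<^sup>2 * u\<^sup>2))" using integrable_gaussian_real[of "a\<^sup>2" 0] a by simp
  have fg: "?f (?g t) * ?g' t = exp (- a\<^sup>2 / t) / (t * sqrt t)" if "t > 0" for t
    using that by (simp add: power_divide)
  have sub: "set_integrable lborel (einterval 0 \<infinity>) (\<lambda>t. ?f (?g t) * ?g' t)"
    using set_integrable_inverse_gaussian[of "a\<^sup>2"] a unfolding einterval_0_infty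
    by (subst set_integrable_cong[OF refl refl fg]) auto
  have "(LBINT u=-\<infinity>..0. ?f u) = (LBINT t=0..\<infinity>. ?f (?g t) * ?g' t)"
  proof (rule interval_integral_substitution_nonneg(2)[where g="?g" and g'="?g'"])
    show "DERIV ?g t :> ?g' t" if "0 < ereal t" for t
      using that by (auto intro!: derivative_eq_intros simp: field_simps)
    have "filterlim (\<lambda>t::real. sqrt t) (at_right 0) (at_right 0)"
      unfolding filterlim_at
      by (auto intro!: tendsto_eq_intros eventually_mono[OF eventually_at_right_less])
    then have "filterlim (\<lambda>t::real. inverse (sqrt t)) at_top (at_right 0)"
      by (rule filterlim_compose[OF filterlim_inverse_at_top_right])
    then have "filterlim ?g at_bot (at_right 0)"
      by (simp add: filterlim_uminus_at_bot divide_inverse)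
    then show "((ereal \<circ> ?g \<circ> real_of_ereal) \<longlongrightarrow> - \<infinity>) (at_right 0)"
      by (simp add: zero_ereal_def ereal_tendsto_simps)
    have "(?g \<longlongrightarrow> 0) at_top"
      by (intro tendsto_divide_0[OF tendsto_const] filterlim_at_top_imp_at_infinity sqrt_at_top)
    then show "((ereal \<circ> ?g \<circ> real_of_ereal) \<longlongrightarrow> 0) (at_left \<infinity>)"
      by (simp add: zero_ereal_def ereal_tendsto_simps)
    show "0 \<le> ?g' t" if "0 \<le> ereal t" for t using that by simp
  qed (use sub in \<open>auto intro!: continuous_intros simp: zero_ereal_def\<close>)
  also have "(LBINT t=0..\<infinity>. ?f (?g t) * ?g' t) = (LINT t:{0<..}|lborel. exp (- a\<^sup>2 / t) / (t * sqrt t))"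
    unfolding interval_lebesgue_integral_def einterval_0_infty
    using fg by (auto intro!: set_lebesgue_integral_cong)
  also have "(LBINT u=-\<infinity>..0. ?f u) = sqrt pi / a"
  proof -
    define h where "h u = indicator {..<0} u *\<^sub>R (2 * exp (- a\<^sup>2 * u\<^sup>2))" for u :: real
    have h: "integrable lborel h"
      by (rule Bochner_Integration.integrable_bound[OF integrable_mult_right[OF int, of 2]])
         (auto simp: h_def[abs_def] indicator_def)
    have h': "integrable lborel (\<lambda>u. h (0 - u))" using h by (rule integrable_reflect_iff[THEN iffD2])
    have "einterval (-\<infinity>) 0 = {..<0}" by (auto simp: einterval_def zero_ereal_def)
    then have "(LBINT u=-\<infinity>..0. ?f u) = (\<integral>u. h u \<partial>lborel)"
      unfolding interval_lebesgue_integral_def set_lebesgue_integral_def h_def by simp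
    moreover have "2 * (\<integral>u. h u \<partial>lborel) = (\<integral>u. h u \<partial>lborel) + (\<integral>u. h (0 - u) \<partial>lborel)"
      by (subst integral_reflect[of h 0]) simp
    moreover have "\<dots> = (\<integral>u. h u + h (0 - u) \<partial>lborel)" using h h' by simp
    moreover have "\<dots> = (\<integral>u. 2 * exp (- a\<^sup>2 * u\<^sup>2) \<partial>lborel)"
      by (rule integral_cong_AE)
         (use AE_lborel_singleton[of 0] in \<open>auto simp: h_def indicator_def\<close>)
    moreover have "(\<integral>u. exp (- a\<^sup>2 * (norm u)\<^sup>2) \<partial>(lborel :: real measure)) = sqrt pi / a"
      using a by (subst integral_gaussian) (auto simp: real_sqrt_divide)
    ultimately show ?thesis by simp
  qed
  finally show ?thesis by simp
qed

section \<open>Gaussian means of the Riesz transform\<close>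

definition riesz_transform :: "'a::euclidean_space \<Rightarrow> ('a \<Rightarrow> complex) \<Rightarrow> 'a \<Rightarrow> complex" where
  "riesz_transform e g x = of_real (riesz_const DIM('a)) * riesz_pv e g x"

text \<open>
  The value of \<open>\<integral> exp (- \<delta> |x|\<^sup>2) exp (- i x \<bullet> \<xi>) ((x - y) \<bullet> e) exp (- t |x - y|\<^sup>2) dx\<close>.
\<close>

definition abel_kernel :: "'a::euclidean_space \<Rightarrow> 'a \<Rightarrow> real \<Rightarrow> real \<Rightarrow> 'a \<Rightarrow> complex" where
  "abel_kernel e \<xi> \<delta> t y =
     of_real (exp (- (t * \<delta> / (t + \<delta>)) * (norm y)\<^sup>2)) * cis (- ((t / (t + \<delta>)) * (y \<bullet> \<xi>)))
     * (- \<i> * of_real ((\<xi> \<bullet> e) / (2 * (t + \<delta>))) - of_real (\<delta> * (y \<bullet> e) / (t + \<delta>)))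
     * of_real (sqrt (pi / (t + \<delta>)) ^ DIM('a) * exp (- (norm \<xi>)\<^sup>2 / (4 * (t + \<delta>))))"

text \<open>
  Completing the square: the product of two Gaussians, centred at \<open>0\<close> and at \<open>y\<close>, is a Gaussian centred at \<open>p\<close>.
\<close>

lemma gaussian_product_exponent:
  fixes y w :: "'a::real_inner"
  assumes "t > 0" "\<delta> > 0"
  defines "p \<equiv> (t / (t + \<delta>)) *\<^sub>R y"
  shows "\<delta> * (norm (p + w))\<^sup>2 + t * (norm (p + w - y))\<^sup>2 = (t * \<delta> / (t + \<delta>)) * (norm y)\<^sup>2 + (t + \<delta>) * (norm w)\<^sup>2"
proof -
  define s where "s = t + \<delta>"
  have s: "s > 0" using assms by (simp add: s_def)
  have ts: "t / s - 1 = - (\<delta> / s)" using s by (simp add: s_def field_simps)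
  have "p - y = (t / s - 1) *\<^sub>R y" by (simp add: p_def s_def scaleR_left_diff_distrib)
  then have py: "p - y = - ((\<delta> / s) *\<^sub>R y)" unfolding ts by simp
  have 1: "(norm (p + w))\<^sup>2 = (t / s)\<^sup>2 * (y \<bullet> y) + 2 * (t / s) * (y \<bullet> w) + w \<bullet> w"
    unfolding p_def s_def[symmetric] power2_norm_eq_inner
    by (simp add: inner_add_left inner_add_right inner_commute power2_eq_square algebra_simps)
  have "p + w - y = (p - y) + w" by simp
  then have pwy: "p + w - y = - ((\<delta> / s) *\<^sub>R y) + w" unfolding py .
  have 2: "(norm (p + w - y))\<^sup>2 = (\<delta> / s)\<^sup>2 * (y \<bullet> y) - 2 * (\<delta> / s) * (y \<bullet> w) + w \<bullet> w"
    unfolding pwy power2_norm_eq_inner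
    by (simp add: inner_add_left inner_add_right inner_diff_left inner_diff_right inner_commute power2_eq_square algebra_simps)
  have "\<delta> * ((t / s)\<^sup>2 * Y + 2 * (t / s) * V + W) + t * ((\<delta> / s)\<^sup>2 * Y - 2 * (\<delta> / s) * V + W) = (t * \<delta> / s) * Y + (t + \<delta>) * W" for Y V W
  proof -
    have "\<delta> * ((t / s)\<^sup>2 * Y + 2 * (t / s) * V + W) + t * ((\<delta> / s)\<^sup>2 * Y - 2 * (\<delta> / s) * V + W) = (t * \<delta> * (t + \<delta>) / s\<^sup>2) * Y + (t + \<delta>) * W"
      using s by (simp add: power_divide field_simps power2_eq_square)
    also have "t * \<delta> * (t + \<delta>) / s\<^sup>2 = t * \<delta> / s"
      using s by (simp add: s_def[symmetric] power2_eq_square)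
    finally show ?thesis .
  qed
  then show ?thesis unfolding 1 2 by (simp add: s_def power2_norm_eq_inner)
qed

lemma integral_gaussian_product:
  fixes e \<xi> y :: "'a::euclidean_space"
  assumes t: "t > 0" and \<delta>: "\<delta> > 0" and e: "e \<in> Basis"
  shows "(\<integral>x. (of_real (exp (- \<delta> * (norm x)\<^sup>2)) * cis (- (x \<bullet> \<xi>))) * of_real (((x - y) \<bullet> e) * exp (- t * (norm (x - y))\<^sup>2)) \<partial>lborel)
     = abel_kernel e \<xi> \<delta> t y"
proof -
  define s where "s = t + \<delta>"
  have s: "s > 0" using t \<delta> by (simp add: s_def)
  define p where "p = (t / s) *\<^sub>R y"
  define c where "c = of_real (exp (- (t * \<delta> / s) * (norm y)\<^sup>2)) * cis (- (p \<bullet> \<xi>))"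
  let ?F = "\<lambda>x. (of_real (exp (- \<delta> * (norm x)\<^sup>2)) * cis (- (x \<bullet> \<xi>))) * of_real (((x - y) \<bullet> e) * exp (- t * (norm (x - y))\<^sup>2))"
  have F: "?F (p + w) = c * (of_real ((w \<bullet> e) * exp (- s * (norm w)\<^sup>2)) * cis (- (w \<bullet> \<xi>))
      + of_real ((p - y) \<bullet> e) * (of_real (exp (- s * (norm w)\<^sup>2)) * cis (- (w \<bullet> \<xi>))))" for w
  proof -
    have "- \<delta> * (norm (p + w))\<^sup>2 + - t * (norm (p + w - y))\<^sup>2 = - (t * \<delta> / s) * (norm y)\<^sup>2 + - s * (norm w)\<^sup>2"
      using gaussian_product_exponent[OF t \<delta>, of y w] unfolding p_def s_def by linarith
    then have 1: "exp (- \<delta> * (norm (p + w))\<^sup>2) * exp (- t * (norm (p + w - y))\<^sup>2) = exp (- (t * \<delta> / s) * (norm y)\<^sup>2) * exp (- s * (norm w)\<^sup>2)"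
      by (simp only: exp_add[symmetric])
    have 2: "cis (- ((p + w) \<bullet> \<xi>)) = cis (- (p \<bullet> \<xi>)) * cis (- (w \<bullet> \<xi>))"
      by (simp add: cis_mult inner_add_left)
    have 3: "(p + w - y) \<bullet> e = w \<bullet> e + (p - y) \<bullet> e" by (simp add: inner_add_left inner_diff_left)
    have "?F (p + w) = of_real (exp (- \<delta> * (norm (p + w))\<^sup>2) * exp (- t * (norm (p + w - y))\<^sup>2)) * cis (- ((p + w) \<bullet> \<xi>)) * of_real ((p + w - y) \<bullet> e)"
      by (simp add: mult_ac)
    also have "\<dots> = c * (of_real ((w \<bullet> e) * exp (- s * (norm w)\<^sup>2)) * cis (- (w \<bullet> \<xi>))
      + of_real ((p - y) \<bullet> e) * (of_real (exp (- s * (norm w)\<^sup>2)) * cis (- (w \<bullet> \<xi>))))"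
      unfolding 1 2 3 c_def by (simp add: algebra_simps)
    finally show ?thesis .
  qed
  have "(p - y) \<bullet> e = - (\<delta> * (y \<bullet> e) / s)"
    using s by (simp add: p_def inner_diff_left field_simps) (simp add: s_def algebra_simps)
  note py = this
  have "(\<integral>x. ?F x \<partial>lborel) = (\<integral>w. ?F (p + w) \<partial>lborel)"
    by (rule integral_translate[symmetric])
  also have "\<dots> = c * ((- \<i> * of_real ((\<xi> \<bullet> e) / (2 * s)) * of_real (sqrt (pi / s) ^ DIM('a) * exp (- (norm \<xi>)\<^sup>2 / (4 * s))))
      + of_real ((p - y) \<bullet> e) * of_real (sqrt (pi / s) ^ DIM('a) * exp (- (norm \<xi>)\<^sup>2 / (4 * s))))"
    unfolding F integral_mult_right_zero
      Bochner_Integration.integral_add[OF integrable_gaussian_cis_1[OF s e] integrable_mult_right[OF integrable_gaussian_cis[OF s]]]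
      integral_gaussian_cis_1[OF s e] integral_gaussian_cis[OF s] ..
  also have "\<dots> = abel_kernel e \<xi> \<delta> t y"
    unfolding abel_kernel_def s_def[symmetric] c_def py by (simp add: p_def algebra_simps)
  finally show ?thesis .
qed

lemma abs_inner_gaussian_le:
  fixes e z :: "'a::euclidean_space"
  assumes t: "t > 0" and e: "e \<in> Basis"
  shows "\<bar>(z \<bullet> e) * exp (- t * (norm z)\<^sup>2)\<bar> \<le> 1 + 1 / t"
proof -
  let ?r = "norm z"
  have "t * ?r\<^sup>2 \<le> exp (t * ?r\<^sup>2)" using exp_ge_add_one_self[of "t * ?r\<^sup>2"] by linarith
  then have "exp (- t * ?r\<^sup>2) * (t * ?r\<^sup>2) \<le> exp (- t * ?r\<^sup>2) * exp (t * ?r\<^sup>2)" by (intro mult_left_mono) auto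
  also have "\<dots> = 1" by (simp add: exp_minus)
  finally have 1: "?r\<^sup>2 * exp (- t * ?r\<^sup>2) \<le> 1 / t" using t by (simp add: field_simps)
  have "?r \<le> 1 + ?r\<^sup>2" using zero_le_power2[of "?r - 1"] by (simp add: power2_diff) (use zero_le_power2[of ?r] norm_ge_zero[of z] in linarith)
  then have "\<bar>z \<bullet> e\<bar> \<le> 1 + ?r\<^sup>2" using Basis_le_norm[OF e, of z] by linarith
  then have "\<bar>z \<bullet> e\<bar> * exp (- t * ?r\<^sup>2) \<le> (1 + ?r\<^sup>2) * exp (- t * ?r\<^sup>2)"
    by (intro mult_right_mono) auto
  also have "\<dots> = exp (- t * ?r\<^sup>2) + ?r\<^sup>2 * exp (- t * ?r\<^sup>2)" by (simp add: algebra_simps)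
  also have "\<dots> \<le> 1 + 1 / t" using t by (intro add_mono 1) auto
  finally show ?thesis by (simp add: abs_mult)
qed

context decaying_C1
begin

text \<open>
  Insert the Gaussian representation of the kernel and integrate over the parameter \<open>t\<close> last. The triple
  integral converges absolutely because the representing integrand does not change sign in \<open>t\<close>: its absolute
  value integrates to that of the kernel, and \<open>integral_norm_kernel_le\<close> applies. For fixed \<open>t\<close> the
  kernel has no singularity, so the symmetrization can be undone, and what is left is \<open>integral_gaussian_product\<close>.
\<close>

lemma riesz_gaussian_mean:
  assumes \<delta>: "\<delta> > 0"
  shows "(\<integral>x. of_real (exp (- \<delta> * (norm x)\<^sup>2)) * (riesz_transform e g x * cis (- (x \<bullet> \<xi>))) \<partial>lborel)
    = (\<integral>t. of_real (riesz_weight DIM('a) t) * (\<integral>y. g y * abel_kernel e \<xi> \<delta> t y \<partial>lborel) \<partial>lborel)"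
proof -
  let ?c = "riesz_const DIM('a)" and ?w = "riesz_weight DIM('a)" and ?k = "riesz_kernel e"
  let ?L2 = "lborel \<Otimes>\<^sub>M lborel :: ('a \<times> 'a) measure"
  interpret Q: pair_sigma_finite ?L2 "lborel :: real measure"
    by (intro pair_sigma_finite.intro lborel_pair.P.sigma_finite_measure_axioms lborel.sigma_finite_measure_axioms)
  define E where "E x = of_real (exp (- \<delta> * (norm x)\<^sup>2)) * cis (- (x \<bullet> \<xi>))" for x :: 'a
  define B where "B t z = (z \<bullet> e) * exp (- t * (norm z)\<^sup>2)" for t and z :: 'a
  define D where "D x z = g (x - z) - g (x + z)" for x z
  define G where "G q = (1 / 2) * (E (fst q) * D (fst q) (snd q))" for q
  define H where "H q t = of_real (?w t * B t (snd q)) * G q" for q t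
  have [measurable]: "E \<in> borel_measurable borel" unfolding E_def[abs_def] by measurable
  have Gm [measurable]: "G \<in> borel_measurable ?L2" unfolding G_def[abs_def] D_def by measurable
  have [measurable]: "case_prod H \<in> borel_measurable (?L2 \<Otimes>\<^sub>M lborel)"
    unfolding H_def B_def by measurable
  have E: "integrable lborel E" unfolding E_def[abs_def] by (rule integrable_gaussian_cis[OF \<delta>])
  have normE: "norm (E x) = exp (- \<delta> * (norm x)\<^sup>2)" for x by (simp add: E_def norm_mult)
  have kernel: "has_bochner_integral lborel (\<lambda>t. ?w t * B t z) (?c * ?k z)" for z
    unfolding B_def by (rule has_bochner_integral_riesz_kernel)
  have H_int: "has_bochner_integral lborel (H q) (of_real (?c * ?k (snd q)) * G q)" for q
    unfolding H_def[abs_def] by (intro has_bochner_integral_mult_left has_bochner_integral_of_real kernel)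
  have H_norm: "(\<integral>t. norm (H q t) \<partial>lborel) = norm (of_real (?c * ?k (snd q)) * G q)" for q
  proof -
    have "norm (H q t) = (sgn (snd q \<bullet> e) * norm (G q)) * (?w t * B t (snd q))" for t
      unfolding H_def B_def
      by (simp add: norm_mult abs_mult riesz_weight_nonneg abs_sgn[of "snd q \<bullet> e"])
    then have "(\<integral>t. norm (H q t) \<partial>lborel) = (sgn (snd q \<bullet> e) * norm (G q)) * (?c * ?k (snd q))"
      using has_bochner_integral_integral_eq[OF kernel[of "snd q"]] by simp
    also have "\<dots> = norm (of_real (?c * ?k (snd q)) * G q)"
    proof -
      have sk: "sgn (snd q \<bullet> e) * ?k (snd q) = \<bar>?k (snd q)\<bar>"
        unfolding riesz_kernel_def abs_divide by (simp add: abs_sgn[of "snd q \<bullet> e"] mult.commute)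
      show ?thesis
        by (simp only: norm_mult norm_of_real abs_mult abs_of_nonneg[OF riesz_const_nonneg] sk[symmetric] mult_ac)
    qed
    finally show ?thesis .
  qed
  have kG: "integrable ?L2 (\<lambda>q. of_real (?c * ?k (snd q)) * G q)"
  proof (rule lborel_pair.Fubini_integrable)
    have eq: "(of_real (?c * ?k z) * G (x, z)) = (of_real (?c / 2) * E x) * (of_real (?k z) * (g (x - z) - g (x + z)))" for x z
      by (simp add: G_def D_def)
    show "AE x in lborel. integrable lborel (\<lambda>z. of_real (?c * ?k (snd (x, z))) * G (x, z))"
      unfolding snd_conv eq by (intro always_eventually allI integrable_mult_right integrable_kernel)
    show "integrable lborel (\<lambda>x. \<integral>z. norm (of_real (?c * ?k (snd (x, z))) * G (x, z)) \<partial>lborel)"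
    proof (rule Bochner_Integration.integrable_bound)
      show "integrable lborel (\<lambda>x::'a. (?c / 2 * bound_const) * exp (- \<delta> * (norm x)\<^sup>2))"
        by (intro integrable_mult_right integrable_gaussian \<delta>)
      show "AE x in lborel. norm (\<integral>z. norm (of_real (?c * ?k (snd (x, z))) * G (x, z)) \<partial>lborel) \<le> norm ((?c / 2 * bound_const) * exp (- \<delta> * (norm x)\<^sup>2))"
      proof (intro always_eventually allI)
        fix x :: 'a
        have "(\<integral>z. norm (of_real (?c * ?k (snd (x, z))) * G (x, z)) \<partial>lborel)
          = (?c / 2 * norm (E x)) * (\<integral>z. norm (of_real (?k z) * (g (x - z) - g (x + z))) \<partial>lborel)"
          unfolding snd_conv eq norm_mult[of "of_real (?c / 2) * E x"] integral_mult_right_zero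
          by (simp add: norm_mult riesz_const_nonneg)
        also have "\<dots> \<le> (?c / 2 * norm (E x)) * bound_const"
        proof (intro mult_left_mono)
          have "bound_const / (1 + norm x) ^ DIM('a) \<le> bound_const / 1"
            using bound_const_nonneg by (intro divide_left_mono one_le_power) (auto intro!: zero_less_power add_pos_nonneg)
          then show "(\<integral>z. norm (of_real (?k z) * (g (x - z) - g (x + z))) \<partial>lborel) \<le> bound_const"
            using integral_norm_kernel_le[of x] by simp
        qed (auto simp: riesz_const_nonneg)
        finally show "norm (\<integral>z. norm (of_real (?c * ?k (snd (x, z))) * G (x, z)) \<partial>lborel) \<le> norm ((?c / 2 * bound_const) * exp (- \<delta> * (norm x)\<^sup>2))"
          using bound_const_nonneg riesz_const_nonneg[of "DIM('a)"] by (simp add: normE mult_ac)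
      qed
    qed measurable
  qed measurable
  have int: "integrable (?L2 \<Otimes>\<^sub>M lborel) (case_prod H)"
  proof (rule Q.Fubini_integrable)
    show "integrable ?L2 (\<lambda>q. \<integral>t. norm (case (q, t) of (q, t) \<Rightarrow> H q t) \<partial>lborel)"
      unfolding prod.case H_norm by (rule integrable_norm[OF kG])
    show "AE q in ?L2. integrable lborel (\<lambda>t. case (q, t) of (q, t) \<Rightarrow> H q t)"
      unfolding prod.case by (intro always_eventually allI integrable.intros) (rule H_int)
  qed measurable
  have inner: "(\<integral>z. of_real (B t z) * D x z \<partial>lborel) = 2 * (\<integral>y. g y * of_real (B t (x - y)) \<partial>lborel)" if t: "t > 0" for x t
  proof -
    define h where "h z = of_real (B t z) * g (x - z)" for z
    have [measurable]: "h \<in> borel_measurable borel" unfolding h_def[abs_def] B_def by measurable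
    have gx: "integrable lborel (\<lambda>z. g (x - z))" using integrable_g by (rule integrable_reflect_iff[THEN iffD2])
    have h: "integrable lborel h"
    proof (rule Bochner_Integration.integrable_bound[OF integrable_mult_right[OF integrable_norm[OF gx], of "1 + 1 / t"]])
      show "AE z in lborel. norm (h z) \<le> norm ((1 + 1 / t) * norm (g (x - z)))"
        using abs_inner_gaussian_le[OF t e] t
        by (auto simp: h_def norm_mult B_def intro!: always_eventually mult_right_mono simp del: of_real_mult)
    qed measurable
    have h': "integrable lborel (\<lambda>z. h (0 - z))" using h by (rule integrable_reflect_iff[THEN iffD2])
    have "(\<integral>z. of_real (B t z) * D x z \<partial>lborel) = (\<integral>z. h z + h (0 - z) \<partial>lborel)"
      by (intro Bochner_Integration.integral_cong) (auto simp: h_def D_def B_def algebra_simps)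
    also have "\<dots> = (\<integral>z. h z \<partial>lborel) + (\<integral>z. h (0 - z) \<partial>lborel)" using h h' by simp
    also have "(\<integral>z. h (0 - z) \<partial>lborel) = (\<integral>z. h z \<partial>lborel)" by (rule integral_reflect)
    also have "(\<integral>z. h z \<partial>lborel) = (\<integral>y. h (x - y) \<partial>lborel)" by (rule integral_reflect[symmetric])
    finally show ?thesis by (simp add: h_def mult.commute)
  qed
  \<comment> \<open>The integral over all pairs \<open>q = (x, z)\<close> for a fixed Gaussian parameter.\<close>
  have slice: "(\<integral>q. H q t \<partial>?L2) = of_real (?w t) * (\<integral>y. g y * abel_kernel e \<xi> \<delta> t y \<partial>lborel)"
    if Ht: "integrable ?L2 (\<lambda>q. H q t)" for t
  proof (cases "t > 0")
    case False
    then have "?w t = 0" by (simp add: riesz_weight_def)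
    then show ?thesis by (simp add: H_def)
  next
    case True
    have "(\<integral>q. H q t \<partial>?L2) = (\<integral>x. \<integral>z. H (x, z) t \<partial>lborel \<partial>lborel)"
      by (rule lborel_pair.integral_fst'[OF Ht, symmetric])
    also have "\<dots> = (\<integral>x. \<integral>z. (of_real (?w t / 2) * E x) * (of_real (B t z) * D x z) \<partial>lborel \<partial>lborel)"
      by (simp add: H_def G_def mult_ac)
    also have "\<dots> = of_real (?w t) * (\<integral>x. E x * (\<integral>y. g y * of_real (B t (x - y)) \<partial>lborel) \<partial>lborel)"
      unfolding integral_mult_right_zero inner[OF True]
      by (subst integral_mult_right_zero[symmetric], intro Bochner_Integration.integral_cong refl) simp
    also have "(\<integral>x. E x * (\<integral>y. g y * of_real (B t (x - y)) \<partial>lborel) \<partial>lborel)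
        = (\<integral>y. g y * (\<integral>x. E x * of_real (B t (x - y)) \<partial>lborel) \<partial>lborel)"
    proof (rule integral_swap_kernel[OF E integrable_g])
      show "norm (complex_of_real (B t (x - y))) \<le> 1 + 1 / t" for x y
        unfolding B_def norm_of_real by (rule abs_inner_gaussian_le[OF True e])
    qed (unfold B_def, measurable)
    also have "\<dots> = (\<integral>y. g y * abel_kernel e \<xi> \<delta> t y \<partial>lborel)"
      unfolding E_def B_def integral_gaussian_product[OF True \<delta> e] ..
    finally show ?thesis .
  qed
  have "(\<integral>x. of_real (exp (- \<delta> * (norm x)\<^sup>2)) * (riesz_transform e g x * cis (- (x \<bullet> \<xi>))) \<partial>lborel)
      = (\<integral>x. \<integral>z. of_real (?c * ?k z) * G (x, z) \<partial>lborel \<partial>lborel)"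
  proof (intro Bochner_Integration.integral_cong refl)
    fix x
    have "(\<integral>z. of_real (?c * ?k z) * G (x, z) \<partial>lborel) = (\<integral>z. (of_real (?c / 2) * E x) * (of_real (?k z) * (g (x - z) - g (x + z))) \<partial>lborel)"
      by (intro Bochner_Integration.integral_cong refl) (simp add: G_def D_def)
    then show "of_real (exp (- \<delta> * (norm x)\<^sup>2)) * (riesz_transform e g x * cis (- (x \<bullet> \<xi>))) = (\<integral>z. of_real (?c * ?k z) * G (x, z) \<partial>lborel)"
      unfolding integral_mult_right_zero by (simp add: riesz_transform_def riesz_pv_def E_def)
  qed
  also have "\<dots> = (\<integral>q. of_real (?c * ?k (snd q)) * G q \<partial>?L2)"
    using lborel_pair.integral_fst'[OF kG] by simp
  also have "\<dots> = (\<integral>q. \<integral>t. H q t \<partial>lborel \<partial>?L2)"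
    using has_bochner_integral_integral_eq[OF H_int] by simp
  also have "\<dots> = (\<integral>t. \<integral>q. H q t \<partial>?L2 \<partial>lborel)"
    using Q.Fubini_integral[OF int] by simp
  also have "\<dots> = (\<integral>t. of_real (?w t) * (\<integral>y. g y * abel_kernel e \<xi> \<delta> t y \<partial>lborel) \<partial>lborel)"
  proof (rule integral_cong_AE)
    show "AE t in lborel. (\<integral>q. H q t \<partial>?L2) = of_real (?w t) * (\<integral>y. g y * abel_kernel e \<xi> \<delta> t y \<partial>lborel)"
      using Q.AE_integrable_snd[OF int] by eventually_elim (rule slice)
    show "(\<lambda>t. \<integral>q. H q t \<partial>?L2) \<in> borel_measurable lborel"
      using Q.integrable_snd[OF int] by (rule borel_measurable_integrable)
    show "(\<lambda>t. of_real (?w t) * (\<integral>y. g y * abel_kernel e \<xi> \<delta> t y \<partial>lborel)) \<in> borel_measurable lborel"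
      unfolding abel_kernel_def by measurable
  qed
  finally show ?thesis .
qed

end

section \<open>The Fourier transform of the Riesz transform\<close>

text \<open>
  The value at the origin is \<open>0\<close>, by the convention for division by \<open>0\<close>.
\<close>

definition riesz_symbol :: "'a::euclidean_space \<Rightarrow> 'a \<Rightarrow> complex" where
  "riesz_symbol e \<xi> = - \<i> * of_real ((\<xi> \<bullet> e) / norm \<xi>)"

text \<open>
  The dimension drops out: the powers of \<open>t\<close> leave exactly \<open>t ^ (- 1/2)\<close>.
\<close>

lemma riesz_weight_times_gaussian_mass:
  assumes t: "t > 0"
  shows "riesz_weight n t * sqrt (pi / t) ^ n = 1 / (sqrt pi * sqrt t)"
proof -
  have "sqrt (pi / t) ^ n = (pi / t) powr (real n / 2)"
    using t by (simp add: powr_half_sqrt[symmetric] powr_realpow[symmetric] powr_powr)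
  also have "\<dots> = pi powr (real n / 2) / t powr (real n / 2)"
    using t by (simp add: powr_divide)
  finally have "riesz_weight n t * sqrt (pi / t) ^ n
     = (t powr ((real n - 1) / 2) / t powr (real n / 2)) * (pi powr (real n / 2) / pi powr ((real n + 1) / 2))"
    using t by (simp add: riesz_weight_def)
  also have "\<dots> = t powr (- (1 / 2)) * pi powr (- (1 / 2))"
    unfolding powr_diff[symmetric] by (simp add: diff_divide_distrib add_divide_distrib)
  also have "\<dots> = 1 / (sqrt pi * sqrt t)"
    using t by (simp add: powr_minus powr_half_sqrt inverse_eq_divide)
  finally show ?thesis .
qed

text \<open>
  A bound uniform in \<open>\<delta>\<close> and integrable in \<open>t\<close>. The part of the kernel with \<open>\<xi>\<close> is controlled near \<open>t = 0\<close> by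
  its factor \<open>exp (- |\<xi>|\<^sup>2 / (4 (t + \<delta>)))\<close>, the part with \<open>y\<close> by \<open>\<delta> / (t + \<delta>) \<le> 1 / (1 + t)\<close>. For \<open>\<xi> = 0\<close> only the
  second part is present, so the origin is no exception.
\<close>

lemma norm_abel_kernel_le:
  fixes e \<xi> y :: "'a::euclidean_space"
  assumes t: "t > 0" and \<delta>: "0 < \<delta>" "\<delta> \<le> 1" and e: "e \<in> Basis"
  shows "riesz_weight DIM('a) t * norm (abel_kernel e \<xi> \<delta> t y)
    \<le> (norm \<xi> * (1 + 4 / (norm \<xi>)\<^sup>2) + 1) * (1 + norm y) * (1 / (sqrt t * (1 + t)))"
proof -
  define s where "s = t + \<delta>"
  have s: "s > 0" "t \<le> s" using t \<delta> by (auto simp: s_def)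
  define X where "X = exp (- (norm \<xi>)\<^sup>2 / (4 * s))"
  have X: "0 \<le> X" "X \<le> 1" using s by (auto simp: X_def)
  define m where "m = norm \<xi> * (1 + 4 / (norm \<xi>)\<^sup>2)"
  have m: "m \<ge> 0" by (simp add: m_def)
  have 1: "norm (- \<i> * of_real ((\<xi> \<bullet> e) / (2 * s)) - of_real (\<delta> * (y \<bullet> e) / s)) \<le> norm \<xi> / s + \<delta> / s * norm y"
  proof -
    have "norm (- \<i> * of_real ((\<xi> \<bullet> e) / (2 * s)) - of_real (\<delta> * (y \<bullet> e) / s)) \<le> \<bar>(\<xi> \<bullet> e) / (2 * s)\<bar> + \<bar>\<delta> * (y \<bullet> e) / s\<bar>"
      by (rule order_trans[OF norm_triangle_ineq4]) (simp only: norm_mult norm_minus_cancel norm_ii norm_of_real mult_1 order.refl)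
    also have "\<dots> = \<bar>\<xi> \<bullet> e\<bar> / (2 * s) + \<delta> / s * \<bar>y \<bullet> e\<bar>"
      using s \<delta> by (simp add: abs_mult)
    also have "\<dots> \<le> norm \<xi> / s + \<delta> / s * norm y"
      using s \<delta> Basis_le_norm[OF e, of \<xi>] Basis_le_norm[OF e, of y]
      by (intro add_mono mult_left_mono frac_le) auto
    finally show ?thesis .
  qed
  have 2: "norm \<xi> / s * X \<le> m / (1 + t)"
  proof (cases "\<xi> = 0")
    case False
    then have c: "(norm \<xi>)\<^sup>2 / 4 > 0" by simp
    have "norm \<xi> / s * X = norm \<xi> * (exp (- ((norm \<xi>)\<^sup>2 / 4) / s) / s)"
      by (simp add: X_def)
    also have "\<dots> \<le> norm \<xi> * ((1 + 1 / ((norm \<xi>)\<^sup>2 / 4)) / (1 + s))"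
      by (intro mult_left_mono exp_neg_divide_le c s) auto
    also have "\<dots> = m / (1 + s)" by (simp add: m_def)
    also have "\<dots> \<le> m / (1 + t)" using m s t by (intro divide_left_mono) auto
    finally show ?thesis .
  qed (simp add: m_def)
  have "\<delta> * (1 + t) \<le> s" using \<delta> t mult_right_mono[of \<delta> 1 t] by (simp add: s_def algebra_simps)
  then have 3: "\<delta> / s \<le> 1 / (1 + t)" using s t by (simp add: field_simps)
  have "norm (abel_kernel e \<xi> \<delta> t y) = exp (- (t * \<delta> / s) * (norm y)\<^sup>2) *
      norm (- \<i> * of_real ((\<xi> \<bullet> e) / (2 * s)) - of_real (\<delta> * (y \<bullet> e) / s)) * (sqrt (pi / s) ^ DIM('a) * X)"
    unfolding abel_kernel_def s_def[symmetric] X_def[symmetric] norm_mult norm_cis norm_of_real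
    using s X by (simp add: abs_mult)
  also have "\<dots> \<le> 1 * (norm \<xi> / s + \<delta> / s * norm y) * (sqrt (pi / s) ^ DIM('a) * X)"
    using s t \<delta> X by (intro mult_right_mono mult_mono 1) auto
  also have "\<dots> = sqrt (pi / s) ^ DIM('a) * (norm \<xi> / s * X + \<delta> / s * norm y * X)"
    by (simp add: algebra_simps)
  also have "\<dots> \<le> sqrt (pi / t) ^ DIM('a) * (m / (1 + t) + 1 / (1 + t) * norm y * 1)"
  proof (intro mult_mono add_mono 2 power_mono mult_right_mono 3 X)
    show "sqrt (pi / s) \<le> sqrt (pi / t)" using s t by (intro real_sqrt_le_mono divide_left_mono) auto
  qed (use s t \<delta> X m in auto)
  finally have "riesz_weight DIM('a) t * norm (abel_kernel e \<xi> \<delta> t y)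
     \<le> riesz_weight DIM('a) t * (sqrt (pi / t) ^ DIM('a) * (m / (1 + t) + 1 / (1 + t) * norm y * 1))"
    by (rule mult_left_mono) (rule riesz_weight_nonneg)
  also have "\<dots> = (1 / (sqrt pi * sqrt t)) * (m / (1 + t) + 1 / (1 + t) * norm y * 1)"
    by (simp only: mult.assoc[symmetric] riesz_weight_times_gaussian_mass[OF t])
  also have "\<dots> = (m + norm y) * (1 / (sqrt t * (1 + t))) / sqrt pi"
  proof -
    have "m / (1 + t) + 1 / (1 + t) * norm y * 1 = (m + norm y) / (1 + t)" by (simp add: add_divide_distrib)
    then show ?thesis by (simp add: mult_ac)
  qed
  also have "\<dots> \<le> (m + norm y) * (1 / (sqrt t * (1 + t))) / 1"
    using m t pi_ge_two by (intro divide_left_mono) auto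
  also have "\<dots> \<le> ((m + 1) * (1 + norm y)) * (1 / (sqrt t * (1 + t)))"
    unfolding div_by_1 using m t by (intro mult_right_mono) (auto simp: algebra_simps)
  finally show ?thesis by (simp add: m_def)
qed

lemma abel_kernel_tendsto:
  assumes t: "t > 0"
  shows "((\<lambda>T. abel_kernel e \<xi> (inverse T) t y) \<longlongrightarrow> abel_kernel e \<xi> 0 t y) at_top"
proof -
  have "((\<lambda>\<delta>. abel_kernel e \<xi> \<delta> t y) \<longlongrightarrow> abel_kernel e \<xi> 0 t y) (at 0)"
    unfolding abel_kernel_def cis_conv_exp using t by (intro tendsto_intros) auto
  moreover have "filterlim (\<lambda>T::real. inverse T) (at 0) at_top"
    by (rule filterlim_inverse_at_iff[THEN iffD2]) (rule filterlim_at_top_imp_at_infinity[OF filterlim_ident])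
  ultimately show ?thesis by (rule filterlim_compose)
qed

context decaying_C1
begin

text \<open>
  Dominated convergence, first in \<open>y\<close> and then in \<open>t\<close>, lets \<open>\<delta>\<close> tend to \<open>0\<close> in \<open>riesz_gaussian_mean\<close>. The
  limit is the Fourier transform of \<open>g\<close> times \<open>- i (\<xi> \<bullet> e) / (2 \<surd>\<pi>)\<close> times the integral of
  \<open>integral_inverse_gaussian\<close> with \<open>a = |\<xi>| / 2\<close>, that is, \<open>2 \<surd>\<pi> / |\<xi>|\<close>.
\<close>

lemma riesz_gaussian_means_tendsto:
  "((\<lambda>\<delta>. \<integral>x. of_real (exp (- \<delta> * (norm x)\<^sup>2)) * (riesz_transform e g x * cis (- (x \<bullet> \<xi>))) \<partial>lborel)
    \<longlongrightarrow> riesz_symbol e \<xi> * fourier g \<xi>) (at_right 0)"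
proof -
  let ?w = "riesz_weight DIM('a)"
  define F where "F \<delta> t = of_real (?w t) * (\<integral>y. g y * abel_kernel e \<xi> \<delta> t y \<partial>lborel)" for \<delta> t
  define A where "A = norm \<xi> * (1 + 4 / (norm \<xi>)\<^sup>2) + 1"
  have A: "A \<ge> 0" by (simp add: A_def)
  define M where "M = (\<integral>y. (1 + norm y) * norm (g y) \<partial>lborel)"
  define d where "d t = 1 / (sqrt t * (1 + t))" for t
  have [measurable]: "F \<delta> \<in> borel_measurable borel" for \<delta>
    unfolding F_def[abs_def] abel_kernel_def by measurable
  have w0: "?w t = 0" if "t \<le> 0" for t using that by (simp add: riesz_weight_def)
  have le: "norm (of_real (?w t) * (g y * abel_kernel e \<xi> \<delta> t y)) \<le> (A * d t) * ((1 + norm y) * norm (g y))"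
    if "t > 0" "0 < \<delta>" "\<delta> \<le> 1" for t \<delta> y
  proof -
    have "norm (of_real (?w t) * (g y * abel_kernel e \<xi> \<delta> t y)) = norm (g y) * (?w t * norm (abel_kernel e \<xi> \<delta> t y))"
      by (simp add: norm_mult riesz_weight_nonneg)
    also have "\<dots> \<le> norm (g y) * (A * (1 + norm y) * d t)"
      unfolding A_def d_def by (intro mult_left_mono norm_abel_kernel_le that e) auto
    finally show ?thesis by (simp add: mult_ac)
  qed
  have F_eq: "F \<delta> t = (\<integral>y. of_real (?w t) * (g y * abel_kernel e \<xi> \<delta> t y) \<partial>lborel)" for \<delta> t
    unfolding F_def by (rule integral_mult_right_zero[symmetric])
  have inv: "\<forall>\<^sub>F T::real in at_top. 0 < inverse T \<and> inverse T \<le> 1"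
    using eventually_ge_at_top[of 1] by eventually_elim (auto simp: inverse_le_1_iff)
  have lim: "((\<lambda>T. F (inverse T) t) \<longlongrightarrow> F 0 t) at_top" for t
  proof (cases "t > 0")
    case False
    then show ?thesis by (simp add: F_def w0)
  next
    case True
    show ?thesis unfolding F_eq
    proof (rule integral_dominated_convergence_at_top[where w="\<lambda>y. (A * d t) * ((1 + norm y) * norm (g y))"])
      show "integrable lborel (\<lambda>y. (A * d t) * ((1 + norm y) * norm (g y)))"
        by (intro integrable_mult_right integrable_moment)
      show "\<forall>\<^sub>F T in at_top. AE y in lborel. norm (of_real (?w t) * (g y * abel_kernel e \<xi> (inverse T) t y)) \<le> (A * d t) * ((1 + norm y) * norm (g y))"
        using inv by eventually_elim (intro always_eventually allI le True; simp)
      show "AE y in lborel. ((\<lambda>T. of_real (?w t) * (g y * abel_kernel e \<xi> (inverse T) t y)) \<longlongrightarrow> of_real (?w t) * (g y * abel_kernel e \<xi> 0 t y)) at_top"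
        by (intro always_eventually allI tendsto_mult tendsto_const abel_kernel_tendsto True)
    qed (unfold abel_kernel_def, measurable)
  qed
  have "((\<lambda>T. \<integral>t. F (inverse T) t \<partial>lborel) \<longlongrightarrow> (\<integral>t. F 0 t \<partial>lborel)) at_top"
  proof (rule integral_dominated_convergence_at_top[where w="\<lambda>t. (A * M) * (indicator {0<..} t *\<^sub>R d t)"])
    show "integrable lborel (\<lambda>t. (A * M) * (indicator {0<..} t *\<^sub>R d t))"
      using set_integrable_inverse_sqrt_decay unfolding set_integrable_def d_def by (rule integrable_mult_right)
    show "\<forall>\<^sub>F T in at_top. AE t in lborel. norm (F (inverse T) t) \<le> (A * M) * (indicator {0<..} t *\<^sub>R d t)"
      using inv
    proof eventually_elim
      case (elim T)
      show ?case
      proof (intro always_eventually allI)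
        fix t
        show "norm (F (inverse T) t) \<le> (A * M) * (indicator {0<..} t *\<^sub>R d t)"
        proof (cases "t > 0")
          case False
          then show ?thesis by (simp add: F_def w0)
        next
          case True
          have "norm (F (inverse T) t) \<le> (\<integral>y. norm (of_real (?w t) * (g y * abel_kernel e \<xi> (inverse T) t y)) \<partial>lborel)"
            unfolding F_eq by (rule integral_norm_bound)
          also have "\<dots> \<le> (\<integral>y. (A * d t) * ((1 + norm y) * norm (g y)) \<partial>lborel)"
          proof (rule integral_mono_AE)
            have dom: "integrable lborel (\<lambda>y. (A * d t) * ((1 + norm y) * norm (g y)))"
              by (intro integrable_mult_right integrable_moment)
            then show "integrable lborel (\<lambda>y. (A * d t) * ((1 + norm y) * norm (g y)))" .
            show "integrable lborel (\<lambda>y. norm (of_real (?w t) * (g y * abel_kernel e \<xi> (inverse T) t y)))"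
            proof (rule Bochner_Integration.integrable_bound[OF dom])
              show "AE y in lborel. norm (norm (of_real (?w t) * (g y * abel_kernel e \<xi> (inverse T) t y))) \<le> norm ((A * d t) * ((1 + norm y) * norm (g y)))"
              proof (intro always_eventually allI)
                fix y
                show "norm (norm (of_real (?w t) * (g y * abel_kernel e \<xi> (inverse T) t y))) \<le> norm ((A * d t) * ((1 + norm y) * norm (g y)))"
                  using le[OF True conjunct1[OF elim] conjunct2[OF elim], of y]
                  by (simp only: real_norm_def abs_of_nonneg[OF norm_ge_zero])
              qed
            qed (unfold abel_kernel_def, measurable)
            show "AE y in lborel. norm (of_real (?w t) * (g y * abel_kernel e \<xi> (inverse T) t y)) \<le> (A * d t) * ((1 + norm y) * norm (g y))"
              using le[OF True, of "inverse T"] elim by (intro always_eventually allI) simp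
          qed
          also have "\<dots> = (A * d t) * M" unfolding M_def by (rule integral_mult_right_zero)
          finally show ?thesis using True by (simp add: mult_ac)
        qed
      qed
    qed
    show "AE t in lborel. ((\<lambda>T. F (inverse T) t) \<longlongrightarrow> F 0 t) at_top" by (intro always_eventually allI lim)
  qed measurable
  moreover have "(\<integral>t. F 0 t \<partial>lborel) = riesz_symbol e \<xi> * fourier g \<xi>"
  proof -
    define c where "c = - \<i> * of_real ((\<xi> \<bullet> e) / (2 * sqrt pi)) * fourier g \<xi>"
    have F0: "F 0 t = c * of_real (indicator {0<..} t *\<^sub>R (exp (- (norm \<xi> / 2)\<^sup>2 / t) / (t * sqrt t)))" for t
    proof (cases "t > 0")
      case False
      then show ?thesis by (simp add: F_def w0)
    next
      case True
      define k where "k = - \<i> * of_real ((\<xi> \<bullet> e) / (2 * t)) * of_real (sqrt (pi / t) ^ DIM('a) * exp (- (norm \<xi>)\<^sup>2 / (4 * t)))"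
      have k: "g y * abel_kernel e \<xi> 0 t y = k * (g y * cis (- (y \<bullet> \<xi>)))" for y
        using True by (simp add: abel_kernel_def k_def)
      have "F 0 t = of_real (?w t) * (k * fourier g \<xi>)"
        unfolding F_def fourier_def k integral_mult_right_zero ..
      also have "\<dots> = - \<i> * of_real ((\<xi> \<bullet> e) / (2 * t)) * of_real (?w t * sqrt (pi / t) ^ DIM('a)) * of_real (exp (- (norm \<xi>)\<^sup>2 / (4 * t))) * fourier g \<xi>"
        by (simp add: k_def mult_ac)
      also have "\<dots> = c * of_real (indicator {0<..} t *\<^sub>R (exp (- (norm \<xi> / 2)\<^sup>2 / t) / (t * sqrt t)))"
        unfolding riesz_weight_times_gaussian_mass[OF True] using True
        by (simp add: c_def power_divide field_simps)
      finally show ?thesis .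
    qed
    have "(\<integral>t. F 0 t \<partial>lborel) = c * of_real (LINT t:{0<..}|lborel. exp (- (norm \<xi> / 2)\<^sup>2 / t) / (t * sqrt t))"
      unfolding F0 set_lebesgue_integral_def integral_mult_right_zero integral_complex_of_real ..
    also have "\<dots> = riesz_symbol e \<xi> * fourier g \<xi>"
    proof (cases "\<xi> = 0")
      case True
      then show ?thesis by (simp add: c_def riesz_symbol_def)
    next
      case False
      then have "norm \<xi> / 2 > 0" by simp
      then show ?thesis
        by (subst integral_inverse_gaussian) (auto simp: c_def riesz_symbol_def field_simps)
    qed
    finally show ?thesis .
  qed
  ultimately have "((\<lambda>\<delta>. \<integral>t. F \<delta> t \<partial>lborel) \<longlongrightarrow> riesz_symbol e \<xi> * fourier g \<xi>) (at_right 0)"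
    by (simp add: filterlim_at_right_to_top)
  then show ?thesis
    by (rule Lim_transform_eventually)
       (use eventually_at_right_less[of 0] in \<open>eventually_elim, simp only: F_def[abs_def] riesz_gaussian_mean\<close>)
qed

lemma norm_riesz_transform_le: "norm (riesz_transform e g x) \<le> riesz_const DIM('a) * bound_const / (1 + norm x) ^ DIM('a)"
  using mult_left_mono[OF norm_riesz_pv_le[of x] riesz_const_nonneg[of "DIM('a)"]]
  by (simp add: riesz_transform_def norm_mult riesz_const_nonneg)

lemma measurable_riesz_transform [measurable]: "riesz_transform e g \<in> borel_measurable borel"
  unfolding riesz_transform_def[abs_def] by measurable

theorem fourier_riesz_transform:
  "((\<lambda>r. fourier (\<lambda>x. indicator (cball 0 r) x * riesz_transform e g x) \<xi>) \<longlongrightarrow> riesz_symbol e \<xi> * fourier g \<xi>) at_top"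
  unfolding fourier_def[of "\<lambda>x. indicator (cball 0 _) x * riesz_transform e g x"] mult.assoc
proof (rule gaussian_means_imp_ball_means)
  show "norm (riesz_transform e g x * cis (- (x \<bullet> \<xi>))) \<le> (riesz_const DIM('a) * bound_const) / (1 + norm x) ^ DIM('a)" for x
    using norm_riesz_transform_le[of x] by (simp add: norm_mult)
qed (measurable, rule riesz_gaussian_means_tendsto)

text \<open>
  The square is \<open>O(|x| ^ (- 2 n))\<close>, and \<open>2 n \<ge> n + 1\<close>.
\<close>

lemma riesz_transform_square_integrable: "integrable lborel (\<lambda>x. (norm (riesz_transform e g x))\<^sup>2)"
proof (rule Bochner_Integration.integrable_bound)
  let ?C = "riesz_const DIM('a) * bound_const"
  show "integrable lborel (\<lambda>x::'a. ?C\<^sup>2 * (1 / (1 + norm x) ^ (DIM('a) + 1)))"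
    by (intro integrable_mult_right integrable_inverse_norm_power)
  show "AE x in lborel. norm ((norm (riesz_transform e g x))\<^sup>2) \<le> norm (?C\<^sup>2 * (1 / (1 + norm x) ^ (DIM('a) + 1)))"
  proof (intro always_eventually allI)
    fix x :: 'a
    have p: "1 + norm x > 0" "1 \<le> 1 + norm x" by (simp_all add: add_pos_nonneg)
    have "(norm (riesz_transform e g x))\<^sup>2 \<le> (?C / (1 + norm x) ^ DIM('a))\<^sup>2"
      by (intro power_mono norm_riesz_transform_le) auto
    also have "\<dots> = ?C\<^sup>2 * (1 / (1 + norm x) ^ (DIM('a) * 2))"
      by (simp add: power_divide power_mult)
    also have "\<dots> \<le> ?C\<^sup>2 * (1 / (1 + norm x) ^ (DIM('a) + 1))"
    proof (intro mult_left_mono divide_left_mono power_increasing p mult_pos_pos zero_less_power)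
      show "DIM('a) + 1 \<le> DIM('a) * 2" using DIM_positive[where 'a='a] by simp
    qed auto
    finally show "norm ((norm (riesz_transform e g x))\<^sup>2) \<le> norm (?C\<^sup>2 * (1 / (1 + norm x) ^ (DIM('a) + 1)))"
      by simp
  qed
qed measurable

end

section \<open>Convergence in the mean\<close>

text \<open>
  By the Plancherel inequality the transforms of two truncations, at \<open>r\<close> and at \<open>k \<ge> r\<close>, differ in the mean by at
  most the tail of \<open>v\<close> outside the ball of radius \<open>r\<close>. Fatou's lemma for \<open>k \<rightarrow> \<infinity>\<close> replaces the second
  transform by the pointwise limit.
\<close>

lemma fourier_ball_L2_tendsto:
  fixes v :: "'a::euclidean_space \<Rightarrow> complex"
  assumes [measurable]: "v \<in> borel_measurable borel" "G \<in> borel_measurable borel"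
    and bound: "\<And>x. norm (v x) \<le> C"
    and v2: "integrable lborel (\<lambda>x. (norm (v x))\<^sup>2)"
    and lim: "\<And>\<xi>. ((\<lambda>r. fourier (\<lambda>x. indicator (cball 0 r) x * v x) \<xi>) \<longlongrightarrow> G \<xi>) at_top"
  shows "((\<lambda>r. \<integral>\<^sup>+\<xi>. ennreal ((norm (fourier (\<lambda>x. indicator (cball 0 r) x * v x) \<xi> - G \<xi>))\<^sup>2) \<partial>lborel) \<longlongrightarrow> 0) at_top"
proof -
  define V where "V r x = indicator (cball 0 r) x * v x" for r x
  define R where "R r = (\<integral>x. (norm (v x - V r x))\<^sup>2 \<partial>lborel)" for r
  have [measurable]: "cball 0 r \<in> sets (borel :: 'a measure)" for r by simp
  have [measurable]: "V r \<in> borel_measurable borel" for r unfolding V_def[abs_def] by measurable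
  have V: "integrable lborel (V r)" for r
  proof (rule Bochner_Integration.integrable_bound)
    show "integrable lborel (\<lambda>x::'a. indicator (cball 0 r) x * C)"
      by (intro integrable_mult_left integrable_real_indicator)
         (use emeasure_lborel_cball_finite[of "0::'a" r] in \<open>simp_all add: top.not_eq_extremum\<close>)
    show "AE x in lborel. norm (V r x) \<le> norm (indicator (cball 0 r) x * C :: real)"
      by (intro always_eventually allI) (auto simp: V_def indicator_def intro: order_trans[OF bound])
  qed measurable
  have tail_le: "(norm (v x - V r x))\<^sup>2 \<le> (norm (v x))\<^sup>2" for r x
    by (auto simp: V_def indicator_def)
  have tail_int: "integrable lborel (\<lambda>x. (norm (v x - V r x))\<^sup>2)" for r
    by (rule Bochner_Integration.integrable_bound[OF v2]) (use tail_le in \<open>auto intro!: always_eventually\<close>)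
  have "(R \<longlongrightarrow> (\<integral>x. 0 \<partial>(lborel :: 'a measure))) at_top"
    unfolding R_def[abs_def]
  proof (rule integral_dominated_convergence_at_top[where w="\<lambda>x. (norm (v x))\<^sup>2"])
    show "AE x in lborel. ((\<lambda>r. (norm (v x - V r x))\<^sup>2) \<longlongrightarrow> 0) at_top"
    proof (intro always_eventually allI)
      fix x :: 'a
      have "\<forall>\<^sub>F r in at_top. (norm (v x - V r x))\<^sup>2 = 0"
        using eventually_ge_at_top[of "norm x"] by eventually_elim (simp add: V_def)
      then show "((\<lambda>r. (norm (v x - V r x))\<^sup>2) \<longlongrightarrow> 0) at_top" by (rule tendsto_eventually)
    qed
    show "\<forall>\<^sub>F r in at_top. AE x in lborel. norm ((norm (v x - V r x))\<^sup>2) \<le> (norm (v x))\<^sup>2"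
      using tail_le by (intro always_eventually allI) simp
  qed (use v2 in measurable)
  then have R: "(R \<longlongrightarrow> 0) at_top" by simp
  have le: "(\<integral>\<^sup>+\<xi>. ennreal ((norm (fourier (V r) \<xi> - G \<xi>))\<^sup>2) \<partial>lborel) \<le> ennreal ((2 * pi) ^ DIM('a) * R r)" for r
  proof -
    have seq: "(\<lambda>k. fourier (V (real k)) \<xi>) \<longlonglongrightarrow> G \<xi>" for \<xi>
      using filterlim_compose[OF lim filterlim_real_sequentially] by (simp add: V_def[abs_def])
    have "(\<lambda>k. ennreal ((norm (fourier (V r) \<xi> - fourier (V (real k)) \<xi>))\<^sup>2)) \<longlonglongrightarrow> ennreal ((norm (fourier (V r) \<xi> - G \<xi>))\<^sup>2)" for \<xi>
      by (intro tendsto_intros tendsto_ennrealI seq)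
    then have "(\<integral>\<^sup>+\<xi>. ennreal ((norm (fourier (V r) \<xi> - G \<xi>))\<^sup>2) \<partial>lborel)
        = (\<integral>\<^sup>+\<xi>. liminf (\<lambda>k. ennreal ((norm (fourier (V r) \<xi> - fourier (V (real k)) \<xi>))\<^sup>2)) \<partial>lborel)"
      by (intro nn_integral_cong lim_imp_Liminf[symmetric]) simp_all
    also have "\<dots> \<le> liminf (\<lambda>k. \<integral>\<^sup>+\<xi>. ennreal ((norm (fourier (V r) \<xi> - fourier (V (real k)) \<xi>))\<^sup>2) \<partial>lborel)"
      by (rule nn_integral_liminf) measurable
    also have "\<dots> \<le> limsup (\<lambda>k. \<integral>\<^sup>+\<xi>. ennreal ((norm (fourier (V r) \<xi> - fourier (V (real k)) \<xi>))\<^sup>2) \<partial>lborel)"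
      by (rule Liminf_le_Limsup) simp
    also have "\<dots> \<le> ennreal ((2 * pi) ^ DIM('a) * R r)"
    proof (rule Limsup_bounded)
      have "\<forall>\<^sub>F k in sequentially. r \<le> real k"
        using filterlim_real_sequentially by (simp add: filterlim_at_top)
      then show "\<forall>\<^sub>F k in sequentially. (\<integral>\<^sup>+\<xi>. ennreal ((norm (fourier (V r) \<xi> - fourier (V (real k)) \<xi>))\<^sup>2) \<partial>lborel) \<le> ennreal ((2 * pi) ^ DIM('a) * R r)"
      proof eventually_elim
        case (elim k)
        have W: "(norm (V r x - V (real k) x))\<^sup>2 \<le> (norm (v x - V r x))\<^sup>2" for x
          using elim by (auto simp: V_def indicator_def)
        have W2: "integrable lborel (\<lambda>x. (norm (V r x - V (real k) x))\<^sup>2)"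
          by (rule Bochner_Integration.integrable_bound[OF tail_int[of r]]) (use W in \<open>auto intro!: always_eventually\<close>)
        have "fourier (V r) \<xi> - fourier (V (real k)) \<xi> = fourier (\<lambda>x. V r x - V (real k) x) \<xi>" for \<xi>
          unfolding fourier_def left_diff_distrib
          by (rule Bochner_Integration.integral_diff[symmetric]) (intro integrable_times_cis V)+
        then have "(\<integral>\<^sup>+\<xi>. ennreal ((norm (fourier (V r) \<xi> - fourier (V (real k)) \<xi>))\<^sup>2) \<partial>lborel)
           = (\<integral>\<^sup>+\<xi>. ennreal ((norm (fourier (\<lambda>x. V r x - V (real k) x) \<xi>))\<^sup>2) \<partial>lborel)" by simp
        also have "\<dots> \<le> ennreal ((2 * pi) ^ DIM('a) * (\<integral>x. (norm (V r x - V (real k) x))\<^sup>2 \<partial>lborel))"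
          by (intro fourier_L2_le Bochner_Integration.integrable_diff V W2)
        also have "\<dots> \<le> ennreal ((2 * pi) ^ DIM('a) * R r)"
          unfolding R_def by (intro ennreal_leI mult_left_mono integral_mono W2 tail_int W) auto
        finally show ?case .
      qed
    qed
    finally show ?thesis .
  qed
  have "((\<lambda>r. ennreal ((2 * pi) ^ DIM('a) * R r)) \<longlongrightarrow> ennreal ((2 * pi) ^ DIM('a) * 0)) at_top"
    by (intro tendsto_ennrealI tendsto_intros R)
  then have lim0: "((\<lambda>r. ennreal ((2 * pi) ^ DIM('a) * R r)) \<longlongrightarrow> 0) at_top" by simp
  have "((\<lambda>r. \<integral>\<^sup>+\<xi>. ennreal ((norm (fourier (V r) \<xi> - G \<xi>))\<^sup>2) \<partial>lborel) \<longlongrightarrow> 0) at_top"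
    by (rule tendsto_sandwich[OF _ _ tendsto_const lim0])
       (intro always_eventually allI zero_le, intro always_eventually allI le)
  then show ?thesis by (simp add: V_def[abs_def])
qed

lemma nn_integral_diagonal:
  fixes c :: "'a::euclidean_space \<Rightarrow> real"
  assumes c: "\<And>b. b \<in> Basis \<Longrightarrow> c b \<noteq> 0" and [measurable]: "F \<in> borel_measurable borel"
  shows "(\<integral>\<^sup>+x. F (\<Sum>b\<in>Basis. (c b * (x \<bullet> b)) *\<^sub>R b) \<partial>lborel) = ennreal (1 / (\<Prod>b\<in>Basis. \<bar>c b\<bar>)) * (\<integral>\<^sup>+x. F x \<partial>lborel)"
proof -
  define p where "p = (\<Prod>b\<in>Basis. \<bar>c b\<bar>)"
  let ?I = "\<integral>\<^sup>+x. F (\<Sum>b\<in>Basis. (c b * (x \<bullet> b)) *\<^sub>R b) \<partial>lborel"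
  have p: "p > 0" unfolding p_def using c by (intro prod_pos) auto
  have "(\<integral>\<^sup>+x. F x \<partial>lborel) = ennreal p * ?I"
    unfolding p_def by (subst lborel_affine_euclidean[OF c, of _ 0])
       (simp_all add: nn_integral_density nn_integral_distr nn_integral_cmult prod_ennreal)
  then have "ennreal (1 / p) * (\<integral>\<^sup>+x. F x \<partial>lborel) = (ennreal (1 / p) * ennreal p) * ?I"
    by (simp only: mult.assoc)
  also have "ennreal (1 / p) * ennreal p = 1"
    using p by (simp add: ennreal_mult[symmetric] less_imp_le)
  finally show ?thesis by (simp add: p_def)
qed

section \<open>Schwartz functions multiplied by a chirp\<close>

lemma norm_power_le_sum_power:
  fixes x :: "real^'n"
  shows "(1 + norm x) ^ N \<le> (real CARD('n) + 1) ^ N * (1 + (\<Sum>k\<in>UNIV. \<bar>x $ k\<bar> ^ N))"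
proof -
  define S where "S = insert 1 (range (\<lambda>k. \<bar>x $ k\<bar>))"
  define m where "m = Max S"
  have S: "finite S" "S \<noteq> {}" by (auto simp: S_def)
  have m: "1 \<le> m" "\<bar>x $ k\<bar> \<le> m" for k
    unfolding m_def by (intro Max_ge S; simp add: S_def)+
  have "1 + norm x \<le> 1 + (\<Sum>k\<in>UNIV. \<bar>x $ k\<bar>)" using norm_le_l1_cart[of x] by simp
  also have "\<dots> \<le> m + (\<Sum>k\<in>(UNIV::'n set). m)" by (intro add_mono sum_mono m)
  also have "\<dots> = (real CARD('n) + 1) * m" by (simp add: algebra_simps)
  finally have "(1 + norm x) ^ N \<le> ((real CARD('n) + 1) * m) ^ N" by (intro power_mono) auto
  also have "\<dots> = (real CARD('n) + 1) ^ N * m ^ N" by (rule power_mult_distrib)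
  also have "m ^ N \<le> 1 + (\<Sum>k\<in>UNIV. \<bar>x $ k\<bar> ^ N)"
  proof -
    have "m \<in> S" unfolding m_def by (rule Max_in[OF S])
    then consider "m = 1" | k where "m = \<bar>x $ k\<bar>" by (auto simp: S_def)
    then show ?thesis
    proof cases
      case 1
      then show ?thesis by (simp add: sum_nonneg)
    next
      case 2
      have "\<bar>x $ k\<bar> ^ N \<le> (\<Sum>k\<in>UNIV. \<bar>x $ k\<bar> ^ N)" by (rule member_le_sum) auto
      then show ?thesis using 2 by simp
    qed
  qed
  finally show ?thesis by (simp add: mult_left_mono)
qed

text \<open>
  The monomials \<open>1\<close> and \<open>x\<^sub>k ^ N\<close> suffice, because together they dominate \<open>(1 + |x|) ^ N\<close>.
\<close>

lemma polynomial_bounds_imp_decay: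
  fixes h :: "real^'n \<Rightarrow> complex"
  assumes "\<And>\<alpha> :: 'n \<Rightarrow> nat. bounded (range (\<lambda>x. of_real (\<Prod>k\<in>UNIV. x $ k ^ \<alpha> k) * h x))"
  shows "\<exists>C. \<forall>x. norm (h x) \<le> C / (1 + norm x) ^ N"
proof -
  have "\<exists>B. \<forall>x. \<bar>\<Prod>k\<in>UNIV. x $ k ^ \<alpha> k\<bar> * norm (h x) \<le> B" for \<alpha> :: "'n \<Rightarrow> nat"
    using assms[of \<alpha>] unfolding bounded_iff by (auto simp only: norm_mult norm_of_real ball_simps)
  then obtain B where B: "\<And>\<alpha> x. \<bar>\<Prod>k\<in>UNIV. x $ k ^ \<alpha> k\<bar> * norm (h x) \<le> B \<alpha>" by metis
  define D where "D = (real CARD('n) + 1) ^ N * (B (\<lambda>_. 0) + (\<Sum>k\<in>UNIV. B (\<lambda>i. if i = k then N else 0)))"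
  have "norm (h x) \<le> D / (1 + norm x) ^ N" for x
  proof -
    have 0: "norm (h x) \<le> B (\<lambda>_. 0)" using B[of x "\<lambda>_. 0"] by simp
    have k: "\<bar>x $ k\<bar> ^ N * norm (h x) \<le> B (\<lambda>i. if i = k then N else 0)" for k
    proof -
      have "(\<Prod>i\<in>UNIV. x $ i ^ (if i = k then N else 0)) = (\<Prod>i\<in>UNIV. if i = k then x $ i ^ N else 1)"
        by (intro prod.cong) auto
      also have "\<dots> = x $ k ^ N" by simp
      finally show ?thesis using B[of x "\<lambda>i. if i = k then N else 0"] by (simp add: power_abs)
    qed
    have "(1 + norm x) ^ N * norm (h x) \<le> ((real CARD('n) + 1) ^ N * (1 + (\<Sum>k\<in>UNIV. \<bar>x $ k\<bar> ^ N))) * norm (h x)"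
      by (intro mult_right_mono norm_power_le_sum_power) auto
    also have "\<dots> = (real CARD('n) + 1) ^ N * (norm (h x) + (\<Sum>k\<in>UNIV. \<bar>x $ k\<bar> ^ N * norm (h x)))"
      by (simp add: algebra_simps sum_distrib_left)
    also have "\<dots> \<le> D" unfolding D_def by (intro mult_left_mono add_mono sum_mono 0 k) auto
    finally show ?thesis by (simp add: pos_le_divide_eq add_pos_nonneg mult.commute)
  qed
  then show ?thesis by blast
qed

text \<open>
  Differentiating the chirp costs a factor \<open>O(|x|)\<close>; the extra power in the bound for \<open>f\<close> pays for it.
\<close>

lemma schwartz_chirp_decaying_C1:
  fixes f :: "real^'n \<Rightarrow> complex" and q :: "'n \<Rightarrow> real"
  assumes f: "schwartz f"
  shows "\<exists>g' C. decaying_C1 (\<lambda>y. f y * cis (\<Sum>k\<in>UNIV. q k * (y $ k)\<^sup>2)) g' C (axis j 1)"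
proof -
  define f' where "f' x = frechet_derivative f (at x)" for x
  have d: "partial_derivs ks f differentiable (at x)" for ks x
    using f by (simp add: schwartz_def)
  have f': "(f has_derivative f' x) (at x)" for x
    using d[of "[]" x] unfolding f'_def by (simp add: partial_derivs_def frechet_derivative_works)
  have dec: "\<exists>C. \<forall>x. norm (partial_derivs ks f x) \<le> C / (1 + norm x) ^ N" for ks N
    using f by (intro polynomial_bounds_imp_decay) (simp add: schwartz_def)
  obtain C1 where C1: "\<And>x. norm (f x) \<le> C1 / (1 + norm x) ^ (CARD('n) + 2)"
    using dec[of "[]" "CARD('n) + 2"] by (auto simp: partial_derivs_def)
  have "\<exists>C. \<forall>x. norm (f' x (axis k 1)) \<le> C / (1 + norm x) ^ (CARD('n) + 1)" for k
    using dec[of "[k]" "CARD('n) + 1"] by (simp add: partial_derivs_def partial_deriv_def f'_def)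
  then obtain C2 where C2: "\<And>k x. norm (f' x (axis k 1)) \<le> C2 k / (1 + norm x) ^ (CARD('n) + 1)" by metis
  have C1_nonneg: "C1 \<ge> 0" using order_trans[OF norm_ge_zero C1[of 0]] by simp
  have C2_nonneg: "C2 k \<ge> 0" for k using order_trans[OF norm_ge_zero C2[of 0 k]] by simp
  define Q where "Q = (\<Sum>k\<in>UNIV. 2 * \<bar>q k\<bar>)"
  have Q: "Q \<ge> 0" by (simp add: Q_def sum_nonneg)
  define C where "C = C1 + (\<Sum>k\<in>UNIV. C2 k) + C1 * Q"
  have C: "C1 \<le> C" using C1_nonneg C2_nonneg Q by (simp add: C_def sum_nonneg)
  let ?\<phi> = "\<lambda>y::real^'n. \<Sum>k\<in>UNIV. q k * (y $ k)\<^sup>2"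
  define \<phi>' where "\<phi>' x v = (\<Sum>k\<in>UNIV. q k * (2 * x $ k * v $ k))" for x v :: "real^'n"
  define g' where "g' x v = f x * (\<i> * of_real (\<phi>' x v) * cis (?\<phi> x)) + f' x v * cis (?\<phi> x)" for x v
  have \<phi>: "(?\<phi> has_derivative \<phi>' x) (at x)" for x
    unfolding \<phi>'_def[abs_def]
    by (auto intro!: derivative_eq_intros bounded_linear.has_derivative[OF bounded_linear_vec_nth] simp: algebra_simps)
  have cis\<phi>: "((\<lambda>y. cis (?\<phi> y)) has_derivative (\<lambda>v. \<i> * of_real (\<phi>' x v) * cis (?\<phi> x))) (at x)" for x
  proof -
    have "((\<lambda>y. \<i> * of_real (?\<phi> y)) has_derivative (\<lambda>v. \<i> * of_real (\<phi>' x v))) (at x)"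
      by (intro has_derivative_mult_right has_derivative_of_real \<phi>)
    from has_derivative_compose[OF this DERIV_exp[unfolded has_field_derivative_def]] show ?thesis
      by (simp only: cis_conv_exp mult_ac)
  qed
  have g': "((\<lambda>y. f y * cis (?\<phi> y)) has_derivative g' x) (at x)" for x
    unfolding g'_def[abs_def] by (rule has_derivative_mult[OF f' cis\<phi>])
  have f'_le: "norm (f' x v) \<le> (\<Sum>k\<in>UNIV. C2 k) / (1 + norm x) ^ (CARD('n) + 1) * norm v" for x v
  proof -
    interpret bounded_linear "f' x" using f' by (rule has_derivative_bounded_linear)
    have "f' x v = f' x (\<Sum>k\<in>UNIV. v $ k *\<^sub>R axis k 1)"
      using basis_expansion[of v] by (simp only: scalar_mult_eq_scaleR)
    also have "\<dots> = (\<Sum>k\<in>UNIV. v $ k *\<^sub>R f' x (axis k 1))"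
      by (simp only: sum scaleR)
    finally have "norm (f' x v) \<le> (\<Sum>k\<in>UNIV. norm (v $ k *\<^sub>R f' x (axis k 1)))" by (simp only: norm_sum)
    also have "\<dots> \<le> (\<Sum>k\<in>UNIV. norm v * (C2 k / (1 + norm x) ^ (CARD('n) + 1)))"
      unfolding norm_scaleR by (intro sum_mono mult_mono C2 component_le_norm_cart) auto
    also have "\<dots> = (\<Sum>k\<in>UNIV. C2 k) / (1 + norm x) ^ (CARD('n) + 1) * norm v"
      by (simp add: sum_distrib_left[symmetric] sum_divide_distrib[symmetric])
    finally show ?thesis .
  qed
  have \<phi>'_le: "\<bar>\<phi>' x v\<bar> \<le> Q * norm x * norm v" for x v
  proof -
    have "\<bar>\<phi>' x v\<bar> \<le> (\<Sum>k\<in>UNIV. \<bar>q k * (2 * x $ k * v $ k)\<bar>)" unfolding \<phi>'_def by (rule sum_abs)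
    also have "\<dots> \<le> (\<Sum>k\<in>UNIV. (2 * \<bar>q k\<bar>) * (norm x * norm v))"
    proof (rule sum_mono)
      fix k
      have "\<bar>x $ k\<bar> * \<bar>v $ k\<bar> \<le> norm x * norm v" by (intro mult_mono component_le_norm_cart) auto
      then have "(2 * \<bar>q k\<bar>) * (\<bar>x $ k\<bar> * \<bar>v $ k\<bar>) \<le> (2 * \<bar>q k\<bar>) * (norm x * norm v)" by (intro mult_left_mono) auto
      then show "\<bar>q k * (2 * x $ k * v $ k)\<bar> \<le> (2 * \<bar>q k\<bar>) * (norm x * norm v)" by (simp add: abs_mult mult_ac)
    qed
    also have "\<dots> = Q * norm x * norm v" by (simp add: Q_def sum_distrib_right mult.assoc)
    finally show ?thesis .
  qed
  have "onorm (g' x) \<le> C / (1 + norm x) ^ (CARD('n) + 1)" for x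
  proof (rule onorm_bound)
    define p where "p = 1 + norm x"
    have p: "p > 0" "norm x \<le> p" by (auto simp: p_def add_pos_nonneg)
    show "0 \<le> C / (1 + norm x) ^ (CARD('n) + 1)" using C C1_nonneg by simp
    fix v
    have "norm (g' x v) \<le> norm (f x) * \<bar>\<phi>' x v\<bar> + norm (f' x v)"
      unfolding g'_def by (rule order_trans[OF norm_triangle_ineq]) (simp add: norm_mult)
    also have "\<dots> \<le> (C1 / p ^ (CARD('n) + 2)) * (Q * p * norm v) + (\<Sum>k\<in>UNIV. C2 k) / p ^ (CARD('n) + 1) * norm v"
    proof (intro add_mono mult_mono)
      show "norm (f x) \<le> C1 / p ^ (CARD('n) + 2)" using C1[of x] by (simp add: p_def)
      show "\<bar>\<phi>' x v\<bar> \<le> Q * p * norm v"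
        by (rule order_trans[OF \<phi>'_le]) (use p Q in \<open>intro mult_right_mono mult_left_mono; simp\<close>)
      show "norm (f' x v) \<le> (\<Sum>k\<in>UNIV. C2 k) / p ^ (CARD('n) + 1) * norm v" using f'_le[of x v] by (simp add: p_def)
    qed (use C1_nonneg p in auto)
    also have "\<dots> = (C1 * Q + (\<Sum>k\<in>UNIV. C2 k)) / p ^ (CARD('n) + 1) * norm v"
      using p by (simp add: field_simps)
    also have "\<dots> \<le> C / p ^ (CARD('n) + 1) * norm v"
      using p C1_nonneg by (intro mult_right_mono divide_right_mono) (auto simp: C_def)
    finally show "norm (g' x v) \<le> C / (1 + norm x) ^ (CARD('n) + 1) * norm v" by (simp only: p_def)
  qed
  moreover have "norm (f x * cis (?\<phi> x)) \<le> C / (1 + norm x) ^ (CARD('n) + 2)" for x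
  proof -
    have "norm (f x) \<le> C / (1 + norm x) ^ (CARD('n) + 2)"
      by (rule order_trans[OF C1 divide_right_mono[OF C]]) simp
    then show ?thesis by (simp add: norm_mult)
  qed
  ultimately have "decaying_C1 (\<lambda>y. f y * cis (?\<phi> y)) g' C (axis j 1)"
    by unfold_locales (use g' in \<open>simp_all add: axis_in_Basis_iff\<close>)
  then show ?thesis by blast
qed

section \<open>The linear canonical transforms\<close>

definition freq :: "('n::finite \<Rightarrow> real^2^2) \<Rightarrow> real^'n \<Rightarrow> real^'n" where
  "freq A \<omega> = (\<chi> k. \<omega> $ k / mat_b (A k))"

definition chirp_phase :: "('n::finite \<Rightarrow> real^2^2) \<Rightarrow> real^'n \<Rightarrow> real" where
  "chirp_phase A x = (\<Sum>k\<in>UNIV. mat_a (A k) / (2 * mat_b (A k)) * (x $ k)\<^sup>2)"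

text \<open>
  The part of the kernel that does not involve the variable of integration. Its modulus is constant
  (\<open>norm_lct_factor\<close>).
\<close>

definition lct_factor :: "('n::finite \<Rightarrow> real^2^2) \<Rightarrow> real^'n \<Rightarrow> complex" where
  "lct_factor A \<omega> = (\<Prod>k\<in>UNIV. csqrt (1 / (\<i> * of_real (2 * pi * mat_b (A k)))) * cis (mat_d (A k) / (2 * mat_b (A k)) * (\<omega> $ k)\<^sup>2))"

lemma lct_eq_fourier:
  "lct A h \<omega> = lct_factor A \<omega> * fourier (\<lambda>x. h x * cis (chirp_phase A x)) (freq A \<omega>)"
proof -
  have "(\<Prod>k\<in>UNIV. lct_kernel (A k) (x $ k) (\<omega> $ k)) = lct_factor A \<omega> * (cis (chirp_phase A x) * cis (- (x \<bullet> freq A \<omega>)))" for x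
  proof -
    have c1: "cis (chirp_phase A x) = (\<Prod>k\<in>UNIV. cis (mat_a (A k) / (2 * mat_b (A k)) * (x $ k)\<^sup>2))"
      by (simp add: chirp_phase_def prod_cis)
    have c2: "cis (- (x \<bullet> freq A \<omega>)) = (\<Prod>k\<in>UNIV. cis (- (\<omega> $ k * x $ k / mat_b (A k))))"
      by (simp add: prod_cis inner_vec_def freq_def sum_negf mult.commute)
    show ?thesis
      unfolding lct_factor_def c1 c2 prod.distrib[symmetric]
      by (intro prod.cong) (simp_all add: lct_kernel_def cis_conv_exp mult_ac)
  qed
  then have "lct A h \<omega> = (\<integral>x. lct_factor A \<omega> * ((h x * cis (chirp_phase A x)) * cis (- (x \<bullet> freq A \<omega>))) \<partial>lborel)"
    unfolding lct_def by (simp add: mult_ac)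
  then show ?thesis unfolding fourier_def integral_mult_right_zero .
qed

lemma norm_lct_factor:
  "norm (lct_factor A \<omega>) = (\<Prod>k\<in>UNIV. norm (csqrt (1 / (\<i> * of_real (2 * pi * mat_b (A k))))))"
  unfolding lct_factor_def prod_norm[symmetric] by (simp add: norm_mult)

lemma measurable_freq [measurable]: "freq A \<in> borel_measurable borel"
  unfolding freq_def[abs_def] divide_inverse
  by (intro borel_measurable_continuous_onI continuous_intros)

lemma measurable_lct_factor [measurable]: "lct_factor A \<in> borel_measurable borel"
  unfolding lct_factor_def[abs_def] by measurable

lemma lcrt_symbol_eq: "lcrt_symbol A j \<omega> = riesz_symbol (axis j 1) (freq A \<omega>)"
  by (simp add: lcrt_symbol_def riesz_symbol_def freq_def inner_axis)

lemma nn_integral_freq: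
  fixes A :: "'n::finite \<Rightarrow> real^2^2"
  assumes b: "\<And>k. mat_b (A k) \<noteq> 0"
  shows "\<exists>D::real. \<forall>F \<in> borel_measurable borel. (\<integral>\<^sup>+\<omega>. F (freq A \<omega>) \<partial>lborel) = ennreal D * (\<integral>\<^sup>+\<xi>. F \<xi> \<partial>lborel)"
proof -
  define c where "c v = (\<Sum>k\<in>UNIV. v $ k / mat_b (A k))" for v :: "real^'n"
  have c_axis: "c (axis k 1) = 1 / mat_b (A k)" for k
  proof -
    have "c (axis k 1) = (\<Sum>i\<in>UNIV. if i = k then 1 / mat_b (A i) else 0)"
      unfolding c_def by (intro sum.cong) (auto simp: axis_def)
    then show ?thesis by simp
  qed
  have c0: "c v \<noteq> 0" if "v \<in> Basis" for v
    using that b by (auto simp: Basis_vec_def c_axis)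
  have "freq A \<omega> = (\<Sum>v\<in>Basis. (c v * (\<omega> \<bullet> v)) *\<^sub>R v)" for \<omega>
  proof (rule euclidean_eqI)
    fix v :: "real^'n" assume v: "v \<in> Basis"
    then obtain k where k: "v = axis k 1" by (auto simp: Basis_vec_def)
    have "(\<Sum>v\<in>Basis. (c v * (\<omega> \<bullet> v)) *\<^sub>R v) \<bullet> v = c v * (\<omega> \<bullet> v)"
      using v by simp
    then show "freq A \<omega> \<bullet> v = (\<Sum>v\<in>Basis. (c v * (\<omega> \<bullet> v)) *\<^sub>R v) \<bullet> v"
      by (simp add: k c_axis freq_def inner_axis)
  qed
  then show ?thesis using nn_integral_diagonal[of c] c0 by (intro exI[of _ "1 / (\<Prod>v\<in>Basis. \<bar>c v\<bar>)"]) simp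
qed

text \<open>
  Here \<open>a\<^sub>k = d\<^sub>k\<close> enters: the chirp in front of the transform is the inverse of the chirp that the linear canonical
  transform multiplies by, so the two cancel when the transforms are composed.
\<close>

lemma lcrt_eq_riesz_transform:
  fixes A :: "'n::finite \<Rightarrow> real^2^2" and f :: "real^'n \<Rightarrow> complex"
  assumes ad: "\<And>k. mat_a (A k) = mat_d (A k)"
    and dec: "decaying_C1 (\<lambda>y. f y * cis (chirp_phase A y)) g' C (axis j 1)"
  shows "lcrt A j f x = cis (- chirp_phase A x) * riesz_transform (axis j 1) (\<lambda>y. f y * cis (chirp_phase A y)) x"
proof -
  interpret decaying_C1 "\<lambda>y. f y * cis (chirp_phase A y)" g' C "axis j 1" by (rule dec)
  have eq: "of_real (x $ j - y $ j) * f y * exp (\<i> * of_real (\<Sum>k\<in>UNIV. mat_a (A k) / (2 * mat_b (A k)) * (y $ k)\<^sup>2))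
      / of_real (norm (x - y) ^ (CARD('n) + 1)) = of_real (riesz_kernel (axis j 1) (x - y)) * (f y * cis (chirp_phase A y))" for y
    by (simp add: riesz_kernel_def chirp_phase_def cis_conv_exp inner_axis)
  have "Lim (at_right 0) (\<lambda>\<epsilon>. LINT y:{y. norm (x - y) \<ge> \<epsilon>}|lborel. of_real (riesz_kernel (axis j 1) (x - y)) * (f y * cis (chirp_phase A y)))
     = riesz_pv (axis j 1) (\<lambda>y. f y * cis (chirp_phase A y)) x"
    by (intro tendsto_Lim riesz_pv_principal_value) simp
  then show ?thesis
    unfolding lcrt_def eq by (simp add: riesz_transform_def chirp_phase_def cis_conv_exp ad mult_ac)
qed

theorem theorem2p7:
  fixes A :: "'n::finite \<Rightarrow> real^2^2" and j :: 'n and f :: "real^'n \<Rightarrow> complex"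
  assumes "\<And>k. det (A k) = 1"
    and "\<And>k. mat_b (A k) \<noteq> 0"
    and "\<And>k. mat_a (A k) = mat_d (A k)"
    and "schwartz f"
  shows "has_lct_L2 A (lcrt A j f) (\<lambda>\<omega>. lcrt_symbol A j \<omega> * lct A f \<omega>) \<and>
         (\<forall>\<omega>. has_lct_at A (lcrt A j f) \<omega> (lcrt_symbol A j \<omega> * lct A f \<omega>))"
proof -
  define g where "g y = f y * cis (chirp_phase A y)" for y
  obtain g' C where dec: "decaying_C1 g g' C (axis j 1)"
    using schwartz_chirp_decaying_C1[OF assms(4), of "\<lambda>k. mat_a (A k) / (2 * mat_b (A k))" j]
    by (auto simp: g_def[abs_def] chirp_phase_def)
  then interpret decaying_C1 g g' C "axis j 1" .
  let ?R = "riesz_transform (axis j 1) g" and ?m = "riesz_symbol (axis j 1) :: real^'n \<Rightarrow> complex"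
  have lcrt: "lcrt A j f x = cis (- chirp_phase A x) * ?R x" for x
    using lcrt_eq_riesz_transform[OF assms(3) dec[unfolded g_def[abs_def]]] by (simp add: g_def[abs_def])
  have lct_f: "lct A f \<omega> = lct_factor A \<omega> * fourier g (freq A \<omega>)" for \<omega>
    unfolding lct_eq_fourier g_def ..
  have trunc: "lct_trunc A r (lcrt A j f) \<omega> = lct_factor A \<omega> * fourier (\<lambda>x. indicator (cball 0 r) x * ?R x) (freq A \<omega>)" for r \<omega>
  proof -
    have "(indicator (cball 0 r) x * lcrt A j f x) * cis (chirp_phase A x) = indicator (cball 0 r) x * ?R x * (cis (- chirp_phase A x) * cis (chirp_phase A x))" for x
      by (simp add: lcrt mult_ac)
    then have eq: "(indicator (cball 0 r) x * lcrt A j f x) * cis (chirp_phase A x) = indicator (cball 0 r) x * ?R x" for x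
      by (simp add: cis_mult)
    show ?thesis unfolding lct_trunc_def lct_eq_fourier eq ..
  qed
  have target: "lcrt_symbol A j \<omega> * lct A f \<omega> = lct_factor A \<omega> * (?m (freq A \<omega>) * fourier g (freq A \<omega>))" for \<omega>
    by (simp add: lcrt_symbol_eq lct_f mult_ac)
  have pointwise: "has_lct_at A (lcrt A j f) \<omega> (lcrt_symbol A j \<omega> * lct A f \<omega>)" for \<omega>
    unfolding has_lct_at_def trunc target by (intro tendsto_mult_left fourier_riesz_transform)
  have [measurable]: "?m \<in> borel_measurable borel" unfolding riesz_symbol_def[abs_def] by measurable
  have m1: "norm (?m \<xi>) \<le> 1" for \<xi>
    using Basis_le_norm[of "axis j 1" \<xi>] by (auto simp: riesz_symbol_def norm_mult axis_in_Basis_iff divide_le_eq_1 simp del: of_real_divide)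
  define p where "p = (\<Prod>k\<in>UNIV. norm (csqrt (1 / (\<i> * of_real (2 * pi * mat_b (A k))))))"
  have p: "norm (lct_factor A \<omega>) = p" for \<omega> unfolding p_def by (rule norm_lct_factor)
  obtain D where D: "\<And>F. F \<in> borel_measurable borel \<Longrightarrow> (\<integral>\<^sup>+\<omega>. F (freq A \<omega>) \<partial>lborel) = ennreal D * (\<integral>\<^sup>+\<xi>. F \<xi> \<partial>lborel)"
    using nn_integral_freq[of A, OF assms(2)] by blast
  have scale: "(\<integral>\<^sup>+\<omega>. ennreal ((norm (lct_factor A \<omega> * F (freq A \<omega>)))\<^sup>2) \<partial>lborel) = ennreal (p\<^sup>2) * (ennreal D * (\<integral>\<^sup>+\<xi>. ennreal ((norm (F \<xi>))\<^sup>2) \<partial>lborel))"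
    if [measurable]: "F \<in> borel_measurable borel" for F :: "real^'n \<Rightarrow> complex"
  proof -
    have "(\<integral>\<^sup>+\<omega>. ennreal ((norm (lct_factor A \<omega> * F (freq A \<omega>)))\<^sup>2) \<partial>lborel) = (\<integral>\<^sup>+\<omega>. ennreal (p\<^sup>2) * ennreal ((norm (F (freq A \<omega>)))\<^sup>2) \<partial>lborel)"
      by (intro nn_integral_cong) (simp add: norm_mult p power_mult_distrib ennreal_mult)
    also have "\<dots> = ennreal (p\<^sup>2) * (\<integral>\<^sup>+\<omega>. ennreal ((norm (F (freq A \<omega>)))\<^sup>2) \<partial>lborel)"
      by (rule nn_integral_cmult) measurable
    also have "(\<integral>\<^sup>+\<omega>. ennreal ((norm (F (freq A \<omega>)))\<^sup>2) \<partial>lborel) = ennreal D * (\<integral>\<^sup>+\<xi>. ennreal ((norm (F \<xi>))\<^sup>2) \<partial>lborel)"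
      by (rule D) measurable
    finally show ?thesis .
  qed
  have "square_integrable (lcrt A j f)"
  proof -
    have [measurable]: "chirp_phase A \<in> borel_measurable borel" unfolding chirp_phase_def[abs_def] by measurable
    have "lcrt A j f \<in> borel_measurable borel" unfolding lcrt[abs_def] by measurable
    moreover have "integrable lborel (\<lambda>x. (norm (lcrt A j f x))\<^sup>2)"
      unfolding lcrt norm_mult using riesz_transform_square_integrable by simp
    ultimately show ?thesis by (simp add: square_integrable_def)
  qed
  moreover have "square_integrable (\<lambda>\<omega>. lcrt_symbol A j \<omega> * lct A f \<omega>)"
    unfolding square_integrable_def target
  proof
    show "(\<lambda>\<omega>. lct_factor A \<omega> * (?m (freq A \<omega>) * fourier g (freq A \<omega>))) \<in> borel_measurable lborel" by measurable
    show "integrable lborel (\<lambda>\<omega>. (norm (lct_factor A \<omega> * (?m (freq A \<omega>) * fourier g (freq A \<omega>))))\<^sup>2)"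
    proof (rule integrableI_nonneg)
      have gC: "norm (g x) \<le> C" for x
      proof -
        have "C / (1 + norm x) ^ (DIM(real^'n) + 2) \<le> C / 1"
          using C_nonneg by (intro divide_left_mono one_le_power mult_pos_pos zero_less_power add_pos_nonneg) auto
        then show ?thesis using bound[of x] by simp
      qed
      have g2: "integrable lborel (\<lambda>x. (norm (g x))\<^sup>2)"
      proof (rule Bochner_Integration.integrable_bound[OF integrable_mult_right[OF integrable_norm[OF integrable_g], of C]])
        show "AE x in lborel. norm ((norm (g x))\<^sup>2) \<le> norm (C * norm (g x))"
          using C_nonneg gC by (intro always_eventually allI) (simp add: power2_eq_square mult_right_mono)
      qed measurable
      have "(\<integral>\<^sup>+\<omega>. ennreal ((norm (lct_factor A \<omega> * (?m (freq A \<omega>) * fourier g (freq A \<omega>))))\<^sup>2) \<partial>lborel)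
         = ennreal (p\<^sup>2) * (ennreal D * (\<integral>\<^sup>+\<xi>. ennreal ((norm (?m \<xi> * fourier g \<xi>))\<^sup>2) \<partial>lborel))"
        by (rule scale[of "\<lambda>\<xi>. ?m \<xi> * fourier g \<xi>"]) measurable
      also have "\<dots> \<le> ennreal (p\<^sup>2) * (ennreal D * (\<integral>\<^sup>+\<xi>. ennreal ((norm (fourier g \<xi>))\<^sup>2) \<partial>lborel))"
        using m1 by (intro mult_left_mono nn_integral_mono ennreal_leI power_mono) (auto simp: norm_mult mult_left_le_one_le)
      also have "\<dots> \<le> ennreal (p\<^sup>2) * (ennreal D * ennreal ((2 * pi) ^ DIM(real^'n) * (\<integral>x. (norm (g x))\<^sup>2 \<partial>lborel)))"
        by (intro mult_left_mono fourier_L2_le integrable_g g2) auto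
      also have "\<dots> < \<infinity>" by (simp add: ennreal_mult_less_top)
      finally show "(\<integral>\<^sup>+\<omega>. ennreal ((norm (lct_factor A \<omega> * (?m (freq A \<omega>) * fourier g (freq A \<omega>))))\<^sup>2) \<partial>lborel) < \<infinity>" .
      show "(\<lambda>\<omega>. (norm (lct_factor A \<omega> * (?m (freq A \<omega>) * fourier g (freq A \<omega>))))\<^sup>2) \<in> borel_measurable lborel"
        by measurable
    qed simp
  qed
  moreover have "((\<lambda>r. \<integral>\<^sup>+\<omega>. ennreal ((norm (lct_trunc A r (lcrt A j f) \<omega> - lcrt_symbol A j \<omega> * lct A f \<omega>))\<^sup>2) \<partial>lborel) \<longlongrightarrow> 0) at_top"
  proof -
    let ?F = "\<lambda>r. fourier (\<lambda>x. indicator (cball 0 r) x * ?R x)" and ?G = "\<lambda>\<xi>. ?m \<xi> * fourier g \<xi>"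
    have cb [measurable]: "cball 0 r \<in> sets (borel :: (real^'n) measure)" for r by simp
    have RC: "norm (?R x) \<le> riesz_const DIM(real^'n) * bound_const" for x
    proof -
      have "riesz_const DIM(real^'n) * bound_const / (1 + norm x) ^ DIM(real^'n) \<le> riesz_const DIM(real^'n) * bound_const / 1"
        using bound_const_nonneg riesz_const_nonneg by (intro divide_left_mono one_le_power mult_pos_pos zero_less_power add_pos_nonneg mult_nonneg_nonneg) auto
      then show ?thesis using norm_riesz_transform_le[of x] by simp
    qed
    have "((\<lambda>r. \<integral>\<^sup>+\<xi>. ennreal ((norm (?F r \<xi> - ?G \<xi>))\<^sup>2) \<partial>lborel) \<longlongrightarrow> 0) at_top"
      by (rule fourier_ball_L2_tendsto[OF _ _ RC riesz_transform_square_integrable fourier_riesz_transform]) measurable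
    then have "((\<lambda>r. ennreal (p\<^sup>2) * (ennreal D * (\<integral>\<^sup>+\<xi>. ennreal ((norm (?F r \<xi> - ?G \<xi>))\<^sup>2) \<partial>lborel))) \<longlongrightarrow> ennreal (p\<^sup>2) * (ennreal D * 0)) at_top"
      by (intro ennreal_tendsto_cmult) auto
    moreover have "(\<integral>\<^sup>+\<omega>. ennreal ((norm (lct_trunc A r (lcrt A j f) \<omega> - lcrt_symbol A j \<omega> * lct A f \<omega>))\<^sup>2) \<partial>lborel)
        = ennreal (p\<^sup>2) * (ennreal D * (\<integral>\<^sup>+\<xi>. ennreal ((norm (?F r \<xi> - ?G \<xi>))\<^sup>2) \<partial>lborel))" for r
      unfolding trunc target right_diff_distrib[symmetric]
      by (rule scale[of "\<lambda>\<xi>. ?F r \<xi> - ?G \<xi>"]) measurable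
    ultimately show ?thesis by simp
  qed
  ultimately show ?thesis using pointwise by (simp add: has_lct_L2_def)
qed

end
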